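(* Let $0\le k\le\infty$. The complement of every finite dimensional subset of $\mathcal R^{k}_{\ge 0}(\mathbb R^2)$ is continuum-connected. The complement of every closed finite dimensional subset of $\mathcal R^{k}_{\ge 0}(\mathbb R^2)$ is path-connected.
   Context: For $k$ an integer with $k\ge 0$ or $k=\infty$, $\mathcal R^{k}_{\ge 0}(\mathbb R^2)$ denotes the set of all $C^\infty$ complete Riemannian metrics on $\mathbb R^2$ of nonnegative sectional curvature, equipped with the $C^k$ topology, i.e. the topology of $C^k$ uniform convergence on compact sets (uniform convergence on compact sets of the metric coefficients and their partial derivatives of order $\le k$; of all orders if $k=\infty$). This space is separable and metrizable. Dimension means covering dimension (of the subset with the subspace topology). A topological space is continuum-connected if every two of its points lie in a continuum, i.e. a compact connected subspace. *)

theory Defs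
  imports "HOL-Analysis.Analysis" "HOL-Library.Extended_Nat"
begin

section \<open>Partial derivatives and smooth functions\<close>

definition partial_deriv :: "'n::finite \<Rightarrow> (real^'n \<Rightarrow> real) \<Rightarrow> real^'n \<Rightarrow> real" where
  "partial_deriv i f x = frechet_derivative f (at x) (axis i 1)"

definition iter_partial :: "'n::finite list \<Rightarrow> (real^'n \<Rightarrow> real) \<Rightarrow> real^'n \<Rightarrow> real" where
  "iter_partial is f = foldr partial_deriv is f"

text \<open>Differentiability of all iterated partial derivatives makes them all continuous, so
  this is the class \<open>C\<^sup>\<infinity>\<close>.\<close>

definition smooth :: "(real^'n::finite \<Rightarrow> real) \<Rightarrow> bool" where
  "smooth f \<longleftrightarrow> (\<forall>is x. iter_partial is f differentiable (at x))"

section \<open>Riemannian metrics in global coordinates\<close>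

text \<open>A metric on \<open>\<real>\<^sup>n\<close> is given by its Gram matrix \<open>g x\<close> in the standard coordinate frame.\<close>

type_synonym 'n metric_field = "real^'n \<Rightarrow> real^'n^'n"

definition coeff_fun :: "'n::finite metric_field \<Rightarrow> 'n \<Rightarrow> 'n \<Rightarrow> real^'n \<Rightarrow> real" where
  "coeff_fun g i j x = g x $ i $ j"

definition metric_inner :: "'n::finite metric_field \<Rightarrow> real^'n \<Rightarrow> real^'n \<Rightarrow> real^'n \<Rightarrow> real" where
  "metric_inner g x u v = u \<bullet> (g x *v v)"

definition riemannian_metric :: "'n::finite metric_field \<Rightarrow> bool" where
  "riemannian_metric g \<longleftrightarrow>
     (\<forall>i j. smooth (coeff_fun g i j)) \<and>
     (\<forall>x u v. metric_inner g x u v = metric_inner g x v u) \<and>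
     (\<forall>x v. v \<noteq> 0 \<longrightarrow> metric_inner g x v v > 0)"

subsection \<open>Sectional curvature\<close>

definition christoffel :: "'n::finite metric_field \<Rightarrow> 'n \<Rightarrow> 'n \<Rightarrow> 'n \<Rightarrow> real^'n \<Rightarrow> real" where
  "christoffel g l i j x =
     (1/2) * (\<Sum>m\<in>UNIV. matrix_inv (g x) $ l $ m *
       (partial_deriv i (coeff_fun g j m) x + partial_deriv j (coeff_fun g i m) x
         - partial_deriv m (coeff_fun g i j) x))"

text \<open>The coefficient of \<open>\<partial>\<^sub>l\<close> in
  \<open>R(\<partial>\<^sub>i, \<partial>\<^sub>j) \<partial>\<^sub>k = \<nabla>\<^sub>i \<nabla>\<^sub>j \<partial>\<^sub>k - \<nabla>\<^sub>j \<nabla>\<^sub>i \<partial>\<^sub>k\<close>.\<close>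

definition riemann_coeff ::
    "'n::finite metric_field \<Rightarrow> 'n \<Rightarrow> 'n \<Rightarrow> 'n \<Rightarrow> 'n \<Rightarrow> real^'n \<Rightarrow> real" where
  "riemann_coeff g l i j k x =
     partial_deriv i (christoffel g l j k) x - partial_deriv j (christoffel g l i k) x
     + (\<Sum>m\<in>UNIV. christoffel g l i m x * christoffel g m j k x
                - christoffel g l j m x * christoffel g m i k x)"

definition riemann_tensor ::
    "'n::finite metric_field \<Rightarrow> real^'n \<Rightarrow> real^'n \<Rightarrow> real^'n \<Rightarrow> real^'n \<Rightarrow> real^'n" where
  "riemann_tensor g x u v w =
     (\<chi> l. \<Sum>i\<in>UNIV. \<Sum>j\<in>UNIV. \<Sum>k\<in>UNIV. riemann_coeff g l i j k x * u $ i * v $ j * w $ k)"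

text \<open>The sectional curvature at \<open>x\<close> of the plane spanned by linearly independent \<open>u\<close>, \<open>v\<close>;
  with this sign round spheres have positive curvature.\<close>

definition sectional_curvature ::
    "'n::finite metric_field \<Rightarrow> real^'n \<Rightarrow> real^'n \<Rightarrow> real^'n \<Rightarrow> real" where
  "sectional_curvature g x u v =
     metric_inner g x (riemann_tensor g x u v v) u /
     (metric_inner g x u u * metric_inner g x v v - (metric_inner g x u v)\<^sup>2)"

definition nonneg_sectional_curvature :: "'n::finite metric_field \<Rightarrow> bool" where
  "nonneg_sectional_curvature g \<longleftrightarrow>
     (\<forall>x u v. u \<noteq> v \<longrightarrow> independent {u, v} \<longrightarrow> sectional_curvature g x u v \<ge> 0)"

subsection \<open>Completeness\<close>

definition curve_speed :: "'n::finite metric_field \<Rightarrow> (real \<Rightarrow> real^'n) \<Rightarrow> real \<Rightarrow> real" where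
  "curve_speed g c t =
     sqrt (metric_inner g (c t) (vector_derivative c (at t)) (vector_derivative c (at t)))"

definition curve_length :: "'n::finite metric_field \<Rightarrow> (real \<Rightarrow> real^'n) \<Rightarrow> real" where
  "curve_length g c = integral {0..1} (curve_speed g c)"

text \<open>The library's piecewise \<open>C\<^sup>1\<close> notion does not bound the derivative near the break points,
  so integrability of the speed has to be demanded: otherwise curves of infinite length would
  be assigned the default value \<open>0\<close> of the integral. The infimum is unaffected by the
  admission of curves with unbounded but integrable speed.\<close>

definition admissible_curve ::
    "'n::finite metric_field \<Rightarrow> real^'n \<Rightarrow> real^'n \<Rightarrow> (real \<Rightarrow> real^'n) \<Rightarrow> bool" where
  "admissible_curve g x y c \<longleftrightarrow>
     c piecewise_C1_differentiable_on {0..1} \<and> curve_speed g c integrable_on {0..1} \<and>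
     pathstart c = x \<and> pathfinish c = y"

definition riemannian_dist :: "'n::finite metric_field \<Rightarrow> real^'n \<Rightarrow> real^'n \<Rightarrow> real" where
  "riemannian_dist g x y = Inf (curve_length g ` {c. admissible_curve g x y c})"

definition complete_metric :: "'n::finite metric_field \<Rightarrow> bool" where
  "complete_metric g \<longleftrightarrow> Metric_space.mcomplete UNIV (riemannian_dist g)"

section \<open>The space of complete nonnegatively curved metrics on the plane\<close>

definition nonneg_planes :: "2 metric_field set" where
  "nonneg_planes = {g. riemannian_metric g \<and> complete_metric g \<and> nonneg_sectional_curvature g}"

definition Ck_nbhd ::
    "'n::finite metric_field \<Rightarrow> (real^'n) set \<Rightarrow> nat \<Rightarrow> real \<Rightarrow> 'n metric_field set" where
  "Ck_nbhd g K m \<epsilon> =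
     {h. \<forall>x\<in>K. \<forall>i j is. length is \<le> m \<longrightarrow>
           \<bar>iter_partial is (coeff_fun h i j) x - iter_partial is (coeff_fun g i j) x\<bar> < \<epsilon>}"

definition Ck_open :: "enat \<Rightarrow> 2 metric_field set \<Rightarrow> bool" where
  "Ck_open k U \<longleftrightarrow> U \<subseteq> nonneg_planes \<and>
     (\<forall>g\<in>U. \<exists>K m \<epsilon>. compact K \<and> enat m \<le> k \<and> \<epsilon> > 0 \<and> Ck_nbhd g K m \<epsilon> \<inter> nonneg_planes \<subseteq> U)"

definition nonneg_planes_space :: "enat \<Rightarrow> 2 metric_field topology" where
  "nonneg_planes_space k = topology (Ck_open k)"

lemma Ck_nbhd_mono:
  assumes "K \<subseteq> K'" "m \<le> m'" "\<epsilon>' \<le> \<epsilon>"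
  shows "Ck_nbhd g K' m' \<epsilon>' \<subseteq> Ck_nbhd g K m \<epsilon>"
proof
  fix h assume h: "h \<in> Ck_nbhd g K' m' \<epsilon>'"
  show "h \<in> Ck_nbhd g K m \<epsilon>"
    unfolding Ck_nbhd_def mem_Collect_eq
  proof (intro ballI allI impI)
    fix x i j and "is" :: "'a list" assume "x \<in> K" "length is \<le> m"
    then have "x \<in> K'" "length is \<le> m'" using assms by auto
    then have "\<bar>iter_partial is (coeff_fun h i j) x - iter_partial is (coeff_fun g i j) x\<bar> < \<epsilon>'"
      using h unfolding Ck_nbhd_def by blast
    then show "\<bar>iter_partial is (coeff_fun h i j) x - iter_partial is (coeff_fun g i j) x\<bar> < \<epsilon>"
      using assms(3) by linarith
  qed
qed

lemma istopology_Ck_open: "istopology (Ck_open k)"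
  unfolding istopology_def
proof (intro conjI allI impI)
  fix S T assume S: "Ck_open k S" and T: "Ck_open k T"
  show "Ck_open k (S \<inter> T)"
    unfolding Ck_open_def
  proof (intro conjI ballI)
    show "S \<inter> T \<subseteq> nonneg_planes" using S by (auto simp: Ck_open_def)
  next
    fix g assume g: "g \<in> S \<inter> T"
    obtain K m e where 1: "compact K" "enat m \<le> k" "e > 0" "Ck_nbhd g K m e \<inter> nonneg_planes \<subseteq> S"
      using S g unfolding Ck_open_def by blast
    obtain K' m' e' where
      2: "compact K'" "enat m' \<le> k" "e' > 0" "Ck_nbhd g K' m' e' \<inter> nonneg_planes \<subseteq> T"
      using T g unfolding Ck_open_def by blast
    have "Ck_nbhd g (K \<union> K') (max m m') (min e e') \<subseteq> Ck_nbhd g K m e \<inter> Ck_nbhd g K' m' e'"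
      by (intro Int_greatest Ck_nbhd_mono) auto
    then have "Ck_nbhd g (K \<union> K') (max m m') (min e e') \<inter> nonneg_planes \<subseteq> S \<inter> T"
      using 1 2 by blast
    moreover have "compact (K \<union> K')" "enat (max m m') \<le> k" "min e e' > 0"
      using 1 2 by (auto simp: max_def)
    ultimately show "\<exists>K m \<epsilon>. compact K \<and> enat m \<le> k \<and> \<epsilon> > 0 \<and>
        Ck_nbhd g K m \<epsilon> \<inter> nonneg_planes \<subseteq> S \<inter> T"
      by blast
  qed
next
  fix \<K> assume *: "\<forall>K\<in>\<K>. Ck_open k K"
  show "Ck_open k (\<Union>\<K>)"
    unfolding Ck_open_def
  proof (intro conjI ballI)
    show "\<Union>\<K> \<subseteq> nonneg_planes" using * by (auto simp: Ck_open_def)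
  next
    fix g assume "g \<in> \<Union>\<K>"
    then obtain U where U: "U \<in> \<K>" "g \<in> U" by blast
    then have "Ck_open k U" using * by simp
    then obtain K m e where
      1: "compact K" "enat m \<le> k" "e > 0" "Ck_nbhd g K m e \<inter> nonneg_planes \<subseteq> U"
      using U(2) unfolding Ck_open_def by blast
    have "Ck_nbhd g K m e \<inter> nonneg_planes \<subseteq> \<Union>\<K>"
      using 1(4) Union_upper[OF U(1)] by (rule subset_trans)
    with 1(1-3) show "\<exists>K m \<epsilon>. compact K \<and> enat m \<le> k \<and> \<epsilon> > 0 \<and>
        Ck_nbhd g K m \<epsilon> \<inter> nonneg_planes \<subseteq> \<Union>\<K>"
      by (intro exI conjI)
  qed
qed

lemma openin_nonneg_planes_space: "openin (nonneg_planes_space k) = Ck_open k"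
  by (simp add: nonneg_planes_space_def istopology_Ck_open)

lemma topspace_nonneg_planes_space [simp]: "topspace (nonneg_planes_space k) = nonneg_planes"
proof (rule antisym)
  show "topspace (nonneg_planes_space k) \<subseteq> nonneg_planes"
    by (auto simp: topspace_def openin_nonneg_planes_space Ck_open_def)
  have "Ck_open k nonneg_planes"
    unfolding Ck_open_def
    by (auto intro!: exI[of _ "{}"] exI[of _ "0::nat"] exI[of _ "1::real"] simp: zero_enat_def[symmetric])
  then show "nonneg_planes \<subseteq> topspace (nonneg_planes_space k)"
    by (simp add: openin_nonneg_planes_space openin_subset)
qed

section \<open>Covering dimension and continuum-connectedness\<close>

text \<open>Every finite open cover has a finite open refinement of order at most \<open>n\<close>, i.e. with no
  point lying in more than \<open>n + 1\<close> members. Restricting to finite covers is immaterial for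
  metrizable spaces. The empty space satisfies this for all \<open>n\<close>.\<close>

definition covering_dim_le :: "'a topology \<Rightarrow> nat \<Rightarrow> bool" where
  "covering_dim_le X n \<longleftrightarrow>
     (\<forall>\<U>. finite \<U> \<and> (\<forall>U\<in>\<U>. openin X U) \<and> \<Union>\<U> = topspace X \<longrightarrow>
       (\<exists>\<V>. finite \<V> \<and> (\<forall>V\<in>\<V>. openin X V) \<and> \<Union>\<V> = topspace X \<and>
            (\<forall>V\<in>\<V>. \<exists>U\<in>\<U>. V \<subseteq> U) \<and>
            (\<forall>x\<in>topspace X. card {V\<in>\<V>. x \<in> V} \<le> n + 1)))"

definition finite_dimensional :: "'a topology \<Rightarrow> bool" where
  "finite_dimensional X \<longleftrightarrow> (\<exists>n. covering_dim_le X n)"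

definition continuum_connected_space :: "'a topology \<Rightarrow> bool" where
  "continuum_connected_space X \<longleftrightarrow>
     (\<forall>x\<in>topspace X. \<forall>y\<in>topspace X. \<exists>C. compactin X C \<and> connectedin X C \<and> x \<in> C \<and> y \<in> C)"

end

theory Submission
  imports Defs "HOL-Computational_Algebra.Polynomial"
begin

text \<open>
  Any two metrics can be joined explicitly. If \<open>g\<close> is complete and nonnegatively curved, then so is
  \<open>x \<mapsto> g (\<rho> x)\<close> for \<open>\<rho> > 0\<close>, being \<open>1 / \<rho>\<^sup>2\<close> times the pullback of \<open>g\<close> under the scaling by \<open>\<rho>\<close>. As
  \<open>\<rho>\<close> tends to \<open>0\<close> these metrics converge, with all derivatives and uniformly on compact sets, to the flat
  metric with constant coefficients \<open>g 0\<close>. Constant metrics form a convex set, so shrinking \<open>g0\<close> to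
  \<open>g0 0\<close>, moving linearly to \<open>g1 0\<close> and expanding to \<open>g1\<close> is a path from \<open>g0\<close> to \<open>g1\<close>
  (\<open>base_path\<close>).

  To avoid a set \<open>S\<close> of dimension at most \<open>n\<close>, the path is thickened to a family \<open>F p\<close> over the Hilbert
  cube (\<open>metric_interpolating_family\<close>). Coordinate \<open>0\<close> of \<open>p\<close> is the time along the path; the metric
  reached at that time is pulled back under a shear \<open>(x\<^sub>1, x\<^sub>2) \<mapsto> (x\<^sub>1, x\<^sub>2 + f x\<^sub>1)\<close>, where the
  polynomial \<open>f\<close> vanishes at \<open>n + 2\<close> marked points and its slopes there are an amplitude \<open>a\<close> and
  \<open>a * p 1, \<dots>, a * p (n + 1)\<close>. The amplitude is \<open>0\<close> exactly at the two ends. A shear changes the quotient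
  of the coefficients \<open>g\<^sub>1\<^sub>2 / g\<^sub>2\<^sub>2\<close> at a marked point by the slope of \<open>f\<close>, so these quotients nearly recover
  \<open>p 1, \<dots>, p (n + 1)\<close>. While the path moves, its own contribution is bounded and small compared with
  \<open>a\<close>; while \<open>a\<close> is not large, the path rests at one of its ends, which can be told apart at a point
  where \<open>g0\<close> and \<open>g1\<close> differ and on which the shears have no effect. Hence \<open>F p = F p'\<close> with \<open>p i \<le> 1/3\<close> and
  \<open>p' i \<ge> 2/3\<close> happens only at the two end metrics.

  The rest is an argument of Mazurkiewicz. The sets \<open>F ` {p i \<le> 1/3}\<close> and \<open>F ` {p i \<ge> 2/3}\<close>,
  \<open>i = 1, \<dots>, n + 1\<close>, form \<open>n + 1\<close> pairs of compact sets that are disjoint inside \<open>S\<close>. Since \<open>S\<close> has covering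
  dimension at most \<open>n\<close>, the preimages of these pairs can be separated by partitions of the cube with
  no common point over \<open>S\<close> (\<open>finite_order_cover_partitions\<close>). On the other hand, \<open>n + 1\<close> partitions between
  opposite faces of the cube always have a continuum in common that runs from time \<open>0\<close> to time \<open>1\<close>
  (\<open>cube_partitions_continuum\<close>); its image joins the two metrics outside \<open>S\<close>. If \<open>S\<close> is closed, the
  preimage of its complement is open in the cube, which is locally path-connected, so the continuum
  can be replaced by a path.

  Two properties of metrics have to be traced through scaled shears. The sign of the curvature is read
  off from a polynomial \<open>gauss_num\<close> in the coefficients and their derivatives of order at most two, which is
  multiplied by \<open>\<rho>\<^sup>2\<close> (\<open>gauss_num_shear_pullback\<close>). Completeness is preserved because the maps multiply
  Riemannian distances by a constant (\<open>complete_metric_homothety\<close>).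
\<close>

section \<open>Partitions of the Hilbert cube\<close>

definition hilbert_cube :: "(nat \<Rightarrow> real) set" where
  "hilbert_cube = (\<Pi>\<^sub>E i\<in>UNIV. {0..1})"

lemma mem_hilbert_cube: "p \<in> hilbert_cube \<longleftrightarrow> (\<forall>i. 0 \<le> p i \<and> p i \<le> 1)"
  by (auto simp: hilbert_cube_def PiE_UNIV_domain Pi_iff)

lemma compact_hilbert_cube: "compact hilbert_cube"
proof -
  have "compactin (product_topology (\<lambda>i::nat. euclideanreal) UNIV) hilbert_cube"
    unfolding hilbert_cube_def by (subst compactin_PiE) auto
  then show ?thesis
    by (simp add: euclidean_product_topology)
qed

lemma locally_path_connected_hilbert_cube: "locally_path_connected_space (top_of_set hilbert_cube)"
proof -
  have "top_of_set hilbert_cube = product_topology (\<lambda>i::nat. top_of_set {0..1::real}) UNIV"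
    unfolding hilbert_cube_def
    by (simp add: subtopology_product_topology flip: euclidean_product_topology)
  moreover have "{i::nat. \<not> path_connected_space (top_of_set {0..1::real})} = {}"
    using path_connectedin_def[of euclideanreal "{0..1}"]
    by (auto simp: path_connectedin_iff_path_connected_real)
  ultimately show ?thesis
    by (simp add: locally_path_connected_space_product_topology locally_path_connected_real_interval)
qed

lemma tendsto_fun_componentwise:
  fixes f :: "nat \<Rightarrow> nat \<Rightarrow> real"
  assumes "\<And>i. (\<lambda>n. f n i) \<longlonglongrightarrow> l i"
  shows "f \<longlonglongrightarrow> l"
proof -
  have "limitin (product_topology (\<lambda>i::nat. euclideanreal) UNIV) f l sequentially"
    using assms by (auto simp: limitin_componentwise)
  then show ?thesis
    by (simp add: euclidean_product_topology)
qed

lemma continuous_on_coordinate: "continuous_on A (\<lambda>p::nat \<Rightarrow> real. p i)"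
  by (rule continuous_on_subset[OF continuous_on_product_coordinates]) auto

text \<open>The points closer to \<open>P\<close> than to \<open>R\<close> and those closer to \<open>R\<close> than to \<open>P\<close>.\<close>

lemma separated_sets_open_nbhds:
  fixes P R :: "'a::metric_space set"
  assumes "P \<noteq> {}" "R \<noteq> {}" "P \<inter> closure R = {}" "closure P \<inter> R = {}"
  obtains G H where "open G" "open H" "G \<inter> H = {}" "P \<subseteq> G" "R \<subseteq> H"
proof
  let ?G = "{p. infdist p P < infdist p R}" and ?H = "{p. infdist p R < infdist p P}"
  show "open ?G" "open ?H"
    by (auto intro!: open_Collect_less continuous_intros)
  show "?G \<inter> ?H = {}" by auto
  show "P \<subseteq> ?G" "R \<subseteq> ?H"
    using assms in_closure_iff_infdist_zero[of R] in_closure_iff_infdist_zero[of P]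
    by (auto simp: less_le infdist_nonneg)
qed

text \<open>Kuhn's combinatorial lemma, applied to finer and finer grids in the first \<open>N\<close> coordinates, gives grid
  cells which for every \<open>i < N\<close> have vertices inside and outside \<open>G i\<close>. A limit of such cells is in the
  frontier of every \<open>G i\<close>, and as \<open>G i\<close> and \<open>H i\<close> are open and disjoint, this point is in none of
  these sets.\<close>

lemma cube_partitions_intersect:
  fixes G H :: "nat \<Rightarrow> (nat \<Rightarrow> real) set"
  assumes oG: "\<And>i. i < N \<Longrightarrow> open (G i)" and oH: "\<And>i. i < N \<Longrightarrow> open (H i)"
    and disj: "\<And>i. i < N \<Longrightarrow> G i \<inter> H i = {}"
    and G0: "\<And>i p. i < N \<Longrightarrow> p \<in> hilbert_cube \<Longrightarrow> p i = 0 \<Longrightarrow> p \<in> G i"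
    and H1: "\<And>i p. i < N \<Longrightarrow> p \<in> hilbert_cube \<Longrightarrow> p i = 1 \<Longrightarrow> p \<in> H i"
  obtains p where "p \<in> hilbert_cube" "\<And>i. i < N \<Longrightarrow> p \<notin> G i \<union> H i"
proof -
  define grid where "grid m x = (\<lambda>j. if j < N then real (x j) / real (Suc m) else 0)"
    for m and x :: "nat \<Rightarrow> nat"
  have grid_cube: "grid m x \<in> hilbert_cube" if "\<forall>i<N. x i \<le> Suc m" for m x
    using that by (auto simp: mem_hilbert_cube grid_def divide_le_eq_1 simp del: of_nat_Suc)
  define near where "near q r \<longleftrightarrow> (\<forall>j<N. q j \<le> r j \<and> r j \<le> q j + 1)" for q r :: "nat \<Rightarrow> nat"
  have ex: "\<exists>q. (\<forall>i<N. q i < Suc m) \<and>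
      (\<forall>i<N. \<exists>r s. near q r \<and> near q s \<and> grid m r \<in> G i \<and> grid m s \<notin> G i)" for m
  proof -
    \<comment> \<open>Kuhn's lemma wants label \<open>0\<close> on the faces \<open>x i = 0\<close> and label \<open>1\<close> on the opposite ones.\<close>
    define label where "label x i = (if grid m x \<in> G i then 0 else (1::nat))" for x i
    obtain q where q: "\<forall>i<N. q i < Suc m" "\<forall>i<N. \<exists>r s. near q r \<and> near q s \<and> label r i \<noteq> label s i"
    proof (rule kuhn_lemma[of "Suc m" N label, folded near_def])
      show "0 < Suc m" by simp
      show "\<forall>x. (\<forall>i<N. x i \<le> Suc m) \<longrightarrow> (\<forall>i<N. label x i = 0 \<or> label x i = 1)"
        by (simp add: label_def)
      show "\<forall>x. (\<forall>i<N. x i \<le> Suc m) \<longrightarrow> (\<forall>i<N. x i = 0 \<longrightarrow> label x i = 0)"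
        using G0 grid_cube by (simp add: label_def grid_def)
      show "\<forall>x. (\<forall>i<N. x i \<le> Suc m) \<longrightarrow> (\<forall>i<N. x i = Suc m \<longrightarrow> label x i = 1)"
      proof (intro allI impI)
        fix x i assume x: "\<forall>i<N. x i \<le> Suc m" "i < N" "x i = Suc m"
        have "grid m x i = 1" using x by (simp add: grid_def)
        then have "grid m x \<in> H i" using H1[OF x(2) grid_cube[OF x(1)]] by simp
        then show "label x i = 1" using disj[OF x(2)] by (auto simp: label_def)
      qed
    qed (rule that)
    have "\<exists>r s. near q r \<and> near q s \<and> grid m r \<in> G i \<and> grid m s \<notin> G i" if i: "i < N" for i
    proof -
      obtain r s where rs: "near q r" "near q s" "label r i \<noteq> label s i"
        using q(2) i by blast
      show ?thesis
      proof (cases "grid m r \<in> G i")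
        case True
        then have "grid m s \<notin> G i" using rs(3) by (auto simp: label_def)
        with True rs(1,2) show ?thesis by blast
      next
        case False
        then have "grid m s \<in> G i" using rs(3) by (auto simp: label_def split: if_splits)
        with False rs(1,2) show ?thesis by blast
      qed
    qed
    with q(1) show ?thesis by (intro exI[of _ q]) simp
  qed
  have "\<exists>q. \<forall>m. (\<forall>i<N. q m i < Suc m) \<and>
      (\<forall>i<N. \<exists>r s. near (q m) r \<and> near (q m) s \<and> grid m r \<in> G i \<and> grid m s \<notin> G i)"
    by (rule choice) (intro allI ex)
  then obtain q where
    q': "\<forall>m. (\<forall>i<N. q m i < Suc m) \<and>
      (\<forall>i<N. \<exists>r s. near (q m) r \<and> near (q m) s \<and> grid m r \<in> G i \<and> grid m s \<notin> G i)"
    by (elim exE)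
  have q: "q m i < Suc m" if "i < N" for m i
    using q' that by simp
  have rs: "\<exists>r s. near (q m) r \<and> near (q m) s \<and> grid m r \<in> G i \<and> grid m s \<notin> G i" if "i < N" for m i
    using q' that by simp
  have "grid m (q m) \<in> hilbert_cube" for m
    using q by (intro grid_cube) (auto simp: less_imp_le)
  then obtain l \<rho> where l: "l \<in> hilbert_cube" and \<rho>: "strict_mono \<rho>"
    and lim: "((\<lambda>m. grid m (q m)) \<circ> \<rho>) \<longlonglongrightarrow> l"
    using compact_hilbert_cube unfolding compact_eq_seq_compact_metric seq_compact_def by meson
  have lim_near: "(\<lambda>m. grid (\<rho> m) (r m)) \<longlonglongrightarrow> l"
    if r: "\<And>m. near (q (\<rho> m)) (r m)" for r
  proof (rule tendsto_fun_componentwise)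
    fix j
    have 1: "(\<lambda>m. grid (\<rho> m) (q (\<rho> m)) j) \<longlonglongrightarrow> l j"
      using continuous_on_tendsto_compose[OF continuous_on_product_coordinates[of j] lim] by (simp add: o_def)
    have lim0: "(\<lambda>m. 1 / real (Suc (\<rho> m))) \<longlonglongrightarrow> 0"
      using LIMSEQ_subseq_LIMSEQ[OF LIMSEQ_Suc[OF lim_1_over_n] \<rho>] by (simp add: o_def)
    have bd: "\<bar>grid (\<rho> m) (r m) j - grid (\<rho> m) (q (\<rho> m)) j\<bar> \<le> 1 / real (Suc (\<rho> m))" for m
    proof (cases "j < N")
      case True
      then have "\<bar>real (r m j) - real (q (\<rho> m) j)\<bar> \<le> 1"
        using r[of m] by (auto simp: near_def)
      then have "\<bar>real (r m j) - real (q (\<rho> m) j)\<bar> / real (Suc (\<rho> m)) \<le> 1 / real (Suc (\<rho> m))"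
        by (intro divide_right_mono) auto
      moreover have "grid (\<rho> m) (r m) j - grid (\<rho> m) (q (\<rho> m)) j
          = (real (r m j) - real (q (\<rho> m) j)) / real (Suc (\<rho> m))"
        using True by (simp only: grid_def if_True diff_divide_distrib)
      ultimately show ?thesis
        by (simp only: abs_divide abs_of_nat)
    next
      case False
      then have "grid (\<rho> m) (r m) j = 0" "grid (\<rho> m) (q (\<rho> m)) j = 0"
        by (auto simp only: grid_def if_False)
      then show ?thesis by simp
    qed
    have "(\<lambda>m. grid (\<rho> m) (r m) j - grid (\<rho> m) (q (\<rho> m)) j) \<longlonglongrightarrow> 0"
      by (rule Lim_null_comparison[OF _ lim0]) (intro always_eventually allI, simp only: real_norm_def bd)
    from tendsto_add[OF this 1] show "(\<lambda>m. grid (\<rho> m) (r m) j) \<longlonglongrightarrow> l j" by simp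
  qed
  have "l \<notin> G i \<union> H i" if i: "i < N" for i
  proof -
    have "\<exists>r. \<forall>m. near (q (\<rho> m)) (r m) \<and> grid (\<rho> m) (r m) \<in> G i"
    proof (rule choice, rule allI)
      show "\<exists>r. near (q (\<rho> m)) r \<and> grid (\<rho> m) r \<in> G i" for m
        using rs[OF i, of "\<rho> m"] by (elim exE conjE) (intro exI conjI)
    qed
    then obtain r where r: "\<forall>m. near (q (\<rho> m)) (r m) \<and> grid (\<rho> m) (r m) \<in> G i"
      by (elim exE)
    have "\<exists>s. \<forall>m. near (q (\<rho> m)) (s m) \<and> grid (\<rho> m) (s m) \<notin> G i"
    proof (rule choice, rule allI)
      show "\<exists>s. near (q (\<rho> m)) s \<and> grid (\<rho> m) s \<notin> G i" for m
        using rs[OF i, of "\<rho> m"] by (elim exE conjE) (intro exI conjI)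
    qed
    then obtain s where s: "\<forall>m. near (q (\<rho> m)) (s m) \<and> grid (\<rho> m) (s m) \<notin> G i"
      by (elim exE)
    have "l \<in> - H i"
    proof (rule closed_sequentially)
      show "closed (- H i)" using oH[OF i] by (simp only: closed_Compl)
      show "(\<lambda>m. grid (\<rho> m) (r m)) \<longlonglongrightarrow> l" using r by (intro lim_near) (rule conjunct1, rule spec)
      show "grid (\<rho> m) (r m) \<in> - H i" for m
        using r[rule_format, of m] disj[OF i] by (auto simp only:)
    qed
    moreover have "l \<in> - G i"
    proof (rule closed_sequentially)
      show "closed (- G i)" using oG[OF i] by (simp only: closed_Compl)
      show "(\<lambda>m. grid (\<rho> m) (s m)) \<longlonglongrightarrow> l" using s by (intro lim_near) (rule conjunct1, rule spec)
      show "grid (\<rho> m) (s m) \<in> - G i" for m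
        using s[rule_format, of m] by (simp only: Compl_iff not_False_eq_True)
    qed
    ultimately show ?thesis by blast
  qed
  then show ?thesis by (rule that[OF l])
qed

text \<open>Let \<open>L\<close> be the common part of the partitions. If no connected subset of \<open>L\<close> met both faces of coordinate
  \<open>0\<close>, then by the cut wire theorem \<open>L\<close> would split into two relatively open pieces, each containing the
  points of \<open>L\<close> on one of these faces. The pieces would give one more partition, in coordinate \<open>0\<close>, that
  misses \<open>L\<close>, against \<open>cube_partitions_intersect\<close>.\<close>

lemma cube_partitions_continuum:
  fixes G H :: "nat \<Rightarrow> (nat \<Rightarrow> real) set"
  assumes oG: "\<And>i. i \<in> {1..N} \<Longrightarrow> open (G i)" and oH: "\<And>i. i \<in> {1..N} \<Longrightarrow> open (H i)"
    and disj: "\<And>i. i \<in> {1..N} \<Longrightarrow> G i \<inter> H i = {}"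
    and G0: "\<And>i p. i \<in> {1..N} \<Longrightarrow> p \<in> hilbert_cube \<Longrightarrow> p i = 0 \<Longrightarrow> p \<in> G i"
    and H1: "\<And>i p. i \<in> {1..N} \<Longrightarrow> p \<in> hilbert_cube \<Longrightarrow> p i = 1 \<Longrightarrow> p \<in> H i"
  obtains C where "compact C" "connected C" "C \<subseteq> hilbert_cube" "\<exists>p\<in>C. p 0 = 0" "\<exists>p\<in>C. p 0 = 1"
    "\<And>i. i \<in> {1..N} \<Longrightarrow> C \<inter> (G i \<union> H i) = {}"
proof -
  define L where "L = hilbert_cube - (\<Union>i\<in>{1..N}. G i \<union> H i)"
  have compL: "compact L"
    unfolding L_def using oG oH by (intro compact_diff compact_hilbert_cube open_UN ballI) auto
  define face where "face c = {p \<in> hilbert_cube. p 0 = c}" for c :: real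
  have closed_face: "closed (face c)" for c
  proof -
    have "face c = hilbert_cube \<inter> {p. p 0 = c}" by (auto simp: face_def)
    moreover have "closed {p::nat\<Rightarrow>real. p 0 = c}"
      by (intro closed_Collect_eq continuous_on_const continuous_on_coordinate)
    ultimately show ?thesis using compact_imp_closed[OF compact_hilbert_cube] by auto
  qed
  have face_ne: "face 0 \<noteq> {}" "face 1 \<noteq> {}"
  proof -
    have "(\<lambda>_. 0) \<in> face 0" "(\<lambda>_. 1) \<in> face 1" by (auto simp: face_def mem_hilbert_cube)
    then show "face 0 \<noteq> {}" "face 1 \<noteq> {}" by auto
  qed
  have "\<not> separated_between (top_of_set L) (L \<inter> face 0) (L \<inter> face 1)"
  proof
    assume "separated_between (top_of_set L) (L \<inter> face 0) (L \<inter> face 1)"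
    then obtain U V where UV: "openin (top_of_set L) U" "openin (top_of_set L) V" "U \<union> V = L" "disjnt U V"
      "L \<inter> face 0 \<subseteq> U" "L \<inter> face 1 \<subseteq> V"
      unfolding separated_between_def by auto
    have "L - U = V" "L - V = U" "U \<subseteq> L" "V \<subseteq> L"
      using UV(3,4) by (auto simp: disjnt_def)
    then have "closedin (top_of_set L) U" "closedin (top_of_set L) V"
      using UV(1,2) by (auto simp: closedin_def)
    then have cl: "closed U" "closed V"
      using compL closedin_compact compact_imp_closed by blast+
    have "(face 0 \<union> U) \<inter> closure (face 1 \<union> V) = {}" "closure (face 0 \<union> U) \<inter> (face 1 \<union> V) = {}"
      using UV(3-6) cl closed_face by (auto simp: disjnt_def closure_Un face_def)
    then obtain G0' H0' where GH: "open G0'" "open H0'" "G0' \<inter> H0' = {}" "face 0 \<union> U \<subseteq> G0'" "face 1 \<union> V \<subseteq> H0'"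
      by (rule separated_sets_open_nbhds[rotated 2]) (use face_ne in auto)
    \<comment> \<open>The additional partition in coordinate \<open>0\<close> is put in front of the given ones.\<close>
    define GG where "GG i = (if i = 0 then G0' else G i)" for i
    define HH where "HH i = (if i = 0 then H0' else H i)" for i
    have split_index: "i = 0 \<or> i \<in> {1..N}" if "i < Suc N" for i
      using that by auto
    obtain p where p: "p \<in> hilbert_cube" "\<And>i. i < Suc N \<Longrightarrow> p \<notin> GG i \<union> HH i"
    proof (rule cube_partitions_intersect[of "Suc N" GG HH])
      fix i assume i: "i < Suc N"
      show "open (GG i)" "open (HH i)" "GG i \<inter> HH i = {}"
        using split_index[OF i] oG oH disj GH(1-3) by (auto simp: GG_def HH_def)
      fix p assume p: "p \<in> hilbert_cube"
      show "p \<in> GG i" if "p i = 0"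
        using split_index[OF i] G0[OF _ p] GH(4) that p by (auto simp: GG_def face_def)
      show "p \<in> HH i" if "p i = 1"
        using split_index[OF i] H1[OF _ p] GH(5) that p by (auto simp: HH_def face_def)
    qed blast
    have "p \<in> L"
      unfolding L_def
    proof (intro DiffI p(1) notI, elim UN_E)
      fix i assume "i \<in> {1..N}" "p \<in> G i \<union> H i"
      then show False using p(2)[of i] by (auto simp: GG_def HH_def)
    qed
    then show False using p(2)[of 0] UV(3) GH(4,5) by (auto simp: GG_def HH_def)
  qed
  then obtain C where C: "connectedin (top_of_set L) C" "\<not> disjnt C (L \<inter> face 0)" "\<not> disjnt C (L \<inter> face 1)"
    using cut_wire_fence_theorem[of "top_of_set L" "L \<inter> face 0" "L \<inter> face 1"] compL closed_face
    by (auto simp: compact_space_subtopology Hausdorff_space_subtopology closedin_closed_Int)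
  have CL: "C \<subseteq> L" "connected C"
    using C(1) by (auto simp: connectedin_subtopology)
  show ?thesis
  proof (rule that[of "closure C"])
    have cL: "closure C \<subseteq> L"
      using CL compL by (simp add: closure_minimal compact_imp_closed)
    then show "compact (closure C)"
      using compact_Int_closed[OF compL closed_closure[of C]] by (simp add: Int_absorb1)
    show "connected (closure C)" using CL(2) by (rule connected_imp_connected_closure)
    show "closure C \<subseteq> hilbert_cube" using cL by (auto simp: L_def)
    show "\<exists>p\<in>closure C. p 0 = 0" "\<exists>p\<in>closure C. p 0 = 1"
      using C(2,3) closure_subset[of C] by (auto simp: disjnt_def face_def)
    show "closure C \<inter> (G i \<union> H i) = {}" if "i \<in> {1..N}" for i
      using cL that by (auto simp: L_def)
  qed
qed

section \<open>Covers of finite order\<close>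

text \<open>A form of Ostrand's theorem: a cover of order \<open>n\<close> has a refinement that consists of \<open>n + 1\<close> families of
  pairwise disjoint open sets. As in a barycentric subdivision, the members are indexed by nonempty sets
  \<open>\<sigma>\<close> of members of the cover, and the families by the size of \<open>\<sigma>\<close>.\<close>

lemma finite_order_cover_colouring:
  fixes M :: "'a::metric_space set"
  assumes fin: "finite \<V>" and op: "\<And>V. V \<in> \<V> \<Longrightarrow> openin (top_of_set M) V" and cov: "\<Union>\<V> = M"
    and ord: "\<And>p. p \<in> M \<Longrightarrow> card {V\<in>\<V>. p \<in> V} \<le> n + 1"
  obtains \<W> where "\<And>i W. W \<in> \<W> i \<Longrightarrow> openin (top_of_set M) W" "\<And>i W. W \<in> \<W> i \<Longrightarrow> \<exists>V\<in>\<V>. W \<subseteq> V"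
    "\<And>i. disjoint (\<W> i)" "M \<subseteq> (\<Union>i\<in>{1..n+1}. \<Union>(\<W> i))"
proof -
  \<comment> \<open>The distance to the empty set is \<open>0\<close> by convention, so \<open>V = M\<close> has to be treated apart to keep \<open>\<phi> V\<close> positive on \<open>V\<close>.\<close>
  define \<phi> where "\<phi> V p = (if V = M then 1 else infdist p (M - V))" for V p
  have VM: "V \<subseteq> M" if "V \<in> \<V>" for V using that cov by blast
  have cont: "continuous_on M (\<phi> V)" for V
    by (cases "V = M") (auto simp: \<phi>_def intro!: continuous_intros)
  have pos: "0 < \<phi> V p \<longleftrightarrow> p \<in> V" if V: "V \<in> \<V>" and p: "p \<in> M" for V p
  proof (cases "V = M")
    case True then show ?thesis using p by (simp add: \<phi>_def)
  next
    case False
    then have ne: "M - V \<noteq> {}" using VM[OF V] by blast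
    have "closedin (top_of_set M) (M - V)" using op[OF V] by (simp add: closedin_diff)
    then obtain T where T: "closed T" "M - V = M \<inter> T" by (auto simp: closedin_closed)
    then have "closure (M - V) \<subseteq> T" by (intro closure_minimal) auto
    then have "p \<in> closure (M - V) \<longleftrightarrow> p \<in> M - V"
      using T(2) p closure_subset[of "M - V"] by blast
    then have "infdist p (M - V) = 0 \<longleftrightarrow> p \<notin> V"
      using in_closure_iff_infdist_zero[OF ne, of p] p by auto
    then show ?thesis using False infdist_nonneg[of p "M - V"] by (auto simp: \<phi>_def less_le)
  qed
  have nonneg: "0 \<le> \<phi> V p" for V p
    by (simp add: \<phi>_def infdist_nonneg)
  \<comment> \<open>If \<open>\<sigma>\<close> and \<open>\<sigma>'\<close> have the same size, neither contains the other, and the conditions for \<open>B \<sigma>\<close> and \<open>B \<sigma>'\<close> contradict each other. A point is in \<open>B \<sigma>\<close> for \<open>\<sigma>\<close> the set of members that contain it.\<close>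
  define B where "B \<sigma> = {p\<in>M. (\<forall>V\<in>\<sigma>. 0 < \<phi> V p) \<and> (\<forall>V\<in>\<sigma>. \<forall>V'\<in>\<V>-\<sigma>. \<phi> V' p < \<phi> V p)}" for \<sigma>
  have openB: "openin (top_of_set M) (B \<sigma>)" if "\<sigma> \<subseteq> \<V>" for \<sigma>
  proof -
    have less: "openin (top_of_set M) {p\<in>M. f p < g p}" if "continuous_on M f" "continuous_on M g" for f g :: "'a \<Rightarrow> real"
    proof -
      have "{p\<in>M. f p < g p} = M \<inter> (\<lambda>p. g p - f p) -` {0<..}" by auto
      then show ?thesis using continuous_openin_preimage_gen[OF continuous_on_diff[OF that(2,1)], of "{0<..}"] by simp
    qed
    have fs: "finite \<sigma>" using that fin finite_subset by blast
    have "B \<sigma> = M \<inter> (\<Inter>V\<in>\<sigma>. {p\<in>M. 0 < \<phi> V p}) \<inter> (\<Inter>V\<in>\<sigma>. \<Inter>V'\<in>\<V>-\<sigma>. {p\<in>M. \<phi> V' p < \<phi> V p})"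
      by (auto simp: B_def)
    also have "\<dots> = M \<inter> \<Inter>((\<lambda>V. {p\<in>M. 0 < \<phi> V p}) ` \<sigma> \<union> (\<lambda>(V,V'). {p\<in>M. \<phi> V' p < \<phi> V p}) ` (\<sigma> \<times> (\<V>-\<sigma>)))"
      by auto
    also have "openin (top_of_set M) \<dots>"
    proof -
      let ?F = "insert M ((\<lambda>V. {p\<in>M. 0 < \<phi> V p}) ` \<sigma> \<union> (\<lambda>(V,V'). {p\<in>M. \<phi> V' p < \<phi> V p}) ` (\<sigma> \<times> (\<V>-\<sigma>)))"
      have "openin (top_of_set M) (\<Inter>?F)"
      proof (rule openin_Inter)
        show "finite ?F" using fs fin by simp
        show "openin (top_of_set M) T" if "T \<in> ?F" for T
          using that less[OF continuous_on_const cont] less[OF cont cont] by auto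
      qed simp
      then show ?thesis by simp
    qed
    finally show ?thesis .
  qed
  define \<W> where "\<W> i = B ` {\<sigma>. \<sigma> \<subseteq> \<V> \<and> \<sigma> \<noteq> {} \<and> card \<sigma> = i}" for i
  show ?thesis
  proof (rule that[of \<W>])
    show "openin (top_of_set M) W" if "W \<in> \<W> i" for i W
      using that openB by (auto simp: \<W>_def)
    show "\<exists>V\<in>\<V>. W \<subseteq> V" if W: "W \<in> \<W> i" for i W
    proof -
      obtain \<sigma> V where \<sigma>: "W = B \<sigma>" "\<sigma> \<subseteq> \<V>" "V \<in> \<sigma>" using W by (auto simp: \<W>_def)
      have "W \<subseteq> V" using \<sigma> pos by (auto simp: B_def)
      then show ?thesis using \<sigma> by blast
    qed
    show "disjoint (\<W> i)" for i
    proof (rule disjointI)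
      fix W W' assume "W \<in> \<W> i" "W' \<in> \<W> i" "W \<noteq> W'"
      then obtain \<sigma> \<sigma>' where s: "W = B \<sigma>" "W' = B \<sigma>'" "\<sigma> \<subseteq> \<V>" "\<sigma>' \<subseteq> \<V>" "card \<sigma> = i" "card \<sigma>' = i" "\<sigma> \<noteq> \<sigma>'"
        by (auto simp: \<W>_def)
      have f: "finite \<sigma>" "finite \<sigma>'" using s fin finite_subset by blast+
      have "\<not> \<sigma> \<subseteq> \<sigma>'" "\<not> \<sigma>' \<subseteq> \<sigma>"
        using card_subset_eq[OF f(1)] card_subset_eq[OF f(2)] s(5-7) by auto
      then obtain V V' where V: "V \<in> \<sigma>" "V \<notin> \<sigma>'" "V' \<in> \<sigma>'" "V' \<notin> \<sigma>" by blast
      have "False" if p: "p \<in> B \<sigma>" "p \<in> B \<sigma>'" for p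
      proof -
        have "\<phi> V' p < \<phi> V p" using p(1) V s(4) by (auto simp: B_def)
        moreover have "\<phi> V p < \<phi> V' p" using p(2) V s(3) by (auto simp: B_def)
        ultimately show False by simp
      qed
      then show "W \<inter> W' = {}" using s(1,2) by blast
    qed
    show "M \<subseteq> (\<Union>i\<in>{1..n+1}. \<Union>(\<W> i))"
    proof
      fix p assume p: "p \<in> M"
      let ?\<sigma> = "{V\<in>\<V>. p \<in> V}"
      have ne: "?\<sigma> \<noteq> {}" using p cov by blast
      have "p \<in> B ?\<sigma>"
      proof -
        have "\<phi> V' p = 0" if "V' \<in> \<V> - ?\<sigma>" for V'
          using pos[of V' p] nonneg[of V' p] that p by auto
        then show ?thesis using p pos by (auto simp: B_def)
      qed
      moreover have "B ?\<sigma> \<in> \<W> (card ?\<sigma>)" using ne by (auto simp: \<W>_def)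
      moreover have "card ?\<sigma> \<in> {1..n+1}"
        using ord[OF p] ne fin by (simp add: Suc_le_eq card_gt_0_iff)
      ultimately show "p \<in> (\<Union>i\<in>{1..n+1}. \<Union>(\<W> i))" by blast
    qed
  qed
qed

text \<open>Each of the \<open>n + 1\<close> disjoint families is used for one pair: a member of the \<open>i\<close>-th family goes to one
  side if it misses \<open>B i\<close>, and to the other side if it does not, in which case it misses \<open>A i\<close>. All
  families together cover \<open>M\<close>, so no point of \<open>M\<close> is left between the two sides for every \<open>i\<close>.\<close>

lemma finite_order_cover_partitions:
  fixes M :: "'a::metric_space set"
  assumes fin: "finite \<V>" and op: "\<And>V. V \<in> \<V> \<Longrightarrow> openin (top_of_set M) V" and cov: "\<Union>\<V> = M"
    and ord: "\<And>p. p \<in> M \<Longrightarrow> card {V\<in>\<V>. p \<in> V} \<le> n + 1"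
    and small: "\<And>V i. V \<in> \<V> \<Longrightarrow> i \<in> {1..n+1} \<Longrightarrow> V \<inter> A i = {} \<or> V \<inter> B i = {}"
  obtains U W where "\<And>i. openin (top_of_set M) (U i)" "\<And>i. openin (top_of_set M) (W i)"
    "\<And>i. U i \<inter> W i = {}" "\<And>i. i \<in> {1..n+1} \<Longrightarrow> U i \<inter> B i = {}" "\<And>i. i \<in> {1..n+1} \<Longrightarrow> W i \<inter> A i = {}"
    "M \<subseteq> (\<Union>i\<in>{1..n+1}. U i \<union> W i)"
proof -
  obtain \<W> where W: "\<And>i W. W \<in> \<W> i \<Longrightarrow> openin (top_of_set M) W" "\<And>i W. W \<in> \<W> i \<Longrightarrow> \<exists>V\<in>\<V>. W \<subseteq> V"
    "\<And>i. disjoint (\<W> i)" "M \<subseteq> (\<Union>i\<in>{1..n+1}. \<Union>(\<W> i))"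
    using finite_order_cover_colouring[OF fin op cov ord] by blast
  define U where "U i = \<Union>{T\<in>\<W> i. T \<inter> B i = {}}" for i
  define W where "W i = \<Union>{T\<in>\<W> i. T \<inter> B i \<noteq> {}}" for i
  show ?thesis
  proof (rule that[of U W])
    show "openin (top_of_set M) (U i)" "openin (top_of_set M) (W i)" for i
      using W(1) by (auto simp: U_def W_def)
    show "U i \<inter> W i = {}" for i
      using disjointD[OF W(3)[of i]] by (fastforce simp: U_def W_def)
    show "U i \<inter> B i = {}" for i by (auto simp: U_def)
    show "W i \<inter> A i = {}" if "i \<in> {1..n+1}" for i
    proof -
      have "T \<inter> A i = {}" if T: "T \<in> \<W> i" "T \<inter> B i \<noteq> {}" for T
      proof -
        obtain V where "V \<in> \<V>" "T \<subseteq> V" using W(2)[OF T(1)] by blast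
        then show ?thesis using small[of V i] T(2) \<open>i \<in> {1..n+1}\<close> by blast
      qed
      then show ?thesis by (auto simp: W_def)
    qed
    show "M \<subseteq> (\<Union>i\<in>{1..n+1}. U i \<union> W i)"
    proof
      fix p assume "p \<in> M"
      then obtain i T where "i \<in> {1..n+1}" "T \<in> \<W> i" "p \<in> T" using W(4) by blast
      moreover from this have "p \<in> U i \<union> W i" by (auto simp: U_def W_def)
      ultimately show "p \<in> (\<Union>i\<in>{1..n+1}. U i \<union> W i)" by blast
    qed
  qed
qed

text \<open>Together with the faces \<open>p i = 0\<close> and \<open>p i = 1\<close>, the two sides of a partition of a subset are still
  separated, because they keep a positive distance in coordinate \<open>i\<close> from the opposite faces.\<close>

lemma extend_partition_to_cube:
  fixes M :: "(nat \<Rightarrow> real) set"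
  assumes U: "openin (top_of_set M) U" and W: "openin (top_of_set M) W" and disj: "U \<inter> W = {}"
    and U2: "\<And>p. p \<in> U \<Longrightarrow> p i \<le> 2/3" and W1: "\<And>p. p \<in> W \<Longrightarrow> 1/3 \<le> p i"
  obtains G H where "open G" "open H" "G \<inter> H = {}" "U \<subseteq> G" "W \<subseteq> H"
    "\<And>p. p \<in> hilbert_cube \<Longrightarrow> p i = 0 \<Longrightarrow> p \<in> G" "\<And>p. p \<in> hilbert_cube \<Longrightarrow> p i = 1 \<Longrightarrow> p \<in> H"
proof -
  define face where "face c = {p::nat\<Rightarrow>real. p i = c}" for c
  have cont: "continuous_on UNIV (\<lambda>p::nat\<Rightarrow>real. p i)" by (rule continuous_on_coordinate)
  have cf: "closed (face c)" for c
    unfolding face_def by (intro closed_Collect_eq continuous_on_const cont)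
  have sep: "closure S \<inter> T = {}" if S: "openin (top_of_set M) S" and T: "openin (top_of_set M) T" and ST: "S \<inter> T = {}" for S T
  proof -
    obtain O' where O': "open O'" "T = M \<inter> O'" using T by (auto simp: openin_open)
    have "S \<subseteq> M" using S openin_imp_subset by blast
    then have "O' \<inter> S = {}" using O' ST by blast
    then have "O' \<inter> closure S = {}" using O' open_Int_closure_eq_empty by blast
    then show ?thesis using O' by blast
  qed
  have "closure U \<subseteq> {p. p i \<le> 2/3}"
    using U2 by (intro closure_minimal closed_Collect_le cont continuous_on_const) auto
  moreover have "closure W \<subseteq> {p. 1/3 \<le> p i}"
    using W1 by (intro closure_minimal closed_Collect_le cont continuous_on_const) auto
  moreover have "face 0 \<inter> {p. 1/3 \<le> p i} = {}" "face 1 \<inter> {p. p i \<le> 2/3} = {}" "face 0 \<inter> face 1 = {}"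
    by (auto simp: face_def)
  moreover have "U \<inter> face 1 = {}" "W \<inter> face 0 = {}"
    using U2 W1 by (force simp: face_def)+
  moreover have "closure W \<inter> U = {}" using sep[OF W U] disj by blast
  moreover note sep[OF U W disj]
  ultimately have "(face 0 \<union> U) \<inter> (face 1 \<union> closure W) = {}" "(face 0 \<union> closure U) \<inter> (face 1 \<union> W) = {}"
    by blast+
  then have "(face 0 \<union> U) \<inter> closure (face 1 \<union> W) = {}" "closure (face 0 \<union> U) \<inter> (face 1 \<union> W) = {}"
    using cf by (simp_all add: closure_Un)
  moreover have "(\<lambda>_. 0) \<in> face 0" "(\<lambda>_. 1) \<in> face 1" by (auto simp: face_def)
  then have "face 0 \<union> U \<noteq> {}" "face 1 \<union> W \<noteq> {}" by blast+
  ultimately obtain G H where "open G" "open H" "G \<inter> H = {}" "face 0 \<union> U \<subseteq> G" "face 1 \<union> W \<subseteq> H"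
    by (metis separated_sets_open_nbhds)
  then show ?thesis by (intro that[of G H]) (auto simp: face_def)
qed

section \<open>Complements of finite dimensional sets\<close>

text \<open>The dimension of \<open>S\<close> is used for the cover of \<open>S\<close> by the sets that, for every \<open>i\<close>, avoid the image of one of
  the slabs \<open>p i \<le> 1/3\<close> and \<open>p i \<ge> 2/3\<close>. The refinement is pulled back to the cube, which does not
  increase its order and makes distance functions available.\<close>

lemma continuum_missing_preimage:
  fixes F :: "(nat \<Rightarrow> real) \<Rightarrow> 'a"
  assumes H: "Hausdorff_space X" and F: "continuous_map (top_of_set hilbert_cube) X F"
    and S: "S \<subseteq> topspace X" and dim: "covering_dim_le (subtopology X S) n"
    and sep: "\<And>p q i. p \<in> hilbert_cube \<Longrightarrow> q \<in> hilbert_cube \<Longrightarrow> i \<in> {1..n+1} \<Longrightarrow>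
      p i \<le> 1/3 \<Longrightarrow> 2/3 \<le> q i \<Longrightarrow> F p = F q \<Longrightarrow> F p \<notin> S"
  obtains C where "compact C" "connected C" "C \<subseteq> hilbert_cube" "\<exists>p\<in>C. p 0 = 0" "\<exists>p\<in>C. p 0 = 1"
    "F ` C \<inter> S = {}"
proof -
  define A where "A i = {p \<in> hilbert_cube. p i \<le> 1/3}" for i
  define B where "B i = {p \<in> hilbert_cube. 2/3 \<le> p i}" for i
  have "closed {p::nat\<Rightarrow>real. p i \<le> 1/3}" "closed {p::nat\<Rightarrow>real. 2/3 \<le> p i}" for i
    by (intro closed_Collect_le continuous_on_const continuous_on_coordinate)+
  then have "compact (hilbert_cube \<inter> {p. p i \<le> 1/3})" "compact (hilbert_cube \<inter> {p. 2/3 \<le> p i})" for i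
    by (intro compact_Int_closed compact_hilbert_cube; simp)+
  moreover have "A i = hilbert_cube \<inter> {p. p i \<le> 1/3}" "B i = hilbert_cube \<inter> {p. 2/3 \<le> p i}" for i
    by (auto simp: A_def B_def)
  ultimately have "compactin (top_of_set hilbert_cube) (A i)" "compactin (top_of_set hilbert_cube) (B i)" for i
    by (auto simp: compactin_subtopology)
  then have clA: "closedin X (F ` A i)" and clB: "closedin X (F ` B i)" for i
    using image_compactin[OF _ F] compactin_imp_closedin[OF H] by blast+
  \<comment> \<open>A set inside \<open>E T\<close> avoids \<open>F ` A i\<close> if \<open>i \<in> T\<close>, and \<open>F ` B i\<close> if not.\<close>
  define E where "E T = S - (\<Union>i\<in>T. F ` A i) - (\<Union>i\<in>{1..n+1}-T. F ` B i)" for T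
  have openE: "openin (subtopology X S) (E T)" if T: "T \<subseteq> {1..n+1}" for T
  proof -
    have "finite T" using T finite_subset by blast
    then have "closedin X ((\<Union>i\<in>T. F ` A i) \<union> (\<Union>i\<in>{1..n+1}-T. F ` B i))"
      using clA clB by (intro closedin_Un closedin_Union) auto
    then have "openin X (topspace X - ((\<Union>i\<in>T. F ` A i) \<union> (\<Union>i\<in>{1..n+1}-T. F ` B i)))"
      by blast
    moreover have "E T = (topspace X - ((\<Union>i\<in>T. F ` A i) \<union> (\<Union>i\<in>{1..n+1}-T. F ` B i))) \<inter> S"
      using S by (auto simp: E_def)
    ultimately show ?thesis by (auto simp: openin_subtopology)
  qed
  have covE: "\<Union>(E ` Pow {1..n+1}) = S"
  proof
    show "S \<subseteq> \<Union>(E ` Pow {1..n+1})"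
    proof
      fix z assume z: "z \<in> S"
      let ?T = "{i\<in>{1..n+1}. z \<notin> F ` A i}"
      have "z \<notin> F ` B i" if i: "i \<in> {1..n+1} - ?T" for i
      proof
        assume "z \<in> F ` B i"
        moreover have "z \<in> F ` A i" using i by blast
        ultimately obtain p q where pq: "z = F p" "p \<in> A i" "z = F q" "q \<in> B i"
          by (elim imageE) simp
        then have "F p \<notin> S"
          using i by (intro sep[of p q i]) (auto simp: A_def B_def)
        then show False using z pq(1) by simp
      qed
      then have "z \<in> E ?T" using z by (auto simp: E_def)
      then show "z \<in> \<Union>(E ` Pow {1..n+1})" by (intro UN_I[of ?T]) auto
    qed
  qed (auto simp: E_def)
  have tS: "topspace (subtopology X S) = S" using S by auto
  obtain \<V> where V: "finite \<V>" "\<And>V. V \<in> \<V> \<Longrightarrow> openin (subtopology X S) V" "\<Union>\<V> = S"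
    "\<And>V. V \<in> \<V> \<Longrightarrow> \<exists>U\<in>E ` Pow {1..n+1}. V \<subseteq> U" "\<And>z. z \<in> S \<Longrightarrow> card {V\<in>\<V>. z \<in> V} \<le> n + 1"
  proof -
    have "finite (E ` Pow {1..n+1}) \<and> (\<forall>U\<in>E ` Pow {1..n+1}. openin (subtopology X S) U) \<and>
        \<Union>(E ` Pow {1..n+1}) = topspace (subtopology X S)"
      using openE covE tS by auto
    from dim[unfolded covering_dim_le_def, rule_format, OF this] obtain \<V> where
      "finite \<V> \<and> (\<forall>V\<in>\<V>. openin (subtopology X S) V) \<and> \<Union>\<V> = S \<and>
       (\<forall>V\<in>\<V>. \<exists>U\<in>E ` Pow {1..n+1}. V \<subseteq> U) \<and> (\<forall>z\<in>S. card {V\<in>\<V>. z \<in> V} \<le> n + 1)"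
      unfolding tS by (elim exE)
    then show ?thesis by (intro that[of \<V>]) simp_all
  qed
  define M where "M = {p\<in>hilbert_cube. F p \<in> S}"
  define pre where "pre V = {p\<in>hilbert_cube. F p \<in> V}" for V
  have U: "\<exists>U W. (\<forall>i. openin (top_of_set M) (U i)) \<and> (\<forall>i. openin (top_of_set M) (W i)) \<and>
    (\<forall>i. U i \<inter> W i = {}) \<and> (\<forall>i\<in>{1..n+1}. U i \<inter> B i = {}) \<and> (\<forall>i\<in>{1..n+1}. W i \<inter> A i = {}) \<and>
    M \<subseteq> (\<Union>i\<in>{1..n+1}. U i \<union> W i)"
  proof (rule finite_order_cover_partitions[of "pre ` \<V>" M n A B])
    show "finite (pre ` \<V>)" using V(1) by blast
    show "\<Union>(pre ` \<V>) = M" using V(3) by (auto simp: pre_def M_def)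
    show "openin (top_of_set M) V'" if V': "V' \<in> pre ` \<V>" for V'
    proof -
      obtain V0 where V0: "V0 \<in> \<V>" "V' = pre V0" using V' by blast
      obtain O' where O': "openin X O'" "V0 = O' \<inter> S" using V(2)[OF V0(1)] by (auto simp: openin_subtopology)
      have "openin (top_of_set hilbert_cube) {p\<in>hilbert_cube. F p \<in> O'}"
        using openin_continuous_map_preimage[OF F O'(1)] by simp
      then obtain Q where "open Q" "{p\<in>hilbert_cube. F p \<in> O'} = hilbert_cube \<inter> Q" by (auto simp: openin_open)
      moreover from this have "V' = M \<inter> Q" using V0(2) O'(2) by (auto simp: pre_def M_def)
      ultimately show ?thesis by (auto simp: openin_open)
    qed
    show "card {V' \<in> pre ` \<V>. p \<in> V'} \<le> n + 1" if p: "p \<in> M" for p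
    proof -
      have "{V' \<in> pre ` \<V>. p \<in> V'} = pre ` {V\<in>\<V>. F p \<in> V}" using p by (auto simp: pre_def M_def)
      then have "card {V' \<in> pre ` \<V>. p \<in> V'} \<le> card {V\<in>\<V>. F p \<in> V}" using V(1) by (simp add: card_image_le)
      also have "\<dots> \<le> n + 1" using V(5) p by (simp add: M_def)
      finally show ?thesis .
    qed
    show "V' \<inter> A i = {} \<or> V' \<inter> B i = {}" if V': "V' \<in> pre ` \<V>" and i: "i \<in> {1..n+1}" for V' i
    proof -
      obtain V0 where V0: "V0 \<in> \<V>" "V' = pre V0" using V' by blast
      obtain T where T: "V0 \<subseteq> E T" using V(4)[OF V0(1)] by blast
      show ?thesis
      proof (cases "i \<in> T")
        case True then have "V0 \<inter> F ` A i = {}" using T by (auto simp: E_def)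
        then show ?thesis by (auto simp: V0(2) pre_def)
      next
        case False then have "V0 \<inter> F ` B i = {}" using T i unfolding E_def by blast
        then show ?thesis by (auto simp: V0(2) pre_def)
      qed
    qed
  qed (intro exI conjI allI ballI; assumption?; blast)
  then obtain U W where UW0: "\<forall>i. openin (top_of_set M) (U i)" "\<forall>i. openin (top_of_set M) (W i)"
    "\<forall>i. U i \<inter> W i = {}" "\<forall>i\<in>{1..n+1}. U i \<inter> B i = {}" "\<forall>i\<in>{1..n+1}. W i \<inter> A i = {}"
    "M \<subseteq> (\<Union>i\<in>{1..n+1}. U i \<union> W i)"
    by (elim exE conjE)
  note UW = UW0(1-5)[rule_format] UW0(6)
  have "\<exists>GH. open (fst GH) \<and> open (snd GH) \<and> fst GH \<inter> snd GH = {} \<and> U i \<subseteq> fst GH \<and> W i \<subseteq> snd GH \<and>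
    (\<forall>p\<in>hilbert_cube. (p i = 0 \<longrightarrow> p \<in> fst GH) \<and> (p i = 1 \<longrightarrow> p \<in> snd GH))" if i: "i \<in> {1..n+1}" for i
  proof -
    have "U i \<subseteq> hilbert_cube" "W i \<subseteq> hilbert_cube"
      using openin_imp_subset[OF UW(1)[of i]] openin_imp_subset[OF UW(2)[of i]] by (auto simp: M_def)
    then have "p i \<le> 2/3" if "p \<in> U i" for p using UW(4)[OF i] that by (force simp: B_def)
    moreover have "1/3 \<le> p i" if "p \<in> W i" for p
      using UW(5)[OF i] that \<open>W i \<subseteq> hilbert_cube\<close> by (force simp: A_def)
    ultimately obtain G H where "open G" "open H" "G \<inter> H = {}" "U i \<subseteq> G" "W i \<subseteq> H"
      "\<And>p. p \<in> hilbert_cube \<Longrightarrow> p i = 0 \<Longrightarrow> p \<in> G" "\<And>p. p \<in> hilbert_cube \<Longrightarrow> p i = 1 \<Longrightarrow> p \<in> H"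
      by (rule extend_partition_to_cube[OF UW(1)[of i] UW(2)[of i] UW(3)[of i], of i]) (assumption | rule that)+
    then show ?thesis by (intro exI[of _ "(G, H)"]) simp
  qed
  then have "\<exists>GH. \<forall>i\<in>{1..n+1}. open (fst (GH i)) \<and> open (snd (GH i)) \<and> fst (GH i) \<inter> snd (GH i) = {} \<and>
     U i \<subseteq> fst (GH i) \<and> W i \<subseteq> snd (GH i) \<and>
    (\<forall>p\<in>hilbert_cube. (p i = 0 \<longrightarrow> p \<in> fst (GH i)) \<and> (p i = 1 \<longrightarrow> p \<in> snd (GH i)))"
    by (intro bchoice ballI)
  then obtain GH where GH: "\<forall>i\<in>{1..n+1}. open (fst (GH i)) \<and> open (snd (GH i)) \<and> fst (GH i) \<inter> snd (GH i) = {} \<and>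
     U i \<subseteq> fst (GH i) \<and> W i \<subseteq> snd (GH i) \<and>
    (\<forall>p\<in>hilbert_cube. (p i = 0 \<longrightarrow> p \<in> fst (GH i)) \<and> (p i = 1 \<longrightarrow> p \<in> snd (GH i)))"
    by (elim exE)
  obtain C where C: "compact C" "connected C" "C \<subseteq> hilbert_cube" "\<exists>p\<in>C. p 0 = 0" "\<exists>p\<in>C. p 0 = 1"
    "\<And>i. i \<in> {1..n+1} \<Longrightarrow> C \<inter> (fst (GH i) \<union> snd (GH i)) = {}"
    by (rule cube_partitions_continuum[of "n+1" "\<lambda>i. fst (GH i)" "\<lambda>i. snd (GH i)"]) (use GH in auto)
  have "F ` C \<inter> S = {}"
  proof (rule ccontr)
    assume "F ` C \<inter> S \<noteq> {}"
    then obtain p where p: "p \<in> C" "F p \<in> S" by blast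
    then have "p \<in> M" using C(3) by (auto simp: M_def)
    then obtain i where i: "i \<in> {1..n+1}" "p \<in> U i \<union> W i" using UW(6) by blast
    then have "p \<in> fst (GH i) \<union> snd (GH i)" using GH i(1) by blast
    then show False using C(6)[OF i(1)] p(1) by blast
  qed
  with C(1-5) show ?thesis by (rule that)
qed

text \<open>Two points outside \<open>S\<close> are joined by a family of paths over the Hilbert cube in which coordinates \<open>1\<close> to
  \<open>n + 1\<close> can be distinguished away from the two points; this suffices, as \<open>S\<close> contains neither of them.\<close>

lemma complement_of_finite_dimensional:
  assumes H: "Hausdorff_space X"
    and family: "\<And>x y n. x \<in> topspace X \<Longrightarrow> y \<in> topspace X \<Longrightarrow> x \<noteq> y \<Longrightarrow>
      \<exists>F. continuous_map (top_of_set hilbert_cube) X F \<and>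
        (\<forall>p\<in>hilbert_cube. (p 0 = 0 \<longrightarrow> F p = x) \<and> (p 0 = 1 \<longrightarrow> F p = y)) \<and>
        (\<forall>p\<in>hilbert_cube. \<forall>q\<in>hilbert_cube. \<forall>i\<in>{1..n+1}.
            p i \<le> 1/3 \<longrightarrow> 2/3 \<le> q i \<longrightarrow> F p = F q \<longrightarrow> F p = x \<or> F p = y)"
    and S: "S \<subseteq> topspace X" and dim: "finite_dimensional (subtopology X S)"
  shows "continuum_connected_space (subtopology X (topspace X - S))"
    and "closedin X S \<Longrightarrow> path_connected_space (subtopology X (topspace X - S))"
proof -
  obtain n where n: "covering_dim_le (subtopology X S) n"
    using dim by (auto simp: finite_dimensional_def)
  let ?Y = "subtopology X (topspace X - S)"
  have main: "\<exists>F C. continuous_map (top_of_set hilbert_cube) X F \<and> compact C \<and> connected C \<and> C \<subseteq> hilbert_cube \<and>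
     x \<in> F ` C \<and> y \<in> F ` C \<and> F ` C \<inter> S = {}" if xy: "x \<in> topspace ?Y" "y \<in> topspace ?Y" "x \<noteq> y" for x y
  proof -
    have xy': "x \<in> topspace X" "y \<in> topspace X" "x \<notin> S" "y \<notin> S" using xy by auto
    obtain F where F: "continuous_map (top_of_set hilbert_cube) X F"
        "\<And>p. p\<in>hilbert_cube \<Longrightarrow> (p 0 = 0 \<longrightarrow> F p = x) \<and> (p 0 = 1 \<longrightarrow> F p = y)"
        and sep: "\<forall>p\<in>hilbert_cube. \<forall>q\<in>hilbert_cube. \<forall>i\<in>{1..n+1}.
            p i \<le> 1/3 \<longrightarrow> 2/3 \<le> q i \<longrightarrow> F p = F q \<longrightarrow> F p = x \<or> F p = y"
      using family[OF xy'(1,2) xy(3), of n] by (elim exE conjE) blast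
    have "F p \<notin> S" if "p \<in> hilbert_cube" "q \<in> hilbert_cube" "i \<in> {1..n+1}" "p i \<le> 1/3" "2/3 \<le> q i" "F p = F q" for p q i
      using sep[rule_format, OF that] xy'(3,4) by auto
    then obtain C where C: "compact C" "connected C" "C \<subseteq> hilbert_cube" "\<exists>p\<in>C. p 0 = 0" "\<exists>p\<in>C. p 0 = 1"
      "F ` C \<inter> S = {}"
      by (rule continuum_missing_preimage[OF H F(1) S n])
    obtain p q where "p \<in> C" "p 0 = 0" "q \<in> C" "q 0 = 1" using C(4,5) by blast
    then have "x \<in> F ` C" "y \<in> F ` C" using F(2) C(3) by blast+
    with F(1) C show ?thesis by (intro exI[of _ F] exI[of _ C] conjI)
  qed
  show "continuum_connected_space ?Y"
    unfolding continuum_connected_space_def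
  proof (intro ballI)
    fix x y assume xy: "x \<in> topspace ?Y" "y \<in> topspace ?Y"
    show "\<exists>C. compactin ?Y C \<and> connectedin ?Y C \<and> x \<in> C \<and> y \<in> C"
    proof (cases "x = y")
      case True
      then show ?thesis using xy by (intro exI[of _ "{x}"]) auto
    next
      case False
      then obtain F C where F: "continuous_map (top_of_set hilbert_cube) X F" "compact C" "connected C" "C \<subseteq> hilbert_cube"
        "x \<in> F ` C" "y \<in> F ` C" "F ` C \<inter> S = {}" using main[OF xy False] by (elim exE conjE)
      have "compactin X (F ` C)" "connectedin X (F ` C)"
        using F(2-4) image_compactin[OF _ F(1)] connectedin_continuous_map_image[OF F(1)]
        by (auto simp: compactin_subtopology connectedin_subtopology)
      moreover from this have "F ` C \<subseteq> topspace X - S"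
        using F(7) compactin_subset_topspace by blast
      ultimately show ?thesis using F(5,6)
        by (intro exI[of _ "F ` C"]) (auto simp: compactin_subtopology connectedin_subtopology)
    qed
  qed
  show "path_connected_space ?Y" if cl: "closedin X S"
    unfolding path_connected_space_def
  proof (intro ballI)
    fix x y assume xy: "x \<in> topspace ?Y" "y \<in> topspace ?Y"
    show "\<exists>g. pathin ?Y g \<and> g 0 = x \<and> g 1 = y"
    proof (cases "x = y")
      case True
      then show ?thesis using xy by (intro exI[of _ "\<lambda>_. x"]) (simp add: pathin_const)
    next
      case False
      then obtain F C where F: "continuous_map (top_of_set hilbert_cube) X F" "compact C" "connected C" "C \<subseteq> hilbert_cube"
        "x \<in> F ` C" "y \<in> F ` C" "F ` C \<inter> S = {}" using main[OF xy False] by (elim exE conjE)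
      obtain p q where pq: "p \<in> C" "F p = x" "q \<in> C" "F q = y" using F(5,6) by blast
      have Fim: "F p \<in> topspace X" if "p \<in> hilbert_cube" for p
        using continuous_map_image_subset_topspace[OF F(1)] that by auto
      define D where "D = {p\<in>hilbert_cube. F p \<in> topspace X - S}"
      have "openin (top_of_set hilbert_cube) D"
        unfolding D_def using openin_continuous_map_preimage[OF F(1), of "topspace X - S"] cl by auto
      then have "locally_path_connected_space (subtopology (top_of_set hilbert_cube) D)"
        by (rule locally_path_connected_space_open_subset[OF locally_path_connected_hilbert_cube])
      moreover have "D \<subseteq> hilbert_cube" by (auto simp: D_def)
      ultimately have lpc: "locally_path_connected_space (top_of_set D)"
        by (simp add: subtopology_subtopology Int_absorb1)
      have CD: "C \<subseteq> D" using F(4,7) Fim by (auto simp: D_def)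
      then have "connected_component_of (top_of_set D) p q"
        unfolding connected_component_of_def using F(3) pq
        by (intro exI[of _ C]) (auto simp: connectedin_subtopology)
      then have "path_component_of (top_of_set D) p q"
        using path_component_eq_connected_component_of[OF lpc, of p] by blast
      then obtain g where g: "pathin (top_of_set D) g" "g 0 = p" "g 1 = q"
        unfolding path_component_of_def by blast
      have "continuous_map (top_of_set D) ?Y F"
      proof -
        have "continuous_map (subtopology (top_of_set hilbert_cube) D) X F"
          using F(1) continuous_map_from_subtopology by blast
        then show ?thesis using \<open>D \<subseteq> hilbert_cube\<close>
          by (auto simp: subtopology_subtopology Int_absorb1 continuous_map_in_subtopology D_def)
      qed
      then have "pathin ?Y (F \<circ> g)" using g(1) pathin_compose by blast
      then show ?thesis using g(2,3) pq by (intro exI[of _ "F \<circ> g"]) auto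
    qed
  qed
qed

section \<open>Partial derivatives and smooth families of functions\<close>

lemma partial_deriv_eq:
  assumes "(f has_derivative f') (at x)"
  shows "partial_deriv i f x = f' (axis i 1)"
  using frechet_derivative_at[OF assms] by (simp add: partial_deriv_def)

lemma has_derivative_frechet: "f differentiable at x \<Longrightarrow> (f has_derivative frechet_derivative f (at x)) (at x)"
  by (simp only: frechet_derivative_works)

lemma frechet_derivative_eq_partial:
  fixes f :: "real^'n::finite \<Rightarrow> real"
  assumes "f differentiable at x"
  shows "frechet_derivative f (at x) v = (\<Sum>k\<in>UNIV. v $ k * partial_deriv k f x)"
proof -
  note lin = has_derivative_linear[OF has_derivative_frechet[OF assms]]
  have "frechet_derivative f (at x) v = frechet_derivative f (at x) (\<Sum>k\<in>UNIV. v $ k *\<^sub>R axis k 1)"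
    using basis_expansion[of v] by (simp add: scalar_mult_eq_scaleR)
  then show ?thesis by (simp add: linear_sum[OF lin] linear_cmul[OF lin] partial_deriv_def)
qed

lemma partial_deriv_add:
  assumes "f differentiable at x" "g differentiable at x"
  shows "partial_deriv i (\<lambda>x. f x + g x) x = partial_deriv i f x + partial_deriv i g x"
  unfolding partial_deriv_eq[OF has_derivative_add[OF assms[THEN has_derivative_frechet]]]
  by (simp add: partial_deriv_def)

lemma partial_deriv_diff:
  assumes "f differentiable at x" "g differentiable at x"
  shows "partial_deriv i (\<lambda>x. f x - g x) x = partial_deriv i f x - partial_deriv i g x"
  unfolding partial_deriv_eq[OF has_derivative_diff[OF assms[THEN has_derivative_frechet]]]
  by (simp add: partial_deriv_def)

lemma partial_deriv_mult:
  assumes "f differentiable at x" "g differentiable at x"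
  shows "partial_deriv i (\<lambda>x. f x * g x) x = f x * partial_deriv i g x + partial_deriv i f x * g x"
  unfolding partial_deriv_eq[OF has_derivative_mult[OF assms[THEN has_derivative_frechet]]]
  by (simp add: partial_deriv_def)

lemma partial_deriv_const: "partial_deriv i (\<lambda>_. c) x = 0"
  using partial_deriv_eq[OF has_derivative_const] .

lemma partial_deriv_cmult:
  assumes "f differentiable at x"
  shows "partial_deriv i (\<lambda>x. c * f x) x = c * partial_deriv i f x"
  using partial_deriv_mult[OF differentiable_const assms, of i c] by (simp add: partial_deriv_const)

lemma iter_partial_Nil [simp]: "iter_partial [] f = f"
  by (simp add: iter_partial_def)

lemma iter_partial_snoc: "iter_partial (is @ [i]) f = iter_partial is (partial_deriv i f)"
  by (simp add: iter_partial_def)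

text \<open>Families of functions on \<open>\<real>\<^sup>n\<close> whose partial derivatives up to the given order exist and are continuous in the
  parameter and the point together. By the joint continuity, nearby parameters give functions that are
  close uniformly on compact sets.\<close>

primrec jointly_C :: "nat \<Rightarrow> ('p::topological_space \<Rightarrow> real^'n::finite \<Rightarrow> real) \<Rightarrow> bool" where
  "jointly_C 0 f \<longleftrightarrow> (\<forall>p x. f p differentiable at x) \<and> continuous_on UNIV (\<lambda>(p, x). f p x)"
| "jointly_C (Suc m) f \<longleftrightarrow> (\<forall>p x. f p differentiable at x) \<and> continuous_on UNIV (\<lambda>(p, x). f p x) \<and>
     (\<forall>i. jointly_C m (\<lambda>p. partial_deriv i (f p)))"

definition jointly_smooth :: "('p::topological_space \<Rightarrow> real^'n::finite \<Rightarrow> real) \<Rightarrow> bool" where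
  "jointly_smooth f \<longleftrightarrow> (\<forall>m. jointly_C m f)"

lemma jointly_C_D:
  assumes "jointly_C m f"
  shows "f p differentiable at x" "continuous_on UNIV (\<lambda>(p, x). f p x)"
  using assms by (cases m, simp_all)+

lemma jointly_C_Suc_D: "jointly_C (Suc m) f \<Longrightarrow> jointly_C m f"
proof (induction m arbitrary: f)
  case 0
  then show ?case by simp
next
  case (Suc m)
  have "jointly_C m (\<lambda>p. partial_deriv i (f p))" for i
    using Suc.prems[unfolded jointly_C.simps(2)[of "Suc m"]] by (intro Suc.IH) blast
  then show ?case using jointly_C_D[OF Suc.prems] unfolding jointly_C.simps(2)[of m] by blast
qed

lemma jointly_C_iter_partial:
  assumes "jointly_C m f" "length is \<le> m"
  shows "iter_partial is (f p) differentiable at x"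
    and "continuous_on UNIV (\<lambda>(p, x). iter_partial is (f p) x)"
proof -
  have "(\<forall>p x. iter_partial is (f p) differentiable at x) \<and> continuous_on UNIV (\<lambda>(p, x). iter_partial is (f p) x)"
    using assms
  proof (induction "is" arbitrary: f m rule: rev_induct)
    case Nil
    then show ?case using jointly_C_D by auto
  next
    case (snoc i "is")
    then obtain m' where m': "m = Suc m'" "length is \<le> m'" by (cases m) auto
    then have "jointly_C m' (\<lambda>p. partial_deriv i (f p))" using snoc.prems(1) by simp
    from snoc.IH[OF this m'(2)] show ?case by (simp add: iter_partial_snoc)
  qed
  then show "iter_partial is (f p) differentiable at x" "continuous_on UNIV (\<lambda>(p, x). iter_partial is (f p) x)"
    by auto
qed

lemma smooth_partial_deriv:
  assumes "smooth f" shows "smooth (partial_deriv i f)"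
  unfolding smooth_def
proof (intro allI)
  fix "is" x
  show "iter_partial is (partial_deriv i f) differentiable at x"
    using assms[unfolded smooth_def, rule_format, of "is @ [i]" x] by (simp add: iter_partial_snoc)
qed

lemma smooth_differentiable: "smooth f \<Longrightarrow> f differentiable at x"
  unfolding smooth_def using iter_partial_Nil by metis

lemma smooth_imp_jointly_smooth:
  assumes f: "smooth f" shows "jointly_smooth (\<lambda>_::'p::topological_space. f)"
proof -
  have basic: "(\<forall>x. f differentiable at x) \<and> continuous_on UNIV (\<lambda>z::'p \<times> _. f (snd z))" if "smooth f" for f
  proof -
    have "continuous_on UNIV f"
      using smooth_differentiable[OF that] by (simp add: differentiable_on_def differentiable_imp_continuous_on)
    then have "continuous_on UNIV (\<lambda>z::'p \<times> _. f (snd z))"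
      by (rule continuous_on_compose2) (auto intro: continuous_intros)
    then show ?thesis using smooth_differentiable[OF that] by blast
  qed
  have "jointly_C m (\<lambda>_::'p. f)" if "smooth f" for m f
    using that
  proof (induction m arbitrary: f)
    case 0
    then show ?case using basic[of f] by (simp add: case_prod_unfold)
  next
    case (Suc m)
    then show ?case using basic[of f] smooth_partial_deriv[OF Suc.prems] by (simp add: case_prod_unfold)
  qed
  from this[OF f] show ?thesis by (simp add: jointly_smooth_def)
qed

lemma jointly_smooth_imp_smooth: "jointly_smooth f \<Longrightarrow> smooth (f p)"
  unfolding jointly_smooth_def smooth_def using jointly_C_iter_partial(1) by blast

lemma jointly_smooth_continuous: "jointly_smooth f \<Longrightarrow> continuous_on UNIV (\<lambda>(p, x). iter_partial is (f p) x)"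
  unfolding jointly_smooth_def using jointly_C_iter_partial(2) by blast

lemma jointly_C_param:
  assumes "continuous_on UNIV c"
  shows "jointly_C m (\<lambda>p _. c p)"
proof -
  have "continuous_on UNIV (\<lambda>z::'a \<times> (real^'b). c (fst z))"
    by (rule continuous_on_compose2[OF assms]) (auto intro: continuous_intros)
  moreover have "partial_deriv i (\<lambda>_::real^'b. a) = (\<lambda>_. 0)" for i a
    using partial_deriv_eq[OF has_derivative_const] by blast
  moreover have "jointly_C m (\<lambda>(_::'a) (_::real^'b). 0)"
  proof (induction m)
    case (Suc m)
    have "partial_deriv i (\<lambda>_::real^'b. 0) = (\<lambda>_. 0)" for i
      using partial_deriv_eq[OF has_derivative_const] by blast
    with Suc show ?case by simp
  qed simp
  ultimately show ?thesis
    by (cases m) (simp_all add: case_prod_unfold jointly_C_Suc_D)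
qed

lemma jointly_C_coordinate: "jointly_C m (\<lambda>(_::'p::topological_space) x::real^'n. x $ k)"
proof -
  have "((\<lambda>x::real^'n. x $ k) has_derivative (\<lambda>x. x $ k)) (at x)" for x
    by (rule bounded_linear_imp_has_derivative[OF bounded_linear_vec_nth])
  then have pd: "partial_deriv i (\<lambda>x::real^'n. x $ k) = (\<lambda>_. axis i 1 $ k)" "(\<lambda>x::real^'n. x $ k) differentiable at x" for i x
    using partial_deriv_eq unfolding differentiable_def by blast+
  have "continuous_on UNIV (\<lambda>z::'p \<times> (real^'n). snd z $ k)"
    by (intro continuous_intros)
  then show ?thesis
    by (cases m) (simp_all add: case_prod_unfold pd jointly_C_param)
qed

lemma jointly_C_add:
  assumes "jointly_C m f" "jointly_C m g"
  shows "jointly_C m (\<lambda>p x. f p x + g p x)"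
  using assms
proof (induction m arbitrary: f g)
  case (Suc m)
  have "partial_deriv i (\<lambda>x. f p x + g p x) = (\<lambda>x. partial_deriv i (f p) x + partial_deriv i (g p) x)" for i p
    by (intro ext partial_deriv_add jointly_C_D(1)[OF Suc.prems(1)] jointly_C_D(1)[OF Suc.prems(2)])
  moreover have "continuous_on UNIV (\<lambda>z. (case z of (p, x) \<Rightarrow> f p x) + (case z of (p, x) \<Rightarrow> g p x))"
    using jointly_C_D(2)[OF Suc.prems(1)] jointly_C_D(2)[OF Suc.prems(2)] by (intro continuous_on_add)
  ultimately show ?case
    using Suc.IH Suc.prems by (simp add: case_prod_unfold)
next
  case 0
  have "continuous_on UNIV (\<lambda>z. (case z of (p, x) \<Rightarrow> f p x) + (case z of (p, x) \<Rightarrow> g p x))"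
    using jointly_C_D(2)[OF 0(1)] jointly_C_D(2)[OF 0(2)] by (intro continuous_on_add)
  then show ?case using 0 by (simp add: case_prod_unfold)
qed

lemma jointly_C_sum:
  assumes "finite I" "\<And>i. i \<in> I \<Longrightarrow> jointly_C m (f i)"
  shows "jointly_C m (\<lambda>p x. \<Sum>i\<in>I. f i p x)"
  using assms
  by (induction I rule: finite_induct) (auto intro: jointly_C_add jointly_C_param)

lemma jointly_C_mult:
  fixes f g :: "'p::topological_space \<Rightarrow> real^'n::finite \<Rightarrow> real"
  assumes "jointly_C m f" "jointly_C m g"
  shows "jointly_C m (\<lambda>p x. f p x * g p x)"
proof -
  have basic: "(\<lambda>x. f p x * g p x) differentiable at x" "continuous_on UNIV (\<lambda>(p, x). f p x * g p x)"
    if f: "jointly_C m f" and g: "jointly_C m g" for m p x and f g :: "'p \<Rightarrow> real^'n \<Rightarrow> real"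
  proof -
    show "(\<lambda>x. f p x * g p x) differentiable at x"
      by (intro differentiable_mult jointly_C_D(1)[OF f] jointly_C_D(1)[OF g])
    show "continuous_on UNIV (\<lambda>(p, x). f p x * g p x)"
      using continuous_on_mult[OF jointly_C_D(2)[OF f] jointly_C_D(2)[OF g]] unfolding case_prod_unfold .
  qed
  show ?thesis using assms
  proof (induction m arbitrary: f g)
    case 0
    show ?case unfolding jointly_C.simps using basic[OF 0] by blast
  next
    case (Suc m)
    have "partial_deriv i (\<lambda>x. f p x * g p x) = (\<lambda>x. f p x * partial_deriv i (g p) x + partial_deriv i (f p) x * g p x)" for i p
      by (intro ext partial_deriv_mult jointly_C_D(1)[OF Suc.prems(1)] jointly_C_D(1)[OF Suc.prems(2)])
    moreover have "jointly_C m (\<lambda>p x. f p x * partial_deriv i (g p) x + partial_deriv i (f p) x * g p x)" for i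
      using Suc.prems jointly_C_Suc_D[OF Suc.prems(1)] jointly_C_Suc_D[OF Suc.prems(2)]
      by (intro jointly_C_add Suc.IH) auto
    ultimately show ?case unfolding jointly_C.simps using basic[OF Suc.prems] by (simp only: simp_thms)
  qed
qed

lemma has_derivative_vec_lambda_componentwise:
  fixes \<psi> :: "'m::finite \<Rightarrow> real^'n \<Rightarrow> real"
  assumes "\<And>k. (\<psi> k has_derivative \<psi>' k) (at x)"
  shows "((\<lambda>x. \<chi> k. \<psi> k x) has_derivative (\<lambda>h. \<chi> k. \<psi>' k h)) (at x)"
proof (subst has_derivative_componentwise_within, intro ballI)
  fix b :: "real^'m" assume "b \<in> Basis"
  then obtain k where "b = axis k 1" by (auto simp: Basis_vec_def)
  then show "((\<lambda>x. (\<chi> k. \<psi> k x) \<bullet> b) has_derivative (\<lambda>h. (\<chi> k. \<psi>' k h) \<bullet> b)) (at x)"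
    using assms[of k] by (simp add: inner_axis)
qed

lemma partial_deriv_compose:
  fixes \<psi> :: "'m::finite \<Rightarrow> real^'n \<Rightarrow> real"
  assumes f: "f differentiable at (\<chi> k. \<psi> k x)" and \<psi>: "\<And>k. \<psi> k differentiable at x"
  shows "(\<lambda>x. f (\<chi> k. \<psi> k x)) differentiable at x"
    and "partial_deriv i (\<lambda>x. f (\<chi> k. \<psi> k x)) x =
      (\<Sum>k\<in>UNIV. partial_deriv k f (\<chi> k. \<psi> k x) * partial_deriv i (\<psi> k) x)"
proof -
  define f' where "f' = frechet_derivative f (at (\<chi> k. \<psi> k x))"
  have f': "(f has_derivative f') (at (\<chi> k. \<psi> k x))"
    unfolding f'_def by (rule has_derivative_frechet[OF f])
  have D: "((\<lambda>x. f (\<chi> k. \<psi> k x)) has_derivative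
      (\<lambda>h. f' (\<chi> k. frechet_derivative (\<psi> k) (at x) h))) (at x)"
    by (rule has_derivative_compose[OF has_derivative_vec_lambda_componentwise[OF has_derivative_frechet[OF \<psi>]] f'])
  then show "(\<lambda>x. f (\<chi> k. \<psi> k x)) differentiable at x" by (rule differentiableI)
  show "partial_deriv i (\<lambda>x. f (\<chi> k. \<psi> k x)) x =
      (\<Sum>k\<in>UNIV. partial_deriv k f (\<chi> k. \<psi> k x) * partial_deriv i (\<psi> k) x)"
    unfolding partial_deriv_eq[OF D] f'_def frechet_derivative_eq_partial[OF f]
    by (simp add: partial_deriv_def mult.commute)
qed

text \<open>By the chain rule a first derivative of the composition is a sum of products, in which the derivatives
  of \<open>f\<close> are again composed with \<open>\<psi>\<close>; this is why the induction varies \<open>f\<close> only.\<close>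

lemma jointly_C_compose:
  fixes \<psi> :: "'m::finite \<Rightarrow> 'p::topological_space \<Rightarrow> real^'n \<Rightarrow> real"
  assumes "jointly_C m f" "\<And>k. jointly_C m (\<psi> k)"
  shows "jointly_C m (\<lambda>p x. f p (\<chi> k. \<psi> k p x))"
proof -
  have basic: "(\<forall>p x. (\<lambda>x. f p (\<chi> k. \<psi> k p x)) differentiable at x) \<and> continuous_on UNIV (\<lambda>(p, x). f p (\<chi> k. \<psi> k p x))"
    if f: "jointly_C m f" and \<psi>: "\<And>k. jointly_C m (\<psi> k)" for m f and \<psi> :: "'m \<Rightarrow> 'p \<Rightarrow> real^'n \<Rightarrow> real"
  proof -
    have "continuous_on UNIV (\<lambda>z. (\<lambda>(p, y). f p y) (fst z, \<chi> k. \<psi> k (fst z) (snd z)))"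
      using jointly_C_D(2)[OF \<psi>]
      by (intro continuous_on_compose2[OF jointly_C_D(2)[OF f]] continuous_on_Pair continuous_on_fst continuous_on_id
          continuous_on_vec_lambda) (auto simp: case_prod_unfold)
    then show ?thesis
      using jointly_C_D(1)[OF f] jointly_C_D(1)[OF \<psi>]
      by (auto simp: case_prod_unfold intro!: partial_deriv_compose(1))
  qed
  show ?thesis using assms
  proof (induction m arbitrary: f)
    case 0
    then show ?case using basic[of 0 f \<psi>] by simp
  next
    case (Suc m)
    have "partial_deriv i (\<lambda>x. f p (\<chi> k. \<psi> k p x)) =
       (\<lambda>x. \<Sum>k\<in>UNIV. partial_deriv k (f p) (\<chi> k. \<psi> k p x) * partial_deriv i (\<psi> k p) x)" for i p
      by (intro ext partial_deriv_compose(2) jointly_C_D(1)[OF Suc.prems(1)] jointly_C_D(1)[OF Suc.prems(2)])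
    moreover have "jointly_C m (\<lambda>p x. \<Sum>k\<in>UNIV. partial_deriv k (f p) (\<chi> k. \<psi> k p x) * partial_deriv i (\<psi> k p) x)" for i
      using Suc.prems jointly_C_Suc_D[OF Suc.prems(2)]
      by (intro jointly_C_sum jointly_C_mult Suc.IH) auto
    ultimately show ?case using basic[OF Suc.prems] by simp
  qed
qed

lemma jointly_smooth_intros:
  shows jointly_smooth_param: "continuous_on UNIV c \<Longrightarrow> jointly_smooth (\<lambda>p _. c p)"
    and jointly_smooth_coordinate: "jointly_smooth (\<lambda>_ x. x $ k)"
    and jointly_smooth_add: "jointly_smooth f \<Longrightarrow> jointly_smooth g \<Longrightarrow> jointly_smooth (\<lambda>p x. f p x + g p x)"
    and jointly_smooth_mult: "jointly_smooth f \<Longrightarrow> jointly_smooth g \<Longrightarrow> jointly_smooth (\<lambda>p x. f p x * g p x)"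
    and jointly_smooth_sum: "finite I \<Longrightarrow> (\<And>i. i \<in> I \<Longrightarrow> jointly_smooth (F i)) \<Longrightarrow> jointly_smooth (\<lambda>p x. \<Sum>i\<in>I. F i p x)"
    and jointly_smooth_compose: "jointly_smooth f \<Longrightarrow> (\<And>k. jointly_smooth (\<psi> k)) \<Longrightarrow> jointly_smooth (\<lambda>p x. f p (\<chi> k. \<psi> k p x))"
  unfolding jointly_smooth_def
  by (auto intro: jointly_C_param jointly_C_coordinate jointly_C_add jointly_C_mult jointly_C_sum jointly_C_compose)

lemma jointly_smooth_poly: "jointly_smooth (\<lambda>(_::'p::topological_space) (x::real^'n). poly q (x $ k))"
proof (induction q)
  case (pCons a q)
  have "jointly_smooth (\<lambda>(_::'p) (x::real^'n). a + x $ k * poly q (x $ k))"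
    by (intro jointly_smooth_add jointly_smooth_mult jointly_smooth_param jointly_smooth_coordinate pCons.IH continuous_on_const)
  then show ?case by simp
qed (simp add: jointly_smooth_param)

section \<open>Continuity into the space of metrics\<close>

text \<open>A neighbourhood in the \<open>C\<^sup>m\<close> topology imposes finitely many conditions, one for each pair of coefficients
  and each list of at most \<open>m\<close> indices, and each of them holds for all nearby parameters by joint continuity
  and compactness of \<open>K\<close>.\<close>

lemma jointly_smooth_near:
  fixes F :: "'p::topological_space \<Rightarrow> 'n::finite metric_field"
  assumes js: "\<And>i j. jointly_smooth (\<lambda>p. coeff_fun (F p) i j)" and K: "compact K" "\<epsilon> > 0"
  obtains N where "open N" "p \<in> N" "\<And>q. q \<in> N \<Longrightarrow> F q \<in> Ck_nbhd (F p) K m \<epsilon>"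
proof -
  define \<Phi> where "\<Phi> = (\<lambda>t q x. iter_partial (snd (snd t)) (coeff_fun (F q) (fst t) (fst (snd t))) x)"
  define I where "I = (UNIV::'n set) \<times> (UNIV::'n set) \<times> {is::'n list. length is \<le> m}"
  have finI: "finite I"
    using finite_lists_length_le[of "UNIV::'n set" m] by (simp add: I_def)
  have "\<exists>N. open N \<and> p \<in> N \<and> (\<forall>q\<in>N. \<forall>x\<in>K. \<bar>\<Phi> t q x - \<Phi> t p x\<bar> < \<epsilon>)" for t
  proof -
    have "continuous_on (UNIV \<times> K) (\<lambda>(q, x). \<Phi> t q x)"
      using jointly_smooth_continuous[OF js] unfolding \<Phi>_def by (rule continuous_on_subset) auto
    then obtain N where N: "p \<in> N" "open N"
      "\<forall>q\<in>N \<inter> UNIV. \<forall>x\<in>K. dist ((\<lambda>(q, x). \<Phi> t q x) (q, x)) ((\<lambda>(q, x). \<Phi> t q x) (p, x)) \<le> \<epsilon>/2"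
      by (rule continuous_on_prod_compactE[OF _ K(1) UNIV_I half_gt_zero[OF K(2)]])
    have "\<bar>\<Phi> t q x - \<Phi> t p x\<bar> < \<epsilon>" if "q \<in> N" "x \<in> K" for q x
    proof -
      have "\<bar>\<Phi> t q x - \<Phi> t p x\<bar> \<le> \<epsilon>/2" using N(3) that by (simp add: dist_real_def)
      then show ?thesis using K(2) by linarith
    qed
    then show ?thesis using N(1,2) by (intro exI[of _ N]) simp
  qed
  then have "\<exists>N. \<forall>t. open (N t) \<and> p \<in> N t \<and> (\<forall>q\<in>N t. \<forall>x\<in>K. \<bar>\<Phi> t q x - \<Phi> t p x\<bar> < \<epsilon>)"
    by (intro choice allI)
  then obtain N where N: "\<forall>t. open (N t) \<and> p \<in> N t \<and> (\<forall>q\<in>N t. \<forall>x\<in>K. \<bar>\<Phi> t q x - \<Phi> t p x\<bar> < \<epsilon>)"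
    by (elim exE)
  show ?thesis
  proof (rule that[of "\<Inter>t\<in>I. N t"])
    show "open (\<Inter>t\<in>I. N t)" using finI N by (intro open_INT) auto
    show "p \<in> (\<Inter>t\<in>I. N t)" using N by auto
    fix q assume q: "q \<in> (\<Inter>t\<in>I. N t)"
    show "F q \<in> Ck_nbhd (F p) K m \<epsilon>"
      unfolding Ck_nbhd_def mem_Collect_eq
    proof (intro ballI allI impI)
      fix x i j and "is" :: "'n list" assume x: "x \<in> K" and l: "length is \<le> m"
      have "q \<in> N (i, j, is)" using q l by (auto simp: I_def)
      then have "\<bar>\<Phi> (i, j, is) q x - \<Phi> (i, j, is) p x\<bar> < \<epsilon>" using N x by blast
      then show "\<bar>iter_partial is (coeff_fun (F q) i j) x - iter_partial is (coeff_fun (F p) i j) x\<bar> < \<epsilon>"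
        by (simp add: \<Phi>_def)
    qed
  qed
qed

lemma continuous_map_nonneg_planes_space:
  fixes F :: "'p::topological_space \<Rightarrow> 2 metric_field"
  assumes js: "\<And>i j. jointly_smooth (\<lambda>p. coeff_fun (F p) i j)" and mem: "\<And>p. p \<in> Y \<Longrightarrow> F p \<in> nonneg_planes"
  shows "continuous_map (top_of_set Y) (nonneg_planes_space k) F"
proof -
  have "openin (top_of_set Y) {p\<in>Y. F p \<in> U}" if "openin (nonneg_planes_space k) U" for U
  proof (subst openin_subopen, intro ballI)
    fix p assume p: "p \<in> {p\<in>Y. F p \<in> U}"
    have "Ck_open k U" using that by (simp add: openin_nonneg_planes_space)
    then obtain K m \<epsilon> where K: "compact K" "\<epsilon> > 0" "Ck_nbhd (F p) K m \<epsilon> \<inter> nonneg_planes \<subseteq> U"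
      using p unfolding Ck_open_def by blast
    obtain N where N: "open N" "p \<in> N" "\<And>q. q \<in> N \<Longrightarrow> F q \<in> Ck_nbhd (F p) K m \<epsilon>"
      using jointly_smooth_near[OF js K(1,2)] by blast
    have "Y \<inter> N \<subseteq> {p\<in>Y. F p \<in> U}" using N(3) K(3) mem by blast
    moreover have "openin (top_of_set Y) (Y \<inter> N)" "p \<in> Y \<inter> N" using N p by auto
    ultimately show "\<exists>T. openin (top_of_set Y) T \<and> p \<in> T \<and> T \<subseteq> {p\<in>Y. F p \<in> U}" by blast
  qed
  then show ?thesis using mem by (auto simp: continuous_map_def)
qed

lemma continuous_map_coeff:
  "continuous_map (nonneg_planes_space k) euclideanreal (\<lambda>g. coeff_fun g i j x)"
  unfolding continuous_map_def
proof (intro conjI allI impI)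
  fix V :: "real set" assume "openin euclideanreal V"
  then have V: "open V" by simp
  show "openin (nonneg_planes_space k) {g \<in> topspace (nonneg_planes_space k). coeff_fun g i j x \<in> V}"
    unfolding openin_nonneg_planes_space Ck_open_def
  proof (intro conjI ballI)
    fix g assume "g \<in> {g \<in> topspace (nonneg_planes_space k). coeff_fun g i j x \<in> V}"
    then obtain e where e: "e > 0" "ball (coeff_fun g i j x) e \<subseteq> V"
      using V open_contains_ball by blast
    have "coeff_fun h i j x \<in> V" if h: "h \<in> Ck_nbhd g {x} 0 e" for h
    proof -
      have "\<bar>iter_partial [] (coeff_fun h i j) x - iter_partial [] (coeff_fun g i j) x\<bar> < e"
        using h unfolding Ck_nbhd_def by blast
      then show ?thesis using e(2) by (auto simp: dist_real_def)
    qed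
    then have "Ck_nbhd g {x} 0 e \<inter> nonneg_planes \<subseteq> {g \<in> topspace (nonneg_planes_space k). coeff_fun g i j x \<in> V}"
      by auto
    then show "\<exists>K m \<epsilon>. compact K \<and> enat m \<le> k \<and> 0 < \<epsilon> \<and>
        Ck_nbhd g K m \<epsilon> \<inter> nonneg_planes \<subseteq> {g \<in> topspace (nonneg_planes_space k). coeff_fun g i j x \<in> V}"
      using e(1) by (intro exI[of _ "{x}"] exI[of _ 0] exI[of _ e]) (simp add: zero_enat_def[symmetric])
  qed auto
qed simp

text \<open>The values of the coefficients at single points already separate metrics.\<close>

lemma Hausdorff_nonneg_planes_space: "Hausdorff_space (nonneg_planes_space k)"
  unfolding Hausdorff_space_def
proof (intro allI impI, elim conjE)
  fix g h :: "2 metric_field"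
  assume gh: "g \<in> topspace (nonneg_planes_space k)" "h \<in> topspace (nonneg_planes_space k)" "g \<noteq> h"
  then obtain x i j where "g x $ i $ j \<noteq> h x $ i $ j" by (auto simp: fun_eq_iff vec_eq_iff)
  then have "coeff_fun g i j x \<noteq> coeff_fun h i j x" by (simp add: coeff_fun_def)
  from hausdorff[OF this] obtain V W where VW: "open V" "open W" "coeff_fun g i j x \<in> V" "coeff_fun h i j x \<in> W" "V \<inter> W = {}"
    by (elim exE conjE)
  let ?pre = "\<lambda>V. {g \<in> topspace (nonneg_planes_space k). coeff_fun g i j x \<in> V}"
  have "openin (nonneg_planes_space k) (?pre V)" "openin (nonneg_planes_space k) (?pre W)"
    using VW(1,2) by (intro openin_continuous_map_preimage[OF continuous_map_coeff]; simp)+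
  moreover have "disjnt (?pre V) (?pre W)" using VW(5) by (auto simp: disjnt_def)
  ultimately show "\<exists>U V. openin (nonneg_planes_space k) U \<and> openin (nonneg_planes_space k) V \<and> g \<in> U \<and> h \<in> V \<and> disjnt U V"
    using gh VW(3,4) by (intro exI[of _ "?pre V"] exI[of _ "?pre W"] conjI) simp_all
qed

section \<open>Curvature of plane metrics\<close>

lemma has_real_derivative_along_axis:
  fixes f :: "real^'n \<Rightarrow> real"
  assumes "f differentiable at (y + s *\<^sub>R axis i 1)"
  shows "((\<lambda>s. f (y + s *\<^sub>R axis i 1)) has_real_derivative partial_deriv i f (y + s *\<^sub>R axis i 1)) (at s)"
proof -
  note f' = has_derivative_frechet[OF assms]
  have "((\<lambda>s. y + s *\<^sub>R axis i 1) has_derivative (\<lambda>h. h *\<^sub>R axis i 1)) (at s)"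
    by (auto intro!: derivative_eq_intros)
  from has_derivative_compose[OF this f']
  have D: "((\<lambda>s. f (y + s *\<^sub>R axis i 1)) has_derivative
     (\<lambda>h. frechet_derivative f (at (y + s *\<^sub>R axis i 1)) (h *\<^sub>R axis i 1))) (at s)" .
  have "frechet_derivative f (at (y + s *\<^sub>R axis i 1)) (h *\<^sub>R axis i 1) = partial_deriv i f (y + s *\<^sub>R axis i 1) * h" for h
    using linear_cmul[OF has_derivative_linear[OF f'], of h "axis i 1"] by (simp add: partial_deriv_def mult.commute)
  with D show ?thesis
    by (simp only: has_field_derivative_def)
qed

text \<open>The mean value theorem, used once in each of the two directions. Exchanging \<open>i\<close> and \<open>j\<close> leaves the
  left-hand side unchanged, which yields the symmetry of second derivatives.\<close>

lemma second_difference_mean_value: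
  fixes f :: "real^'n \<Rightarrow> real"
  assumes f: "smooth f" and h: "0 < h"
  obtains \<xi> \<eta> where "0 < \<xi>" "\<xi> < h" "0 < \<eta>" "\<eta> < h"
    "f (x + h *\<^sub>R axis i 1 + h *\<^sub>R axis j 1) - f (x + h *\<^sub>R axis i 1) - f (x + h *\<^sub>R axis j 1) + f x
      = h * h * partial_deriv j (partial_deriv i f) (x + \<xi> *\<^sub>R axis i 1 + \<eta> *\<^sub>R axis j 1)"
proof -
  let ?ei = "axis i 1 :: real^'n" and ?ej = "axis j 1 :: real^'n"
  note d0 = smooth_differentiable[OF f] and d1 = smooth_differentiable[OF smooth_partial_deriv[OF f]]
  have "\<exists>\<xi>>0. \<xi> < h \<and> (f ((x + h *\<^sub>R ?ej) + h *\<^sub>R ?ei) - f (x + h *\<^sub>R ?ei)) - (f ((x + h *\<^sub>R ?ej) + 0 *\<^sub>R ?ei) - f (x + 0 *\<^sub>R ?ei))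
     = (h - 0) * (partial_deriv i f ((x + h *\<^sub>R ?ej) + \<xi> *\<^sub>R ?ei) - partial_deriv i f (x + \<xi> *\<^sub>R ?ei))"
    by (rule MVT2[OF h]) (intro DERIV_diff has_real_derivative_along_axis d0)
  then obtain \<xi> where \<xi>: "0 < \<xi>" "\<xi> < h"
    "(f ((x + h *\<^sub>R ?ej) + h *\<^sub>R ?ei) - f (x + h *\<^sub>R ?ei)) - (f ((x + h *\<^sub>R ?ej) + 0 *\<^sub>R ?ei) - f (x + 0 *\<^sub>R ?ei))
     = (h - 0) * (partial_deriv i f ((x + h *\<^sub>R ?ej) + \<xi> *\<^sub>R ?ei) - partial_deriv i f (x + \<xi> *\<^sub>R ?ei))" by blast
  have "\<exists>\<eta>>0. \<eta> < h \<and> partial_deriv i f ((x + \<xi> *\<^sub>R ?ei) + h *\<^sub>R ?ej) - partial_deriv i f ((x + \<xi> *\<^sub>R ?ei) + 0 *\<^sub>R ?ej)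
     = (h - 0) * partial_deriv j (partial_deriv i f) ((x + \<xi> *\<^sub>R ?ei) + \<eta> *\<^sub>R ?ej)"
    by (rule MVT2[OF h]) (intro has_real_derivative_along_axis d1)
  then obtain \<eta> where \<eta>: "0 < \<eta>" "\<eta> < h"
    "partial_deriv i f ((x + \<xi> *\<^sub>R ?ei) + h *\<^sub>R ?ej) - partial_deriv i f ((x + \<xi> *\<^sub>R ?ei) + 0 *\<^sub>R ?ej)
     = (h - 0) * partial_deriv j (partial_deriv i f) ((x + \<xi> *\<^sub>R ?ei) + \<eta> *\<^sub>R ?ej)" by blast
  show ?thesis
  proof (rule that[OF \<xi>(1,2) \<eta>(1,2)])
    show "f (x + h *\<^sub>R ?ei + h *\<^sub>R ?ej) - f (x + h *\<^sub>R ?ei) - f (x + h *\<^sub>R ?ej) + f x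
      = h * h * partial_deriv j (partial_deriv i f) (x + \<xi> *\<^sub>R ?ei + \<eta> *\<^sub>R ?ej)"
      using \<xi>(3) \<eta>(3) by (simp add: add.commute add.left_commute)
  qed
qed

lemma partial_deriv_commute:
  fixes f :: "real^'n \<Rightarrow> real"
  assumes f: "smooth f"
  shows "partial_deriv i (partial_deriv j f) x = partial_deriv j (partial_deriv i f) x"
proof (rule ccontr)
  let ?A = "partial_deriv i (partial_deriv j f)" and ?B = "partial_deriv j (partial_deriv i f)"
  assume "?A x \<noteq> ?B x"
  define e where "e = \<bar>?A x - ?B x\<bar> / 2"
  have e: "e > 0" using \<open>?A x \<noteq> ?B x\<close> by (simp add: e_def)
  have "isCont ?A x" "isCont ?B x"
    using smooth_differentiable[OF smooth_partial_deriv[OF smooth_partial_deriv[OF f]]]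
    by (auto intro: differentiable_imp_continuous_within)
  then obtain d1 d2 where d: "d1 > 0" "\<And>y. dist y x < d1 \<Longrightarrow> dist (?A y) (?A x) < e"
     "d2 > 0" "\<And>y. dist y x < d2 \<Longrightarrow> dist (?B y) (?B x) < e"
    using e unfolding continuous_at_eps_delta by metis
  define h where "h = min d1 d2 / 2"
  have h: "h > 0" "2 * h \<le> d1" "2 * h \<le> d2" using d by (auto simp: h_def)
  have near: "dist (x + \<xi> *\<^sub>R axis k 1 + \<eta> *\<^sub>R axis l 1) x < 2 * h"
    if "0 < \<xi>" "\<xi> < h" "0 < \<eta>" "\<eta> < h" for \<xi> \<eta> k l
  proof -
    have "dist (x + \<xi> *\<^sub>R axis k 1 + \<eta> *\<^sub>R axis l 1) x = norm (\<xi> *\<^sub>R axis k 1 + \<eta> *\<^sub>R axis l (1::real))"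
      by (simp add: dist_norm algebra_simps)
    also have "\<dots> \<le> norm (\<xi> *\<^sub>R axis k (1::real)) + norm (\<eta> *\<^sub>R axis l (1::real))" by (rule norm_triangle_ineq)
    finally show ?thesis using that by simp
  qed
  obtain \<xi> \<eta> where 1: "0 < \<xi>" "\<xi> < h" "0 < \<eta>" "\<eta> < h"
    "f (x + h *\<^sub>R axis j 1 + h *\<^sub>R axis i 1) - f (x + h *\<^sub>R axis j 1) - f (x + h *\<^sub>R axis i 1) + f x
      = h * h * ?A (x + \<xi> *\<^sub>R axis j 1 + \<eta> *\<^sub>R axis i 1)"
    by (rule second_difference_mean_value[OF f h(1)])
  obtain \<xi>' \<eta>' where 2: "0 < \<xi>'" "\<xi>' < h" "0 < \<eta>'" "\<eta>' < h"
    "f (x + h *\<^sub>R axis i 1 + h *\<^sub>R axis j 1) - f (x + h *\<^sub>R axis i 1) - f (x + h *\<^sub>R axis j 1) + f x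
      = h * h * ?B (x + \<xi>' *\<^sub>R axis i 1 + \<eta>' *\<^sub>R axis j 1)"
    by (rule second_difference_mean_value[OF f h(1)])
  have "h * h * ?A (x + \<xi> *\<^sub>R axis j 1 + \<eta> *\<^sub>R axis i 1) = h * h * ?B (x + \<xi>' *\<^sub>R axis i 1 + \<eta>' *\<^sub>R axis j 1)"
    using 1(5) 2(5) by (simp add: algebra_simps)
  then have "?A (x + \<xi> *\<^sub>R axis j 1 + \<eta> *\<^sub>R axis i 1) = ?B (x + \<xi>' *\<^sub>R axis i 1 + \<eta>' *\<^sub>R axis j 1)"
    using h(1) by simp
  moreover have "dist (?A (x + \<xi> *\<^sub>R axis j 1 + \<eta> *\<^sub>R axis i 1)) (?A x) < e"
    using near[OF 1(1-4), of j i] h by (intro d(2)) linarith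
  moreover have "dist (?B (x + \<xi>' *\<^sub>R axis i 1 + \<eta>' *\<^sub>R axis j 1)) (?B x) < e"
    using near[OF 2(1-4), of i j] h by (intro d(4)) linarith
  ultimately show False
    by (simp add: dist_real_def e_def abs_if split: if_splits)
qed

lemma matrix_inv_eqI:
  fixes A B :: "real^'n^'n"
  assumes "A ** B = mat 1" "B ** A = mat 1"
  shows "matrix_inv A = B"
proof -
  have "A ** matrix_inv A = mat 1 \<and> matrix_inv A ** A = mat 1"
    unfolding matrix_inv_def by (rule someI[of _ B]) (use assms in simp)
  then show ?thesis
    by (metis assms(1) matrix_mul_assoc matrix_mul_lid matrix_mul_rid)
qed

definition gram_det :: "2 metric_field \<Rightarrow> real^2 \<Rightarrow> real" where
  "gram_det g x = coeff_fun g 1 1 x * coeff_fun g 2 2 x - coeff_fun g 1 2 x * coeff_fun g 1 2 x"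

lemma metric_inner_sum:
  "metric_inner g x u v = (\<Sum>i\<in>UNIV. \<Sum>j\<in>UNIV. u $ i * coeff_fun g i j x * v $ j)"
  by (simp add: metric_inner_def inner_vec_def matrix_vector_mult_def coeff_fun_def sum_distrib_left mult.assoc)

text \<open>Positivity of a symmetric \<open>2 \<times> 2\<close> matrix by its leading principal minors.\<close>

lemma riemannian_metric_plane:
  fixes g :: "2 metric_field"
  shows "riemannian_metric g \<longleftrightarrow> (\<forall>i j. smooth (coeff_fun g i j)) \<and> (\<forall>x. coeff_fun g 2 1 x = coeff_fun g 1 2 x) \<and>
     (\<forall>x. coeff_fun g 1 1 x > 0) \<and> (\<forall>x. gram_det g x > 0)"
    (is "?L \<longleftrightarrow> ?S \<and> ?sym \<and> ?pos \<and> ?det")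
proof
  assume L: ?L
  then have sm: ?S by (simp add: riemannian_metric_def)
  have sym: ?sym
  proof
    fix x
    have "metric_inner g x (axis 1 1) (axis 2 1) = metric_inner g x (axis 2 1) (axis 1 1)"
      using L by (simp add: riemannian_metric_def)
    then show "coeff_fun g 2 1 x = coeff_fun g 1 2 x" by (simp add: metric_inner_sum sum_2 axis_def)
  qed
  have p: "metric_inner g x v v > 0" if "v \<noteq> 0" for x v
    using L that by (simp add: riemannian_metric_def)
  have pos: ?pos
  proof
    fix x
    have "axis 1 1 \<noteq> (0::real^2)" by (simp add: axis_eq_0_iff)
    from p[OF this, of x] show "coeff_fun g 1 1 x > 0"
      by (simp add: metric_inner_sum sum_2 axis_def)
  qed
  have det: ?det
  proof
    fix x
    let ?v = "(\<chi> i. if i = 1 then - coeff_fun g 1 2 x else coeff_fun g 1 1 x) :: real^2"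
    have c: "coeff_fun g 1 1 x > 0" using pos by blast
    then have "?v $ 2 \<noteq> 0" by simp
    then have "?v \<noteq> 0" by (metis zero_index)
    from p[OF this, of x] have "coeff_fun g 1 1 x * gram_det g x > 0"
      using sym by (simp add: metric_inner_sum sum_2 gram_det_def algebra_simps)
    then show "gram_det g x > 0" using c by (simp add: zero_less_mult_iff)
  qed
  show "?S \<and> ?sym \<and> ?pos \<and> ?det" using sm sym pos det by blast
next
  assume R: "?S \<and> ?sym \<and> ?pos \<and> ?det"
  have "metric_inner g x v v > 0" if "v \<noteq> 0" for x v
  proof -
    let ?E = "coeff_fun g 1 1 x" and ?F = "coeff_fun g 1 2 x"
    have E: "?E > 0" and D: "gram_det g x > 0" using R by auto
    have eq: "?E * metric_inner g x v v = (?E * v $ 1 + ?F * v $ 2)\<^sup>2 + gram_det g x * (v $ 2)\<^sup>2"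
      using R by (simp add: metric_inner_sum sum_2 gram_det_def algebra_simps power2_eq_square)
    have "v $ 1 \<noteq> 0 \<or> v $ 2 \<noteq> 0" using that by (auto simp: vec_eq_iff forall_2)
    then have "0 < (?E * v $ 1 + ?F * v $ 2)\<^sup>2 + gram_det g x * (v $ 2)\<^sup>2"
    proof (cases "v $ 2 = 0")
      case True
      then show ?thesis using E \<open>v $ 1 \<noteq> 0 \<or> v $ 2 \<noteq> 0\<close> by simp
    next
      case False
      then have "0 < gram_det g x * (v $ 2)\<^sup>2" using D by simp
      then show ?thesis by (simp add: add_nonneg_pos)
    qed
    then show ?thesis using E unfolding eq[symmetric] by (simp add: zero_less_mult_iff)
  qed
  moreover have "metric_inner g x u v = metric_inner g x v u" for x u v
    using R by (simp add: metric_inner_sum sum_2 algebra_simps)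
  ultimately show ?L using R by (simp add: riemannian_metric_def)
qed

text \<open>\<open>christoffel1 g i j m\<close> is the Christoffel symbol of the first kind.\<close>

definition christoffel1 :: "'n::finite metric_field \<Rightarrow> 'n \<Rightarrow> 'n \<Rightarrow> 'n \<Rightarrow> real^'n \<Rightarrow> real" where
  "christoffel1 g i j m x = (1/2) *
     (partial_deriv i (coeff_fun g j m) x + partial_deriv j (coeff_fun g i m) x - partial_deriv m (coeff_fun g i j) x)"

lemma one_neq_2: "(1::2) \<noteq> 2"
  by simp

lemma matrix_inv_metric:
  fixes g :: "2 metric_field"
  assumes g: "riemannian_metric g"
  shows "matrix_inv (g x) $ 1 $ 1 = coeff_fun g 2 2 x / gram_det g x"
    "matrix_inv (g x) $ 1 $ 2 = - coeff_fun g 1 2 x / gram_det g x"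
    "matrix_inv (g x) $ 2 $ 1 = - coeff_fun g 1 2 x / gram_det g x"
    "matrix_inv (g x) $ 2 $ 2 = coeff_fun g 1 1 x / gram_det g x"
proof -
  have sym: "g x $ 2 $ 1 = g x $ 1 $ 2" and "gram_det g x > 0"
    using g by (auto simp: riemannian_metric_plane coeff_fun_def)
  then have D: "gram_det g x \<noteq> 0" by simp
  have inv: "a * (d / c) + b * (- b / c) = 1" "a * (- b / c) + b * (a / c) = 0" "b * (d / c) + d * (- b / c) = 0"
    "b * (- b / c) + d * (a / c) = 1" "d / c * a + - b / c * b = 1" "d / c * b + - b / c * d = 0"
    "- b / c * a + a / c * b = 0" "- b / c * b + a / c * d = 1"
    if "a * d - b * b = c" "c \<noteq> 0" for a b c d :: real
    using that by (auto simp: field_simps)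
  define B where "B = ((\<chi> i j. (if i = j then (if i = 1 then g x $ 2 $ 2 else g x $ 1 $ 1) else - g x $ 1 $ 2) / gram_det g x) :: real^2^2)"
  note inv' = inv[OF gram_det_def[of g x, symmetric, unfolded coeff_fun_def] D]
  have "matrix_inv (g x) = B"
  proof (rule matrix_inv_eqI)
    show "g x ** B = mat 1" "B ** g x = mat 1"
      by (simp_all only: vec_eq_iff forall_2 matrix_matrix_mult_def sum_2 B_def mat_def sym vec_lambda_beta)
        (simp_all only: inv' if_True if_False one_neq_2 one_neq_2[symmetric] simp_thms)
  qed
  then show "matrix_inv (g x) $ 1 $ 1 = coeff_fun g 2 2 x / gram_det g x"
    "matrix_inv (g x) $ 1 $ 2 = - coeff_fun g 1 2 x / gram_det g x"
    "matrix_inv (g x) $ 2 $ 1 = - coeff_fun g 1 2 x / gram_det g x"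
    "matrix_inv (g x) $ 2 $ 2 = coeff_fun g 1 1 x / gram_det g x"
    by (simp_all add: B_def coeff_fun_def)
qed

lemma christoffel_explicit:
  fixes g :: "2 metric_field"
  assumes g: "riemannian_metric g"
  shows "christoffel g 1 i j x = (coeff_fun g 2 2 x * christoffel1 g i j 1 x - coeff_fun g 1 2 x * christoffel1 g i j 2 x) / gram_det g x"
    and "christoffel g 2 i j x = (coeff_fun g 1 1 x * christoffel1 g i j 2 x - coeff_fun g 1 2 x * christoffel1 g i j 1 x) / gram_det g x"
  unfolding christoffel_def sum_2 matrix_inv_metric[OF g] christoffel1_def
  by (simp_all add: diff_divide_distrib add_divide_distrib algebra_simps)

lemma smooth_christoffel1_differentiable:
  assumes "\<And>i j. smooth (coeff_fun g i j)"
  shows "christoffel1 g i j m differentiable at x"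
    and "partial_deriv k (christoffel1 g i j m) x = (1/2) *
     (partial_deriv k (partial_deriv i (coeff_fun g j m)) x + partial_deriv k (partial_deriv j (coeff_fun g i m)) x
        - partial_deriv k (partial_deriv m (coeff_fun g i j)) x)"
proof -
  have eq: "christoffel1 g i j m = (\<lambda>x. (1/2) *
     (partial_deriv i (coeff_fun g j m) x + partial_deriv j (coeff_fun g i m) x - partial_deriv m (coeff_fun g i j) x))"
    by (simp add: fun_eq_iff christoffel1_def)
  note d = smooth_differentiable[OF smooth_partial_deriv[OF assms]]
  show "christoffel1 g i j m differentiable at x"
    unfolding eq by (intro differentiable_mult differentiable_const differentiable_diff differentiable_add d)
  show "partial_deriv k (christoffel1 g i j m) x = (1/2) *
     (partial_deriv k (partial_deriv i (coeff_fun g j m)) x + partial_deriv k (partial_deriv j (coeff_fun g i m)) x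
        - partial_deriv k (partial_deriv m (coeff_fun g i j)) x)"
    unfolding eq by (simp only: partial_deriv_cmult partial_deriv_diff partial_deriv_add differentiable_add differentiable_diff d)
qed

lemma christoffel_differentiable:
  fixes g :: "2 metric_field"
  assumes g: "riemannian_metric g"
  shows "christoffel g l i j differentiable at x"
proof -
  have sm: "\<And>i j. smooth (coeff_fun g i j)" and D: "\<And>x. gram_det g x \<noteq> 0"
    using g by (auto simp: riemannian_metric_plane less_imp_neq[THEN not_sym])
  have dD: "gram_det g differentiable at x"
    unfolding gram_det_def[abs_def] by (intro differentiable_diff differentiable_mult smooth_differentiable sm)
  consider "l = 1" | "l = 2" using exhaust_2 by blast
  then show ?thesis
  proof cases
    case 1
    have "christoffel g 1 i j = (\<lambda>x. (coeff_fun g 2 2 x * christoffel1 g i j 1 x - coeff_fun g 1 2 x * christoffel1 g i j 2 x) / gram_det g x)"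
      by (intro ext christoffel_explicit[OF g])
    then show ?thesis unfolding 1
      by (simp only:) (intro differentiable_divide differentiable_diff differentiable_mult smooth_differentiable sm
          smooth_christoffel1_differentiable dD D)
  next
    case 2
    have "christoffel g 2 i j = (\<lambda>x. (coeff_fun g 1 1 x * christoffel1 g i j 2 x - coeff_fun g 1 2 x * christoffel1 g i j 1 x) / gram_det g x)"
      by (intro ext christoffel_explicit[OF g])
    then show ?thesis unfolding 2
      by (simp only:) (intro differentiable_divide differentiable_diff differentiable_mult smooth_differentiable sm
          smooth_christoffel1_differentiable dD D)
  qed
qed

lemma christoffel_lowered:
  fixes g :: "2 metric_field"
  assumes g: "riemannian_metric g"
  shows "coeff_fun g p 1 x * christoffel g 1 i j x + coeff_fun g p 2 x * christoffel g 2 i j x = christoffel1 g i j p x"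
proof -
  have sym: "coeff_fun g 2 1 x = coeff_fun g 1 2 x" and "gram_det g x > 0"
    using g by (auto simp: riemannian_metric_plane)
  then have D: "gram_det g x \<noteq> 0" by simp
  consider "p = 1" | "p = 2" using exhaust_2 by blast
  then show ?thesis
    by cases (use D sym in \<open>simp_all add: christoffel_explicit[OF g] divide_simps, simp_all add: gram_det_def algebra_simps\<close>)
qed

text \<open>Differentiating \<open>christoffel_lowered\<close> expresses the derivatives of the Christoffel symbols, with an
  index lowered, without derivatives of the inverse matrix.\<close>

lemma partial_deriv_christoffel_lowered:
  fixes g :: "2 metric_field"
  assumes g: "riemannian_metric g"
  shows "coeff_fun g p 1 x * partial_deriv k (christoffel g 1 i j) x + coeff_fun g p 2 x * partial_deriv k (christoffel g 2 i j) x =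
    partial_deriv k (christoffel1 g i j p) x
     - partial_deriv k (coeff_fun g p 1) x * christoffel g 1 i j x - partial_deriv k (coeff_fun g p 2) x * christoffel g 2 i j x"
proof -
  have sm: "\<And>i j. smooth (coeff_fun g i j)" using g by (auto simp: riemannian_metric_plane)
  note d = smooth_differentiable[OF sm] christoffel_differentiable[OF g]
  have "christoffel1 g i j p = (\<lambda>x. coeff_fun g p 1 x * christoffel g 1 i j x + coeff_fun g p 2 x * christoffel g 2 i j x)"
    by (simp add: fun_eq_iff christoffel_lowered[OF g])
  then have "partial_deriv k (christoffel1 g i j p) x =
     partial_deriv k (\<lambda>x. coeff_fun g p 1 x * christoffel g 1 i j x + coeff_fun g p 2 x * christoffel g 2 i j x) x" by simp
  also have "\<dots> = (coeff_fun g p 1 x * partial_deriv k (christoffel g 1 i j) x + partial_deriv k (coeff_fun g p 1) x * christoffel g 1 i j x)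
     + (coeff_fun g p 2 x * partial_deriv k (christoffel g 2 i j) x + partial_deriv k (coeff_fun g p 2) x * christoffel g 2 i j x)"
    by (simp only: partial_deriv_add partial_deriv_mult d differentiable_mult)
  finally show ?thesis by simp
qed

text \<open>The inner product of \<open>R(\<partial>\<^sub>1, \<partial>\<^sub>2) \<partial>\<^sub>k\<close> with \<open>\<partial>\<^sub>p\<close>.\<close>

definition riemann_lowered :: "2 metric_field \<Rightarrow> 2 \<Rightarrow> 2 \<Rightarrow> real^2 \<Rightarrow> real" where
  "riemann_lowered g p k x = coeff_fun g p 1 x * riemann_coeff g 1 1 2 k x + coeff_fun g p 2 x * riemann_coeff g 2 1 2 k x"

text \<open>Lowering the index makes the connection compatible with the metric visible: \<open>\<partial>\<^sub>i g\<^sub>p\<^sub>l\<close> is the sum of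
  two Christoffel symbols of the first kind, and the quadratic terms of the curvature cancel against half
  of the terms that arise from differentiating the coefficients.\<close>

lemma riemann_lowered_christoffel:
  assumes g: "riemannian_metric g"
  shows "riemann_lowered g p k x = partial_deriv 1 (christoffel1 g 2 k p) x - partial_deriv 2 (christoffel1 g 1 k p) x
     + (christoffel1 g 2 p 1 x * christoffel g 1 1 k x + christoffel1 g 2 p 2 x * christoffel g 2 1 k x)
     - (christoffel1 g 1 p 1 x * christoffel g 1 2 k x + christoffel1 g 1 p 2 x * christoffel g 2 2 k x)"
proof -
  have "coeff_fun g 2 1 = coeff_fun g 1 2" using g by (auto simp: riemannian_metric_plane)
  then have sym: "\<forall>i j. coeff_fun g i j = coeff_fun g j i" by (simp add: forall_2)
  have compat: "partial_deriv i (coeff_fun g p l) x = christoffel1 g i p l x + christoffel1 g i l p x" for i p l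
    unfolding christoffel1_def sym[rule_format, of l p] by (simp add: field_simps)
  have "riemann_lowered g p k x =
     (coeff_fun g p 1 x * partial_deriv 1 (christoffel g 1 2 k) x + coeff_fun g p 2 x * partial_deriv 1 (christoffel g 2 2 k) x)
   - (coeff_fun g p 1 x * partial_deriv 2 (christoffel g 1 1 k) x + coeff_fun g p 2 x * partial_deriv 2 (christoffel g 2 1 k) x)
   + (coeff_fun g p 1 x * christoffel g 1 1 1 x + coeff_fun g p 2 x * christoffel g 2 1 1 x) * christoffel g 1 2 k x
   + (coeff_fun g p 1 x * christoffel g 1 1 2 x + coeff_fun g p 2 x * christoffel g 2 1 2 x) * christoffel g 2 2 k x
   - (coeff_fun g p 1 x * christoffel g 1 2 1 x + coeff_fun g p 2 x * christoffel g 2 2 1 x) * christoffel g 1 1 k x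
   - (coeff_fun g p 1 x * christoffel g 1 2 2 x + coeff_fun g p 2 x * christoffel g 2 2 2 x) * christoffel g 2 1 k x"
    unfolding riemann_lowered_def riemann_coeff_def sum_2 by (simp add: algebra_simps)
  also have "\<dots> = (partial_deriv 1 (christoffel1 g 2 k p) x
     - (christoffel1 g 1 p 1 x + christoffel1 g 1 1 p x) * christoffel g 1 2 k x - (christoffel1 g 1 p 2 x + christoffel1 g 1 2 p x) * christoffel g 2 2 k x)
   - (partial_deriv 2 (christoffel1 g 1 k p) x
     - (christoffel1 g 2 p 1 x + christoffel1 g 2 1 p x) * christoffel g 1 1 k x - (christoffel1 g 2 p 2 x + christoffel1 g 2 2 p x) * christoffel g 2 1 k x)
   + christoffel1 g 1 1 p x * christoffel g 1 2 k x + christoffel1 g 1 2 p x * christoffel g 2 2 k x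
   - christoffel1 g 2 1 p x * christoffel g 1 1 k x - christoffel1 g 2 2 p x * christoffel g 2 1 k x"
    unfolding partial_deriv_christoffel_lowered[OF g] christoffel_lowered[OF g] compat ..
  finally show ?thesis by (simp add: algebra_simps)
qed

text \<open>The Gauss curvature multiplied by \<open>(gram_det g x)\<^sup>2\<close>, which clears the denominators and leaves a polynomial in the
  coefficients and their first and second derivatives.\<close>

definition gauss_num :: "2 metric_field \<Rightarrow> real^2 \<Rightarrow> real" where
  "gauss_num g x =
    (let E = coeff_fun g 1 1; F = coeff_fun g 1 2; G = coeff_fun g 2 2;
         E1 = partial_deriv 1 E x; E2 = partial_deriv 2 E x; F1 = partial_deriv 1 F x; F2 = partial_deriv 2 F x;
         G1 = partial_deriv 1 G x; G2 = partial_deriv 2 G x in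
     gram_det g x * (partial_deriv 1 (partial_deriv 2 F) x - partial_deriv 1 (partial_deriv 1 G) x / 2
        - partial_deriv 2 (partial_deriv 2 E) x / 2)
     + (G x * E2 * E2 - 2 * F x * E2 * G1 + E x * G1 * G1) / 4
     - (G x * E1 * (F2 - G1 / 2) / 2 - F x * (E1 * G2 / 4 + (F1 - E2 / 2) * (F2 - G1 / 2)) + E x * (F1 - E2 / 2) * G2 / 2))"

text \<open>In dimension two the symmetries of the curvature tensor leave a single component. The vanishing of the
  diagonal ones is the symmetry of second derivatives of \<open>g\<^sub>1\<^sub>1\<close> and \<open>g\<^sub>2\<^sub>2\<close>.\<close>

lemma riemann_lowered_eq:
  assumes g: "riemannian_metric g"
  shows "gram_det g x * riemann_lowered g 1 2 x = gauss_num g x"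
    and "gram_det g x * riemann_lowered g 2 1 x = - gauss_num g x"
    and "riemann_lowered g 1 1 x = 0" "riemann_lowered g 2 2 x = 0"
proof -
  have sm: "\<And>i j. smooth (coeff_fun g i j)" and D: "gram_det g x \<noteq> 0" and sym: "coeff_fun g 2 1 = coeff_fun g 1 2"
    using g by (auto simp: riemannian_metric_plane less_imp_neq[THEN not_sym])
  define d where "d = gram_det g x"
  have comm: "partial_deriv 2 (partial_deriv 1 (coeff_fun g i j)) x = partial_deriv 1 (partial_deriv 2 (coeff_fun g i j)) x" for i j
    by (rule partial_deriv_commute[OF sm])
  note c1 = smooth_christoffel1_differentiable(2)[OF sm] christoffel1_def
  have chr: "d * christoffel g 1 i j x = coeff_fun g 2 2 x * christoffel1 g i j 1 x - coeff_fun g 1 2 x * christoffel1 g i j 2 x"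
    "d * christoffel g 2 i j x = coeff_fun g 1 1 x * christoffel1 g i j 2 x - coeff_fun g 1 2 x * christoffel1 g i j 1 x" for i j
    using D by (simp_all add: d_def christoffel_explicit[OF g])
  have low: "d * riemann_lowered g p k x = d * (partial_deriv 1 (christoffel1 g 2 k p) x - partial_deriv 2 (christoffel1 g 1 k p) x)
     + christoffel1 g 2 p 1 x * (d * christoffel g 1 1 k x) + christoffel1 g 2 p 2 x * (d * christoffel g 2 1 k x)
     - christoffel1 g 1 p 1 x * (d * christoffel g 1 2 k x) - christoffel1 g 1 p 2 x * (d * christoffel g 2 2 k x)" for p k
    unfolding riemann_lowered_christoffel[OF g] by (simp add: algebra_simps)
  note low = low[unfolded chr]
  show "gram_det g x * riemann_lowered g 1 2 x = gauss_num g x"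
    unfolding d_def[symmetric] low gauss_num_def Let_def unfolding c1 unfolding sym comm by (simp add: field_simps)
  show "gram_det g x * riemann_lowered g 2 1 x = - gauss_num g x"
    unfolding d_def[symmetric] low gauss_num_def Let_def unfolding c1 unfolding sym comm by (simp add: field_simps)
  have "d * riemann_lowered g 1 1 x = 0" "d * riemann_lowered g 2 2 x = 0"
    unfolding low unfolding c1 unfolding sym comm by (simp_all add: field_simps)
  then show "riemann_lowered g 1 1 x = 0" "riemann_lowered g 2 2 x = 0" using D by (auto simp: d_def)
qed

text \<open>Numerator and denominator of the sectional curvature depend on \<open>u\<close> and \<open>v\<close> through the square of their
  determinant alone.\<close>

lemma sectional_curvature_plane:
  assumes g: "riemannian_metric g"
  shows "sectional_curvature g x u v * ((u $ 1 * v $ 2 - u $ 2 * v $ 1)\<^sup>2 * (gram_det g x)\<^sup>2)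
     = (u $ 1 * v $ 2 - u $ 2 * v $ 1)\<^sup>2 * gauss_num g x"
proof -
  have D: "gram_det g x \<noteq> 0" and sym: "coeff_fun g 2 1 = coeff_fun g 1 2"
    using g by (auto simp: riemannian_metric_plane less_imp_neq[THEN not_sym])
  define w where "w = u $ 1 * v $ 2 - u $ 2 * v $ 1"
  have z: "riemann_coeff g l 1 1 k x = 0" "riemann_coeff g l 2 2 k x = 0"
      "riemann_coeff g l 2 1 k x = - riemann_coeff g l 1 2 k x" for l k
    by (simp_all add: riemann_coeff_def sum_2)
  have R: "riemann_tensor g x u v v $ l = w * (riemann_coeff g l 1 2 1 x * v $ 1 + riemann_coeff g l 1 2 2 x * v $ 2)" for l
    by (simp add: riemann_tensor_def sum_2 z w_def algebra_simps)
  have "metric_inner g x (riemann_tensor g x u v v) u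
     = w * (u $ 1 * v $ 1 * riemann_lowered g 1 1 x + u $ 1 * v $ 2 * riemann_lowered g 1 2 x
          + u $ 2 * v $ 1 * riemann_lowered g 2 1 x + u $ 2 * v $ 2 * riemann_lowered g 2 2 x)"
    unfolding metric_inner_sum R by (simp add: sum_2 riemann_lowered_def sym algebra_simps)
  moreover have "riemann_lowered g 2 1 x = - riemann_lowered g 1 2 x"
  proof -
    have "gram_det g x * riemann_lowered g 2 1 x = gram_det g x * (- riemann_lowered g 1 2 x)"
      using riemann_lowered_eq(1,2)[OF g, of x] by simp
    then show ?thesis using mult_left_cancel[OF D] by blast
  qed
  ultimately have "metric_inner g x (riemann_tensor g x u v v) u = w * (w * riemann_lowered g 1 2 x)"
    using riemann_lowered_eq(3,4)[OF g, of x] by (simp add: w_def algebra_simps)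
  then have num: "gram_det g x * metric_inner g x (riemann_tensor g x u v v) u = w\<^sup>2 * gauss_num g x"
    unfolding riemann_lowered_eq(1)[OF g, of x, symmetric] by (simp add: power2_eq_square mult.left_commute)
  have den: "metric_inner g x u u * metric_inner g x v v - (metric_inner g x u v)\<^sup>2 = w\<^sup>2 * gram_det g x"
    by (simp add: metric_inner_sum sum_2 sym gram_det_def w_def power2_eq_square algebra_simps)
  show ?thesis
  proof (cases "w = 0")
    case False
    then show ?thesis unfolding sectional_curvature_def den w_def[symmetric] using D num
      by (simp add: field_simps power2_eq_square)
  qed (simp add: w_def)
qed

text \<open>Since division by \<open>0\<close> gives \<open>0\<close>, the curvature of a pair of linearly dependent vectors is \<open>0\<close>.\<close>

lemma nonneg_sectional_curvature_plane:
  assumes g: "riemannian_metric g"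
  shows "nonneg_sectional_curvature g \<longleftrightarrow> (\<forall>x. 0 \<le> gauss_num g x)"
proof
  assume L: "nonneg_sectional_curvature g"
  show "\<forall>x. 0 \<le> gauss_num g x"
  proof
    fix x
    let ?e1 = "axis 1 1 :: real^2" and ?e2 = "axis 2 1 :: real^2"
    have "independent {?e1, ?e2}"
      by (rule independent_mono[OF independent_Basis]) (auto simp: Basis_vec_def)
    moreover have "?e1 \<noteq> ?e2" by (simp add: axis_eq_axis)
    ultimately have "0 \<le> sectional_curvature g x ?e1 ?e2"
      using L by (simp add: nonneg_sectional_curvature_def)
    moreover have "sectional_curvature g x ?e1 ?e2 * (gram_det g x)\<^sup>2 = gauss_num g x"
      using sectional_curvature_plane[OF g, of x ?e1 ?e2] by (simp add: axis_def)
    ultimately show "0 \<le> gauss_num g x"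
      by (metis mult_nonneg_nonneg zero_le_power2)
  qed
next
  assume R: "\<forall>x. 0 \<le> gauss_num g x"
  have sym: "coeff_fun g 2 1 = coeff_fun g 1 2" and D: "\<And>x. gram_det g x > 0"
    using g by (auto simp: riemannian_metric_plane)
  have "0 \<le> sectional_curvature g x u v" for x u v
  proof (cases "u $ 1 * v $ 2 - u $ 2 * v $ 1 = 0")
    case True
    have den: "metric_inner g x u u * metric_inner g x v v - (metric_inner g x u v)\<^sup>2 = (u $ 1 * v $ 2 - u $ 2 * v $ 1)\<^sup>2 * gram_det g x"
      by (simp add: metric_inner_sum sum_2 sym gram_det_def power2_eq_square algebra_simps)
    then show ?thesis unfolding sectional_curvature_def den True by simp
  next
    case False
    let ?w = "u $ 1 * v $ 2 - u $ 2 * v $ 1"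
    have "0 < ?w\<^sup>2 * (gram_det g x)\<^sup>2" using False D[of x] by simp
    moreover have "0 \<le> sectional_curvature g x u v * (?w\<^sup>2 * (gram_det g x)\<^sup>2)"
      unfolding sectional_curvature_plane[OF g] using R by simp
    ultimately show ?thesis using mult_neg_pos not_le by blast
  qed
  then show "nonneg_sectional_curvature g" by (simp add: nonneg_sectional_curvature_def)
qed

section \<open>Riemannian distance and completeness\<close>

text \<open>The length is an argument, so that one predicate records integrability of the speed as well as the
  value of its integral.\<close>

definition curve_of_length :: "'n::finite metric_field \<Rightarrow> real^'n \<Rightarrow> real^'n \<Rightarrow> (real \<Rightarrow> real^'n) \<Rightarrow> real \<Rightarrow> bool" where
  "curve_of_length g x y c L \<longleftrightarrow>
     valid_path c \<and> (curve_speed g c has_integral L) {0..1} \<and> c 0 = x \<and> c 1 = y"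

lemma riemannian_dist_Inf: "riemannian_dist g x y = Inf {L. \<exists>c. curve_of_length g x y c L}"
proof -
  have "curve_length g ` {c. admissible_curve g x y c} = {L. \<exists>c. curve_of_length g x y c L}"
  proof (intro set_eqI iffI)
    fix L assume "L \<in> curve_length g ` {c. admissible_curve g x y c}"
    then obtain c where "admissible_curve g x y c" "L = integral {0..1} (curve_speed g c)"
      unfolding curve_length_def by blast
    then have "curve_of_length g x y c L"
      unfolding admissible_curve_def curve_of_length_def valid_path_def pathstart_def pathfinish_def
      using integrable_integral by blast
    then show "L \<in> {L. \<exists>c. curve_of_length g x y c L}" by blast
  next
    fix L assume "L \<in> {L. \<exists>c. curve_of_length g x y c L}"
    then obtain c where c: "curve_of_length g x y c L" by blast
    then have "admissible_curve g x y c"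
      unfolding admissible_curve_def curve_of_length_def valid_path_def pathstart_def pathfinish_def integrable_on_def
      by blast
    moreover have "curve_length g c = L"
      using c unfolding curve_of_length_def curve_length_def by (intro integral_unique) simp
    ultimately show "L \<in> curve_length g ` {c. admissible_curve g x y c}" by blast
  qed
  then show ?thesis by (simp only: riemannian_dist_def)
qed

lemma valid_path_has_vector_derivative:
  assumes "valid_path c"
  obtains S where "finite S" "\<And>t. t \<in> {0..1} - S \<Longrightarrow> (c has_vector_derivative vector_derivative c (at t)) (at t)"
    "continuous_on ({0..1} - S) (\<lambda>t. vector_derivative c (at t))"
proof -
  obtain S where "finite S" "c C1_differentiable_on {0..1} - S"
    using assms unfolding valid_path_def piecewise_C1_differentiable_on_def by blast
  then show ?thesis
    by (intro that[of S]) (auto simp: C1_differentiable_on_eq vector_derivative_works)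
qed

lemma curve_of_length_valid: "curve_of_length g x y c L \<Longrightarrow> valid_path c"
  by (simp add: curve_of_length_def)

lemma metric_inner_scaleR: "metric_inner g x (a *\<^sub>R u) (a *\<^sub>R u) = a\<^sup>2 * metric_inner g x u u"
  by (simp add: metric_inner_def matrix_vector_mult_scaleR power2_eq_square)

lemma metric_inner_nonneg: "riemannian_metric g \<Longrightarrow> 0 \<le> metric_inner g x v v"
  by (cases "v = 0") (auto simp: riemannian_metric_def less_imp_le metric_inner_def)

lemma curve_speed_nonneg: "riemannian_metric g \<Longrightarrow> 0 \<le> curve_speed g c t"
  by (simp add: curve_speed_def metric_inner_nonneg)

lemma curve_speed_eq:
  assumes "(c has_vector_derivative w) (at t)"
  shows "curve_speed g c t = sqrt (metric_inner g (c t) w w)"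
  using vector_derivative_at[OF assms] by (simp add: curve_speed_def)

lemma continuous_on_metric_inner:
  assumes g: "riemannian_metric g" and f: "continuous_on A f" and u: "continuous_on A u"
  shows "continuous_on A (\<lambda>z. metric_inner g (f z) (u z) (u z))"
proof -
  have "continuous_on UNIV (coeff_fun g i j)" for i j
    using g by (auto simp: riemannian_metric_def differentiable_on_def intro!: differentiable_imp_continuous_on smooth_differentiable)
  then have "continuous_on A (\<lambda>z. coeff_fun g i j (f z))" for i j
    by (rule continuous_on_compose2[OF _ f]) auto
  then show ?thesis
    unfolding metric_inner_sum by (intro continuous_intros u)
qed

lemma curve_of_length_ge_0: "riemannian_metric g \<Longrightarrow> curve_of_length g x y c L \<Longrightarrow> 0 \<le> L"
  unfolding curve_of_length_def using has_integral_nonneg curve_speed_nonneg by blast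

lemma curve_of_length_linepath:
  assumes g: "riemannian_metric g"
  shows "\<exists>L. curve_of_length g x y (linepath x y) L"
proof -
  have "continuous_on {0..1} (curve_speed g (linepath x y))"
    unfolding curve_speed_def vector_derivative_linepath_at
    by (intro continuous_on_real_sqrt continuous_on_metric_inner[OF g] continuous_on_linepath continuous_on_const)
  then have "curve_speed g (linepath x y) integrable_on {0..1}"
    by (rule integrable_continuous_real)
  then show ?thesis
    by (auto simp: curve_of_length_def linepath_def integrable_on_def intro: valid_path_linepath[unfolded linepath_def])
qed

lemma riemannian_dist_le:
  assumes g: "riemannian_metric g" and "curve_of_length g x y c L"
  shows "riemannian_dist g x y \<le> L"
  unfolding riemannian_dist_Inf
proof (rule cInf_lower)
  show "bdd_below {L. \<exists>c. curve_of_length g x y c L}"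
    using curve_of_length_ge_0[OF g] by (intro bdd_belowI[of _ 0]) blast
qed (use assms(2) in blast)

lemma riemannian_dist_greatest:
  assumes g: "riemannian_metric g" and "\<And>c L. curve_of_length g x y c L \<Longrightarrow> a \<le> L"
  shows "a \<le> riemannian_dist g x y"
  unfolding riemannian_dist_Inf
proof (rule cInf_greatest)
  show "{L. \<exists>c. curve_of_length g x y c L} \<noteq> {}" using curve_of_length_linepath[OF g, of x y] by blast
qed (use assms(2) in blast)

text \<open>If the metric dominates \<open>k\<^sup>2\<close> times the Euclidean one along the curve up to time \<open>\<tau>\<close>, the length is at
  least \<open>k\<close> times the length of the chord. With \<open>\<tau> = 1\<close> this bounds distances of constant metrics globally;
  with \<open>\<tau>\<close> an exit time from a ball it bounds distances of arbitrary metrics locally.\<close>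

lemma length_ge_chord:
  assumes g: "riemannian_metric g" and c: "curve_of_length g x y c L" and \<tau>: "0 \<le> \<tau>" "\<tau> \<le> 1" and k: "0 \<le> k"
    and le: "\<And>t v. 0 \<le> t \<Longrightarrow> t < \<tau> \<Longrightarrow> k * norm v \<le> sqrt (metric_inner g (c t) v v)"
  shows "k * norm (c \<tau> - x) \<le> L"
proof -
  obtain S where S: "finite S" "\<And>t. t \<in> {0..1} - S \<Longrightarrow> (c has_vector_derivative vector_derivative c (at t)) (at t)"
      "continuous_on ({0..1} - S) (\<lambda>t. vector_derivative c (at t))"
    by (rule valid_path_has_vector_derivative[OF curve_of_length_valid[OF c]]) (assumption | rule that)+
  \<comment> \<open>The bound is assumed before time \<open>\<tau>\<close> only; the value \<open>0\<close> makes it true at \<open>\<tau>\<close> as well.\<close>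
  define f where "f t = (if t = \<tau> then 0 else k *\<^sub>R vector_derivative c (at t))" for t
  have cont: "continuous_on {0..1} c"
    using c by (auto simp: curve_of_length_def valid_path_def piecewise_C1_differentiable_on_def)
  have 1: "(f has_integral (k *\<^sub>R c \<tau> - k *\<^sub>R c 0)) {0..\<tau>}"
  proof (rule fundamental_theorem_of_calculus_strong[of "insert \<tau> S"])
    show "continuous_on {0..\<tau>} (\<lambda>t. k *\<^sub>R c t)"
      using continuous_on_subset[OF cont, of "{0..\<tau>}"] \<tau> by (auto intro: continuous_intros)
    show "((\<lambda>t. k *\<^sub>R c t) has_vector_derivative f t) (at t)" if "t \<in> {0..\<tau>} - insert \<tau> S" for t
      using that S(2)[of t] \<tau> by (auto simp: f_def intro!: has_vector_derivative_scaleR[of "\<lambda>_. k" 0, simplified])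
  qed (use S \<tau> in auto)
  have sp: "curve_speed g c integrable_on {0..1}" "integral {0..1} (curve_speed g c) = L"
    using c by (auto simp: curve_of_length_def integrable_on_def intro: integral_unique)
  then have sp\<tau>: "curve_speed g c integrable_on {0..\<tau>}"
    using \<tau> by (intro integrable_on_subinterval[OF sp(1)]) auto
  have "norm (integral {0..\<tau>} f) \<le> integral {0..\<tau>} (curve_speed g c)"
  proof (rule integral_norm_bound_integral)
    show "f integrable_on {0..\<tau>}" using 1 by (auto simp: integrable_on_def)
    show "norm (f t) \<le> curve_speed g c t" if "t \<in> {0..\<tau>}" for t
      using le[of t] that k curve_speed_nonneg[OF g] by (auto simp: f_def curve_speed_def)
  qed (rule sp\<tau>)
  also have "\<dots> \<le> integral {0..1} (curve_speed g c)"
    using \<tau> sp sp\<tau> curve_speed_nonneg[OF g] by (intro integral_subset_le) auto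
  finally have "norm (k *\<^sub>R c \<tau> - k *\<^sub>R c 0) \<le> L"
    using integral_unique[OF 1] sp(2) by simp
  then show ?thesis
    using c k by (simp add: curve_of_length_def flip: scaleR_diff_right)
qed

lemma metric_lower_bound:
  assumes g: "riemannian_metric g" and K: "compact K" "K \<noteq> {}"
  obtains k where "0 < k" "\<And>z v. z \<in> K \<Longrightarrow> k * norm v \<le> sqrt (metric_inner g z v v)"
proof -
  have ne: "K \<times> sphere (0::real^'a) 1 \<noteq> {}"
    using K vector_choose_size[of 1, where 'a="real^'a"] by (auto simp: dist_norm)
  have "continuous_on (K \<times> sphere 0 1) (\<lambda>z. metric_inner g (fst z) (snd z) (snd z))"
    by (intro continuous_on_metric_inner[OF g] continuous_on_fst continuous_on_snd continuous_on_id)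
  from continuous_attains_inf[OF compact_Times[OF K(1) compact_sphere] ne this]
  obtain z0 v0 where z0: "z0 \<in> K" "norm v0 = 1"
    "\<And>z v. z \<in> K \<Longrightarrow> norm v = 1 \<Longrightarrow> metric_inner g z0 v0 v0 \<le> metric_inner g z v v"
    by (auto simp: dist_norm)
  have "v0 \<noteq> 0" using z0(2) by auto
  then have pos: "0 < metric_inner g z0 v0 v0" using g by (simp add: riemannian_metric_def)
  show ?thesis
  proof (rule that[of "sqrt (metric_inner g z0 v0 v0)"])
    show "0 < sqrt (metric_inner g z0 v0 v0)" using pos by simp
    fix z v assume z: "z \<in> K"
    show "sqrt (metric_inner g z0 v0 v0) * norm v \<le> sqrt (metric_inner g z v v)"
    proof (cases "v = 0")
      case True
      then show ?thesis by (simp add: metric_inner_def)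
    next
      case False
      define w where "w = (1 / norm v) *\<^sub>R v"
      have w: "norm w = 1" "v = norm v *\<^sub>R w" using False by (auto simp: w_def)
      have "metric_inner g z v v = (norm v)\<^sup>2 * metric_inner g z w w"
        using metric_inner_scaleR[of g z "norm v" w] w(2) by metis
      then have "sqrt (metric_inner g z v v) = norm v * sqrt (metric_inner g z w w)"
        by (simp add: real_sqrt_mult)
      then show ?thesis using z0(3)[OF z w(1)] by (simp add: mult.commute mult_left_mono)
    qed
  qed
qed

lemma curve_of_length_reversepath:
  assumes "curve_of_length g x y c L"
  shows "curve_of_length g y x (reversepath c) L"
proof -
  obtain S where S: "finite S" "\<And>t. t \<in> {0..1} - S \<Longrightarrow> (c has_vector_derivative vector_derivative c (at t)) (at t)"
      "continuous_on ({0..1} - S) (\<lambda>t. vector_derivative c (at t))"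
    by (rule valid_path_has_vector_derivative[OF curve_of_length_valid[OF assms]]) (assumption | rule that)+
  have "(curve_speed g c has_integral L) (cbox 0 1)" using assms by (simp add: curve_of_length_def)
  from has_integral_affinity[OF this, of "-1" 1]
  have int1: "((\<lambda>t. curve_speed g c (1 - t)) has_integral L) {0..1}"
    by (simp add: image_affinity_cbox)
  have finS: "finite ((\<lambda>t. 1 - t) ` S)" using S(1) by simp
  have sp: "curve_speed g (reversepath c) t = curve_speed g c (1 - t)" if "t \<in> {0..1} - (\<lambda>t. 1 - t) ` S" for t
  proof -
    have "1 - t \<notin> S"
    proof
      assume "1 - t \<in> S"
      then have "1 - (1 - t) \<in> (\<lambda>t. 1 - t) ` S" by (rule imageI)
      then show False using that by simp
    qed
    then have "1 - t \<in> {0..1} - S" using that by simp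
    from S(2)[OF this] have "(c has_vector_derivative vector_derivative c (at (1 - t))) (at (1 - t))" .
    moreover have "((\<lambda>t. 1 - t) has_vector_derivative - 1) (at t)"
      by (auto intro!: derivative_eq_intros)
    ultimately have "((c \<circ> (\<lambda>t. 1 - t)) has_vector_derivative (-1) *\<^sub>R vector_derivative c (at (1 - t))) (at t)"
      by (intro vector_diff_chain_at)
    then have "(reversepath c has_vector_derivative (-1) *\<^sub>R vector_derivative c (at (1 - t))) (at t)"
      by (simp only: reversepath_def o_def)
    from curve_speed_eq[OF this, of g] show ?thesis
      unfolding metric_inner_scaleR by (simp add: curve_speed_def reversepath_def)
  qed
  have "(curve_speed g (reversepath c) has_integral L) {0..1}"
    by (rule has_integral_spike_finite[OF finS sp int1])
  moreover have "valid_path (reversepath c)"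
    by (rule valid_path_imp_reverse[OF curve_of_length_valid[OF assms]])
  moreover have "reversepath c 0 = y" "reversepath c 1 = x"
    using assms by (auto simp: curve_of_length_def reversepath_def)
  ultimately show ?thesis unfolding curve_of_length_def by blast
qed

lemma curve_of_length_joinpaths:
  assumes 1: "curve_of_length g x y c1 L1" and 2: "curve_of_length g y z c2 L2"
  shows "curve_of_length g x z (c1 +++ c2) (L1 + L2)"
proof -
  have v: "valid_path c1" "valid_path c2" and ends: "c1 0 = x" "c1 1 = y" "c2 0 = y" "c2 1 = z"
    using 1 2 by (auto simp: curve_of_length_def)
  obtain S1 where S1: "finite S1" "\<And>t. t \<in> {0..1} - S1 \<Longrightarrow> (c1 has_vector_derivative vector_derivative c1 (at t)) (at t)"
      "continuous_on ({0..1} - S1) (\<lambda>t. vector_derivative c1 (at t))"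
    by (rule valid_path_has_vector_derivative[OF v(1)]) (assumption | rule that)+
  obtain S2 where S2: "finite S2" "\<And>t. t \<in> {0..1} - S2 \<Longrightarrow> (c2 has_vector_derivative vector_derivative c2 (at t)) (at t)"
      "continuous_on ({0..1} - S2) (\<lambda>t. vector_derivative c2 (at t))"
    by (rule valid_path_has_vector_derivative[OF v(2)]) (assumption | rule that)+
  have "(curve_speed g c1 has_integral L1) (cbox 0 1)" "(curve_speed g c2 has_integral L2) (cbox 0 1)"
    using 1 2 by (auto simp: curve_of_length_def)
  from has_integral_affinity'[OF this(1), of 2 0] has_integral_affinity'[OF this(2), of 2 "-1"]
  have "((\<lambda>t. curve_speed g c1 (2 * t)) has_integral L1 / 2) {0..1/2}"
       "((\<lambda>t. curve_speed g c2 (2 * t - 1)) has_integral L2 / 2) {1/2..1}"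
    by simp_all
  note half = this
  have i: "((\<lambda>t. 2 * curve_speed g c1 (2 * t)) has_integral L1) {0..1/2}"
       "((\<lambda>t. 2 * curve_speed g c2 (2 * t - 1)) has_integral L2) {1/2..1}"
    using has_integral_mult_right[OF half(1), of 2] has_integral_mult_right[OF half(2), of 2] by simp_all
  have "curve_speed g (c1 +++ c2) t = 2 * curve_speed g c1 (2 * t)"
    if t: "t \<in> {0..1/2} - insert (1/2) ((\<lambda>t. t / 2) ` S1)" for t
  proof -
    have "2 * t \<in> {0..1} - S1"
    proof -
      have "2 * t \<notin> S1"
      proof
        assume "2 * t \<in> S1"
        then have "(2 * t) / 2 \<in> (\<lambda>t. t / 2) ` S1" by (rule imageI)
        then show False using t by simp
      qed
      then show ?thesis using t by simp
    qed
    from S1(2)[OF this] have d: "(c1 has_vector_derivative vector_derivative c1 (at (2 * t))) (at (2 * t))" .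
    have "((\<lambda>t. 2 * t) has_vector_derivative 2) (at t)" by (auto intro!: derivative_eq_intros)
    from vector_diff_chain_at[OF this d]
    have "((\<lambda>t. c1 (2 * t)) has_vector_derivative 2 *\<^sub>R vector_derivative c1 (at (2 * t))) (at t)" by (simp add: o_def)
    then have "((c1 +++ c2) has_vector_derivative 2 *\<^sub>R vector_derivative c1 (at (2 * t))) (at t)"
      by (rule has_vector_derivative_transform_within_open[where S = "{..<1/2}"]) (use t in \<open>auto simp: joinpaths_def\<close>)
    from curve_speed_eq[OF this] show ?thesis
      using t by (simp add: curve_speed_def metric_inner_scaleR real_sqrt_mult joinpaths_def)
  qed
  then have j1: "(curve_speed g (c1 +++ c2) has_integral L1) {0..1/2}"
    using S1(1) by (intro has_integral_spike_finite[OF _ _ i(1), of "insert (1/2) ((\<lambda>t. t / 2) ` S1)"]) auto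
  have "curve_speed g (c1 +++ c2) t = 2 * curve_speed g c2 (2 * t - 1)"
    if t: "t \<in> {1/2..1} - insert (1/2) ((\<lambda>t. (t + 1) / 2) ` S2)" for t
  proof -
    have "2 * t - 1 \<in> {0..1} - S2"
    proof -
      have "2 * t - 1 \<notin> S2"
      proof
        assume "2 * t - 1 \<in> S2"
        then have "(2 * t - 1 + 1) / 2 \<in> (\<lambda>t. (t + 1) / 2) ` S2" by (rule imageI)
        then show False using t by simp
      qed
      then show ?thesis using t by simp
    qed
    from S2(2)[OF this] have d: "(c2 has_vector_derivative vector_derivative c2 (at (2 * t - 1))) (at (2 * t - 1))" .
    have "((\<lambda>t. 2 * t - 1) has_vector_derivative 2) (at t)" by (auto intro!: derivative_eq_intros)
    from vector_diff_chain_at[OF this d]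
    have "((\<lambda>t. c2 (2 * t - 1)) has_vector_derivative 2 *\<^sub>R vector_derivative c2 (at (2 * t - 1))) (at t)" by (simp add: o_def)
    then have "((c1 +++ c2) has_vector_derivative 2 *\<^sub>R vector_derivative c2 (at (2 * t - 1))) (at t)"
      by (rule has_vector_derivative_transform_within_open[where S = "{1/2<..}"]) (use t in \<open>auto simp: joinpaths_def\<close>)
    from curve_speed_eq[OF this] show ?thesis
      using t by (simp add: curve_speed_def metric_inner_scaleR real_sqrt_mult joinpaths_def)
  qed
  then have j2: "(curve_speed g (c1 +++ c2) has_integral L2) {1/2..1}"
    using S2(1) by (intro has_integral_spike_finite[OF _ _ i(2), of "insert (1/2) ((\<lambda>t. (t + 1) / 2) ` S2)"]) auto
  have "(curve_speed g (c1 +++ c2) has_integral (L1 + L2)) {0..1}"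
    by (rule has_integral_combine[OF _ _ j1 j2]) auto
  moreover have "valid_path (c1 +++ c2)"
    using v ends by (intro valid_path_join) (auto simp: pathfinish_def pathstart_def)
  ultimately show ?thesis using ends by (simp add: curve_of_length_def joinpaths_def)
qed

text \<open>A curve from \<open>x\<close> to \<open>y\<close> has to leave the open ball around \<open>x\<close> whose radius is the Euclidean distance, and
  on this ball the metric dominates a multiple of the Euclidean one.\<close>

lemma riemannian_dist_pos:
  assumes g: "riemannian_metric g" and xy: "x \<noteq> y"
  shows "0 < riemannian_dist g x y"
proof -
  define r where "r = norm (y - x)"
  have r: "0 < r" using xy by (simp add: r_def)
  obtain k where k: "0 < k" "\<And>z v. z \<in> cball x r \<Longrightarrow> k * norm v \<le> sqrt (metric_inner g z v v)"
    by (rule metric_lower_bound[OF g compact_cball[of x r]]) (use r in auto)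
  have "k * r \<le> L" if c: "curve_of_length g x y c L" for c L
  proof -
    have cont: "continuous_on {0..1} c" and ends: "c 0 = x" "c 1 = y"
      using c by (auto simp: curve_of_length_def valid_path_def piecewise_C1_differentiable_on_def)
    let ?T = "{t \<in> {0..1}. r \<le> norm (c t - x)}"
    have "closedin (top_of_set {0..1}) {t \<in> {0..1}. (\<lambda>t. norm (c t - x)) t \<in> {r..}}"
      by (rule continuous_closedin_preimage_gen[unfolded vimage_def Int_def mem_Collect_eq, of "{0..1}" "\<lambda>t. norm (c t - x)" UNIV "{r..}"])
         (auto intro!: continuous_intros cont)
    then have "compact ?T" by (auto intro: closedin_compact[of "{0..1}"])
    moreover have "1 \<in> ?T" using ends by (simp add: r_def)
    \<comment> \<open>The first time at which the curve is outside the open ball.\<close>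
    ultimately obtain \<tau> where \<tau>: "\<tau> \<in> ?T" "\<And>t. t \<in> ?T \<Longrightarrow> \<tau> \<le> t"
      using compact_attains_inf[of ?T] by blast
    have "k * norm (c \<tau> - x) \<le> L"
    proof (rule length_ge_chord[OF g c])
      fix t v assume "0 \<le> t" "t < \<tau>"
      then have "t \<notin> ?T" using \<tau>(2) by (meson not_le)
      then have "norm (c t - x) < r" using \<open>0 \<le> t\<close> \<open>t < \<tau>\<close> \<tau>(1) by auto
      then have "c t \<in> cball x r" by (simp add: dist_norm norm_minus_commute)
      then show "k * norm v \<le> sqrt (metric_inner g (c t) v v)" by (rule k(2))
    qed (use \<tau> k in auto)
    moreover have "k * r \<le> k * norm (c \<tau> - x)" using \<tau>(1) k(1) by simp
    ultimately show ?thesis by linarith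
  qed
  then have "k * r \<le> riemannian_dist g x y" by (rule riemannian_dist_greatest[OF g])
  then show ?thesis using k(1) r by (meson less_le_trans mult_pos_pos)
qed

lemma Metric_space_riemannian_dist:
  assumes g: "riemannian_metric g"
  shows "Metric_space UNIV (riemannian_dist g)"
proof
  have nn: "0 \<le> riemannian_dist g x y" for x y
    using riemannian_dist_greatest[OF g] curve_of_length_ge_0[OF g] by blast
  then show "0 \<le> riemannian_dist g x y" for x y .
  have le: "riemannian_dist g x y \<le> riemannian_dist g y x" for x y
    by (rule riemannian_dist_greatest[OF g]) (rule riemannian_dist_le[OF g curve_of_length_reversepath])
  show "riemannian_dist g x y = riemannian_dist g y x" for x y
    using le[of x y] le[of y x] by simp
  show "riemannian_dist g x y = 0 \<longleftrightarrow> x = y" for x y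
  proof
    assume "x = y"
    moreover have "curve_speed g (\<lambda>_. x) = (\<lambda>_. 0)"
      by (rule ext) (simp add: curve_speed_eq[OF has_vector_derivative_const] metric_inner_def)
    then have "curve_of_length g x x (\<lambda>_. x) 0"
      by (simp add: curve_of_length_def valid_path_def piecewise_C1_differentiable_const)
    from riemannian_dist_le[OF g this] nn[of x x] have "riemannian_dist g x x = 0" by linarith
    ultimately show "riemannian_dist g x y = 0" by simp
  qed (use riemannian_dist_pos[OF g, of x y] in force)
  show "riemannian_dist g x z \<le> riemannian_dist g x y + riemannian_dist g y z" for x y z
  proof -
    have "riemannian_dist g x z - L2 \<le> riemannian_dist g x y" if 2: "curve_of_length g y z c2 L2" for c2 L2
    proof (rule riemannian_dist_greatest[OF g])
      fix c1 L1 assume "curve_of_length g x y c1 L1"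
      from riemannian_dist_le[OF g curve_of_length_joinpaths[OF this 2]]
      show "riemannian_dist g x z - L2 \<le> L1" by simp
    qed
    then have "riemannian_dist g x z - riemannian_dist g x y \<le> riemannian_dist g y z"
      by (intro riemannian_dist_greatest[OF g]) (simp add: algebra_simps)
    then show ?thesis by simp
  qed
qed

text \<open>Composition with \<open>\<psi>\<close> multiplies the length of every curve by \<open>\<mu>\<close>. Using this for the inverse map
  as well turns the inequality into an equality.\<close>

lemma riemannian_dist_homothety_le:
  fixes \<psi> :: "real^'n::finite \<Rightarrow> real^'n"
  assumes g: "riemannian_metric g" and h: "riemannian_metric h" and \<mu>: "0 < \<mu>"
    and \<psi>: "\<And>x. (\<psi> has_derivative D x) (at x)" and cD: "continuous_on UNIV (\<lambda>(x, u). D x u)"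
    and iso: "\<And>x u. metric_inner g (\<psi> x) (D x u) (D x u) = \<mu>\<^sup>2 * metric_inner h x u u"
  shows "riemannian_dist g (\<psi> x) (\<psi> y) \<le> \<mu> * riemannian_dist h x y"
proof -
  have "riemannian_dist g (\<psi> x) (\<psi> y) \<le> \<mu> * L" if c: "curve_of_length h x y c L" for c L
  proof (rule riemannian_dist_le[OF g])
    have v: "valid_path c" and int: "(curve_speed h c has_integral L) {0..1}" and ends: "c 0 = x" "c 1 = y"
      using c by (auto simp: curve_of_length_def)
    obtain S where S: "finite S" "\<And>t. t \<in> {0..1} - S \<Longrightarrow> (c has_vector_derivative vector_derivative c (at t)) (at t)"
      "continuous_on ({0..1} - S) (\<lambda>t. vector_derivative c (at t))"
    by (rule valid_path_has_vector_derivative[OF v]) (assumption | rule that)+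
    have cc: "continuous_on {0..1} c"
      using v by (auto simp: valid_path_def piecewise_C1_differentiable_on_def)
    have d: "((\<psi> \<circ> c) has_vector_derivative D (c t) (vector_derivative c (at t))) (at t)" if "t \<in> {0..1} - S" for t
      by (rule vector_derivative_diff_chain_within[OF S(2)[OF that] has_derivative_at_withinI[OF \<psi>]])
    have "continuous_on ({0..1} - S) (\<lambda>t. D (c t) (vector_derivative c (at t)))"
      using continuous_on_compose2[OF cD continuous_on_Pair[OF continuous_on_subset[OF cc Diff_subset] S(3)] subset_UNIV]
      by (simp only: prod.case)
    with d have "(\<psi> \<circ> c) C1_differentiable_on ({0..1} - S)"
      unfolding C1_differentiable_on_def by (intro exI[of _ "\<lambda>t. D (c t) (vector_derivative c (at t))"] conjI ballI)
    moreover have "continuous_on {0..1} (\<psi> \<circ> c)"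
    proof (rule continuous_on_compose[OF cc])
      show "continuous_on (c ` {0..1}) \<psi>"
        using \<psi> by (intro continuous_at_imp_continuous_on ballI) (rule has_derivative_continuous)
    qed
    ultimately have "valid_path (\<psi> \<circ> c)"
      unfolding valid_path_def piecewise_C1_differentiable_on_def using S(1) by blast
    moreover have "(curve_speed g (\<psi> \<circ> c) has_integral \<mu> * L) {0..1}"
    proof (rule has_integral_spike_finite[OF S(1) _ has_integral_mult_right[OF int]])
      fix t assume "t \<in> {0..1} - S"
      from curve_speed_eq[OF d[OF this], of g] show "curve_speed g (\<psi> \<circ> c) t = \<mu> * curve_speed h c t"
        using \<mu> by (simp add: iso real_sqrt_mult curve_speed_def)
    qed
    ultimately show "curve_of_length g (\<psi> x) (\<psi> y) (\<psi> \<circ> c) (\<mu> * L)"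
      using ends by (simp add: curve_of_length_def)
  qed
  then have "riemannian_dist g (\<psi> x) (\<psi> y) / \<mu> \<le> riemannian_dist h x y"
    using \<mu> by (intro riemannian_dist_greatest[OF h]) (simp add: field_simps)
  then show ?thesis using \<mu> by (simp add: field_simps)
qed

lemma complete_metric_homothety:
  fixes \<psi> \<phi> :: "real^'n::finite \<Rightarrow> real^'n"
  assumes g: "riemannian_metric g" and h: "riemannian_metric h" and \<mu>: "0 < \<mu>"
    and \<psi>: "\<And>x. (\<psi> has_derivative D x) (at x)" and cD: "continuous_on UNIV (\<lambda>(x, u). D x u)"
    and \<phi>: "\<And>x. (\<phi> has_derivative D' x) (at x)" and cD': "continuous_on UNIV (\<lambda>(x, u). D' x u)"
    and inv: "\<And>x. \<psi> (\<phi> x) = x" "\<And>x. \<phi> (\<psi> x) = x"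
    and iso: "\<And>x u. metric_inner g (\<psi> x) (D x u) (D x u) = \<mu>\<^sup>2 * metric_inner h x u u"
    and complete: "complete_metric g"
  shows "complete_metric h"
proof -
  have DD': "D (\<phi> x) (D' x u) = u" for x u
  proof -
    have "((\<lambda>x. \<psi> (\<phi> x)) has_derivative (\<lambda>u. D (\<phi> x) (D' x u))) (at x)"
      by (rule has_derivative_compose[OF \<phi> \<psi>])
    moreover have "((\<lambda>x. \<psi> (\<phi> x)) has_derivative (\<lambda>u. u)) (at x)"
      by (simp add: inv)
    ultimately show ?thesis using has_derivative_unique by metis
  qed
  have iso': "metric_inner h (\<phi> x) (D' x u) (D' x u) = (1/\<mu>)\<^sup>2 * metric_inner g x u u" for x u
    using iso[of "\<phi> x" "D' x u"] \<mu> by (simp add: DD' inv field_simps)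
  have 1: "riemannian_dist g (\<psi> x) (\<psi> y) \<le> \<mu> * riemannian_dist h x y" for x y
    by (rule riemannian_dist_homothety_le[OF g h \<mu> \<psi> cD iso])
  have "riemannian_dist h (\<phi> x) (\<phi> y) \<le> (1/\<mu>) * riemannian_dist g x y" for x y
    by (rule riemannian_dist_homothety_le[OF h g _ \<phi> cD' iso']) (use \<mu> in simp)
  then have 2: "\<mu> * riemannian_dist h (\<phi> x) (\<phi> y) \<le> riemannian_dist g x y" for x y
    using \<mu> by (simp add: field_simps)
  interpret G: Metric_space UNIV "riemannian_dist g" by (rule Metric_space_riemannian_dist[OF g])
  interpret H: Metric_space UNIV "riemannian_dist h" by (rule Metric_space_riemannian_dist[OF h])
  show ?thesis
    unfolding complete_metric_def H.mcomplete_def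
  proof (intro allI impI)
    fix \<sigma> :: "nat \<Rightarrow> real^'n" assume \<sigma>: "H.MCauchy \<sigma>"
    have "G.MCauchy (\<psi> \<circ> \<sigma>)"
      unfolding G.MCauchy_def
    proof (intro conjI allI impI)
      fix \<epsilon> :: real assume "0 < \<epsilon>"
      then have "0 < \<epsilon> / \<mu>" using \<mu> by simp
      then obtain N where N: "\<And>n n'. N \<le> n \<Longrightarrow> N \<le> n' \<Longrightarrow> riemannian_dist h (\<sigma> n) (\<sigma> n') < \<epsilon> / \<mu>"
        using \<sigma> unfolding H.MCauchy_def by meson
      have "riemannian_dist g ((\<psi> \<circ> \<sigma>) n) ((\<psi> \<circ> \<sigma>) n') < \<epsilon>" if "N \<le> n" "N \<le> n'" for n n'
      proof -
        have "\<mu> * riemannian_dist h (\<sigma> n) (\<sigma> n') < \<epsilon>" using N[OF that] \<mu> by (simp add: field_simps)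
        then show ?thesis using 1[of "\<sigma> n" "\<sigma> n'"] by simp
      qed
      then show "\<exists>N. \<forall>n n'. N \<le> n \<longrightarrow> N \<le> n' \<longrightarrow> riemannian_dist g ((\<psi> \<circ> \<sigma>) n) ((\<psi> \<circ> \<sigma>) n') < \<epsilon>" by blast
    qed simp
    then obtain y where y: "limitin G.mtopology (\<psi> \<circ> \<sigma>) y sequentially"
      using complete unfolding complete_metric_def G.mcomplete_def by blast
    have "limitin H.mtopology \<sigma> (\<phi> y) sequentially"
      unfolding H.limit_metric_sequentially
    proof (intro conjI allI impI)
      fix \<epsilon> :: real assume "0 < \<epsilon>"
      then have "0 < \<mu> * \<epsilon>" using \<mu> by simp
      then obtain N where N: "\<And>n. N \<le> n \<Longrightarrow> riemannian_dist g ((\<psi> \<circ> \<sigma>) n) y < \<mu> * \<epsilon>"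
        using y unfolding G.limit_metric_sequentially by meson
      have "riemannian_dist h (\<sigma> n) (\<phi> y) < \<epsilon>" if "N \<le> n" for n
      proof -
        have "\<mu> * riemannian_dist h (\<sigma> n) (\<phi> y) < \<mu> * \<epsilon>"
          using 2[of "\<psi> (\<sigma> n)" y] N[OF that] by (simp add: inv)
        then show ?thesis using \<mu> by simp
      qed
      then show "\<exists>N. \<forall>n\<ge>N. \<sigma> n \<in> UNIV \<and> riemannian_dist h (\<sigma> n) (\<phi> y) < \<epsilon>" by blast
    qed simp
    then show "\<exists>x. limitin H.mtopology \<sigma> x sequentially" by blast
  qed
qed

text \<open>Distances of a constant metric are bounded below by a multiple of the Euclidean distance, and above by
  the length of the segment, so Cauchy sequences converge in the Euclidean sense and then for the metric.\<close>

lemma complete_metric_const: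
  fixes A :: "real^'n::finite^'n"
  assumes g: "riemannian_metric (\<lambda>_. A)"
  shows "complete_metric (\<lambda>_. A)"
proof -
  let ?g = "\<lambda>_::real^'n. A"
  have const: "metric_inner ?g x u v = metric_inner ?g 0 u v" for x u v by (simp add: metric_inner_def)
  obtain k where k: "0 < k" "\<And>z v. z \<in> {0} \<Longrightarrow> k * norm v \<le> sqrt (metric_inner ?g z v v)"
    by (rule metric_lower_bound[OF g, of "{0}"]) auto
  have ge: "k * norm (y - x) \<le> riemannian_dist ?g x y" for x y
  proof (rule riemannian_dist_greatest[OF g])
    fix c L assume c: "curve_of_length ?g x y c L"
    have "k * norm (c 1 - x) \<le> L"
      by (rule length_ge_chord[OF g c]) (use k(1) k(2)[of 0] in \<open>simp_all add: const[of "c _"]\<close>)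
    then show "k * norm (y - x) \<le> L" using c by (simp add: curve_of_length_def)
  qed
  have le: "riemannian_dist ?g x y \<le> sqrt (metric_inner ?g 0 (y - x) (y - x))" for x y
  proof (rule riemannian_dist_le[OF g])
    have "curve_speed ?g (linepath x y) = (\<lambda>_. sqrt (metric_inner ?g 0 (y - x) (y - x)))"
      by (simp add: fun_eq_iff curve_speed_def const[of "linepath x y _"])
    then show "curve_of_length ?g x y (linepath x y) (sqrt (metric_inner ?g 0 (y - x) (y - x)))"
      using has_integral_const_real[of "sqrt (metric_inner ?g 0 (y - x) (y - x))" 0 1]
      by (simp add: curve_of_length_def linepath_0' linepath_1')
  qed
  interpret G: Metric_space UNIV "riemannian_dist ?g" by (rule Metric_space_riemannian_dist[OF g])
  show ?thesis
    unfolding complete_metric_def G.mcomplete_def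
  proof (intro allI impI)
    fix \<sigma> :: "nat \<Rightarrow> real^'n" assume \<sigma>: "G.MCauchy \<sigma>"
    have "Cauchy \<sigma>"
    proof (rule metric_CauchyI)
      fix e :: real assume "0 < e"
      then have "0 < k * e" using k by simp
      then obtain N where N: "\<And>n n'. N \<le> n \<Longrightarrow> N \<le> n' \<Longrightarrow> riemannian_dist ?g (\<sigma> n) (\<sigma> n') < k * e"
        using \<sigma> unfolding G.MCauchy_def by meson
      have "dist (\<sigma> m) (\<sigma> n) < e" if "N \<le> m" "N \<le> n" for m n
      proof -
        have "k * norm (\<sigma> n - \<sigma> m) < k * e" using ge[of "\<sigma> n" "\<sigma> m"] N[OF that] by linarith
        then show ?thesis using k(1) by (simp add: dist_norm norm_minus_commute)
      qed
      then show "\<exists>M. \<forall>m\<ge>M. \<forall>n\<ge>M. dist (\<sigma> m) (\<sigma> n) < e" by blast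
    qed
    then obtain l where l: "\<sigma> \<longlonglongrightarrow> l" using Cauchy_convergent convergent_def by blast
    have "continuous_on UNIV (\<lambda>v. sqrt (metric_inner ?g 0 (l - v) (l - v)))"
      by (intro continuous_on_real_sqrt continuous_on_metric_inner[OF g] continuous_intros)
    from continuous_on_tendsto_compose[OF this l]
    have lim: "(\<lambda>n. sqrt (metric_inner ?g 0 (l - \<sigma> n) (l - \<sigma> n))) \<longlonglongrightarrow> 0" by (simp add: metric_inner_def)
    have "limitin G.mtopology \<sigma> l sequentially"
      unfolding G.limit_metric_sequentially
    proof (intro conjI allI impI)
      fix \<epsilon> :: real assume "0 < \<epsilon>"
      from order_tendstoD(2)[OF lim this] obtain N where "\<And>n. N \<le> n \<Longrightarrow> sqrt (metric_inner ?g 0 (l - \<sigma> n) (l - \<sigma> n)) < \<epsilon>"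
        unfolding eventually_sequentially by blast
      then have "\<forall>n\<ge>N. \<sigma> n \<in> UNIV \<and> riemannian_dist ?g (\<sigma> n) l < \<epsilon>"
        using le le_less_trans by blast
      then show "\<exists>N. \<forall>n\<ge>N. \<sigma> n \<in> UNIV \<and> riemannian_dist ?g (\<sigma> n) l < \<epsilon>" by blast
    qed simp
    then show "\<exists>x. limitin G.mtopology \<sigma> x sequentially" by blast
  qed
qed

section \<open>Scaled shears of the plane\<close>

text \<open>The shear \<open>(x\<^sub>1, x\<^sub>2) \<mapsto> (x\<^sub>1, x\<^sub>2 + q x\<^sub>1)\<close> followed by the scaling by \<open>\<rho>\<close>.\<close>

definition shear_map :: "real \<Rightarrow> real poly \<Rightarrow> real^2 \<Rightarrow> real^2" where
  "shear_map \<rho> q x = (\<chi> k. \<rho> * (if k = 1 then x $ 1 else x $ 2 + poly q (x $ 1)))"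

text \<open>The Jacobian matrix of the shear without the scaling factor, in row \<open>k\<close> and column \<open>i\<close>.\<close>

definition shear_jac :: "real poly \<Rightarrow> real^2 \<Rightarrow> 2 \<Rightarrow> 2 \<Rightarrow> real" where
  "shear_jac q x k i = (if k = i then 1 else if k = 2 then poly (pderiv q) (x $ 1) else 0)"

text \<open>For \<open>\<rho> \<noteq> 0\<close> this is the pullback of \<open>g\<close> under \<open>shear_map \<rho> q\<close> divided by \<open>\<rho>\<^sup>2\<close>. In this normalisation
  it extends continuously to \<open>\<rho> = 0\<close>, where without a shear it is the constant metric \<open>g 0\<close>.\<close>

definition shear_pullback :: "real \<Rightarrow> real poly \<Rightarrow> 2 metric_field \<Rightarrow> 2 metric_field" where
  "shear_pullback \<rho> q g x = (\<chi> i j. \<Sum>k\<in>UNIV. \<Sum>l\<in>UNIV. shear_jac q x k i * coeff_fun g k l (shear_map \<rho> q x) * shear_jac q x l j)"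

lemma coeff_fun_shear_pullback_sum:
  "coeff_fun (shear_pullback \<rho> q g) i j x =
     (\<Sum>k\<in>UNIV. \<Sum>l\<in>UNIV. shear_jac q x k i * coeff_fun g k l (shear_map \<rho> q x) * shear_jac q x l j)"
  by (simp add: coeff_fun_def[of "shear_pullback \<rho> q g"] shear_pullback_def)

lemma coeff_fun_shear_pullback:
  defines "a \<equiv> \<lambda>q x. poly (pderiv q) (x $ 1)"
  shows "coeff_fun (shear_pullback \<rho> q g) 1 1 x = coeff_fun g 1 1 (shear_map \<rho> q x) + a q x * coeff_fun g 1 2 (shear_map \<rho> q x)
       + a q x * coeff_fun g 2 1 (shear_map \<rho> q x) + a q x * a q x * coeff_fun g 2 2 (shear_map \<rho> q x)"
    and "coeff_fun (shear_pullback \<rho> q g) 1 2 x = coeff_fun g 1 2 (shear_map \<rho> q x) + a q x * coeff_fun g 2 2 (shear_map \<rho> q x)"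
    and "coeff_fun (shear_pullback \<rho> q g) 2 1 x = coeff_fun g 2 1 (shear_map \<rho> q x) + a q x * coeff_fun g 2 2 (shear_map \<rho> q x)"
    and "coeff_fun (shear_pullback \<rho> q g) 2 2 x = coeff_fun g 2 2 (shear_map \<rho> q x)"
  by (simp_all add: coeff_fun_shear_pullback_sum sum_2 shear_jac_def a_def algebra_simps)

lemma jointly_smooth_if:
  "jointly_smooth f \<Longrightarrow> jointly_smooth g \<Longrightarrow> jointly_smooth (\<lambda>p x. if b then f p x else g p x)"
  by (cases b) simp_all

lemma jointly_smooth_shear_pullback:
  fixes g :: "'p::topological_space \<Rightarrow> 2 metric_field"
  assumes g: "\<And>i j. jointly_smooth (\<lambda>p. coeff_fun (g p) i j)" and \<rho>: "continuous_on UNIV \<rho>"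
    and q: "jointly_smooth (\<lambda>p (x::real^2). poly (q p) (x $ 1))" and q': "jointly_smooth (\<lambda>p (x::real^2). poly (pderiv (q p)) (x $ 1))"
  shows "jointly_smooth (\<lambda>p. coeff_fun (shear_pullback (\<rho> p) (q p) (g p)) i j)"
proof -
  have jac: "jointly_smooth (\<lambda>p x. shear_jac (q p) x k i)" for k i
    unfolding shear_jac_def
    by (rule jointly_smooth_if[OF jointly_smooth_param[OF continuous_on_const]
          jointly_smooth_if[OF q' jointly_smooth_param[OF continuous_on_const]]])
  have "jointly_smooth (\<lambda>p (x::real^2). \<rho> p * (if k = 1 then x $ 1 else x $ 2 + poly (q p) (x $ 1)))" for k :: 2
    by (rule jointly_smooth_mult[OF jointly_smooth_param[OF \<rho>]
          jointly_smooth_if[OF jointly_smooth_coordinate jointly_smooth_add[OF jointly_smooth_coordinate q]]])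
  from jointly_smooth_compose[OF g this]
  have comp: "jointly_smooth (\<lambda>p x. coeff_fun (g p) k l (shear_map (\<rho> p) (q p) x))" for k l
    unfolding shear_map_def .
  have "jointly_smooth (\<lambda>p x. \<Sum>k\<in>UNIV. \<Sum>l\<in>UNIV. shear_jac (q p) x k i * coeff_fun (g p) k l (shear_map (\<rho> p) (q p) x) * shear_jac (q p) x l j)"
    by (rule jointly_smooth_sum[OF finite jointly_smooth_sum[OF finite jointly_smooth_mult[OF jointly_smooth_mult[OF jac comp] jac]]])
  moreover have "coeff_fun (shear_pullback (\<rho> p) (q p) (g p)) i j =
     (\<lambda>x. \<Sum>k\<in>UNIV. \<Sum>l\<in>UNIV. shear_jac (q p) x k i * coeff_fun (g p) k l (shear_map (\<rho> p) (q p) x) * shear_jac (q p) x l j)" for p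
    by (rule ext) (rule coeff_fun_shear_pullback_sum)
  ultimately show ?thesis by simp
qed

lemma smooth_shear_pullback:
  assumes "\<And>i j. smooth (coeff_fun g i j)"
  shows "smooth (coeff_fun (shear_pullback \<rho> q g) i j)"
proof -
  have "jointly_smooth (\<lambda>_::real. coeff_fun (shear_pullback \<rho> q g) i j)"
    by (rule jointly_smooth_shear_pullback[OF smooth_imp_jointly_smooth[OF assms] continuous_on_const jointly_smooth_poly jointly_smooth_poly])
  then show ?thesis by (rule jointly_smooth_imp_smooth)
qed

lemma riemannian_metric_shear_pullback:
  assumes g: "riemannian_metric g"
  shows "riemannian_metric (shear_pullback \<rho> q g)"
    and "gram_det (shear_pullback \<rho> q g) x = gram_det g (shear_map \<rho> q x)"
proof -
  have sm: "\<And>i j. smooth (coeff_fun g i j)" and sym: "\<And>x. coeff_fun g 2 1 x = coeff_fun g 1 2 x"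
    and pos: "\<And>x. coeff_fun g 1 1 x > 0" and det: "\<And>x. gram_det g x > 0"
    using g by (auto simp: riemannian_metric_plane)
  show det': "gram_det (shear_pullback \<rho> q g) x = gram_det g (shear_map \<rho> q x)" for x
    by (simp add: gram_det_def coeff_fun_shear_pullback sym algebra_simps)
  have "coeff_fun (shear_pullback \<rho> q g) 1 1 x > 0" for x
  proof -
    let ?a = "poly (pderiv q) (x $ 1)" and ?y = "shear_map \<rho> q x"
    let ?v = "(\<chi> i. if i = 1 then 1 else ?a) :: real^2"
    have "?v $ 1 \<noteq> 0" by simp
    then have "?v \<noteq> 0" by (metis zero_index)
    then have "metric_inner g ?y ?v ?v > 0" using g by (simp add: riemannian_metric_def)
    then show ?thesis by (simp add: metric_inner_sum sum_2 coeff_fun_shear_pullback algebra_simps)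
  qed
  moreover have "coeff_fun (shear_pullback \<rho> q g) 2 1 x = coeff_fun (shear_pullback \<rho> q g) 1 2 x" for x
    by (simp add: coeff_fun_shear_pullback sym)
  ultimately show "riemannian_metric (shear_pullback \<rho> q g)"
    using smooth_shear_pullback[OF sm] det det' by (auto simp: riemannian_metric_plane)
qed

text \<open>The invariance of the curvature under a shear with slope \<open>a\<close>, as an identity of polynomials: the left-hand
  side is formed from the coefficients and derivatives of the new metric, computed by the chain rule from
  those of the old one. The derivative \<open>b\<close> of the slope cancels.\<close>

lemma gauss_num_shear_identity:
  fixes E F G E1 E2 F1 F2 G1 G2 F12 F22 G11 G12 G22 E22 a b r :: real
  defines "e \<equiv> E + 2 * (a * F) + a * a * G" and "f \<equiv> F + a * G"
    and "e1 \<equiv> r * (E1 + a * E2) + 2 * (b * F + a * (r * (F1 + a * F2))) + (2 * a * b * G + a * a * (r * (G1 + a * G2)))"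
    and "e2 \<equiv> r * E2 + 2 * (a * (r * F2)) + a * a * (r * G2)"
    and "f1 \<equiv> r * (F1 + a * F2) + (b * G + a * (r * (G1 + a * G2)))" and "f2 \<equiv> r * F2 + a * (r * G2)"
    and "g1 \<equiv> r * (G1 + a * G2)" and "g2 \<equiv> r * G2"
    and "f12 \<equiv> r * (r * (F12 + a * F22)) + (b * (r * G2) + a * (r * (r * (G12 + a * G22))))"
    and "g11 \<equiv> r * (r * (G11 + a * G12) + (b * G2 + a * (r * (G12 + a * G22))))"
    and "e22 \<equiv> r * (r * E22) + 2 * (a * (r * (r * F22))) + a * a * (r * (r * G22))"
  shows "(E * G - F * F) * (f12 - g11 / 2 - e22 / 2) + (G * e2 * e2 - 2 * f * e2 * g1 + e * g1 * g1) / 4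
     - (G * e1 * (f2 - g1 / 2) / 2 - f * (e1 * g2 / 4 + (f1 - e2 / 2) * (f2 - g1 / 2)) + e * (f1 - e2 / 2) * g2 / 2)
    = r\<^sup>2 * ((E * G - F * F) * (F12 - G11 / 2 - E22 / 2) + (G * E2 * E2 - 2 * F * E2 * G1 + E * G1 * G1) / 4
     - (G * E1 * (F2 - G1 / 2) / 2 - F * (E1 * G2 / 4 + (F1 - E2 / 2) * (F2 - G1 / 2)) + E * (F1 - E2 / 2) * G2 / 2))"
  unfolding assms by (simp add: field_simps power2_eq_square)

definition shear_deriv :: "real \<Rightarrow> real poly \<Rightarrow> real^2 \<Rightarrow> real^2 \<Rightarrow> real^2" where
  "shear_deriv \<rho> q x u = (\<chi> k. \<rho> * (if k = 1 then u $ 1 else u $ 2 + poly (pderiv q) (x $ 1) * u $ 1))"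

lemma has_derivative_shear_map: "(shear_map \<rho> q has_derivative shear_deriv \<rho> q x) (at x)"
proof -
  have n: "((\<lambda>x. x $ k) has_derivative (\<lambda>h. h $ k)) (at x)" for k and x :: "real^2"
    by (rule bounded_linear_imp_has_derivative[OF bounded_linear_vec_nth])
  have "(poly q has_derivative (\<lambda>h. poly (pderiv q) (x $ 1) * h)) (at (x $ 1))"
    using poly_DERIV[of q "x $ 1"] by (simp only: has_field_derivative_def)
  from has_derivative_compose[OF n this]
  have p: "((\<lambda>x. x $ 2 + poly q (x $ 1)) has_derivative (\<lambda>h. h $ 2 + poly (pderiv q) (x $ 1) * h $ 1)) (at x)"
    by (rule has_derivative_add[OF n])
  have "((\<lambda>x. \<rho> * (if k = 1 then x $ 1 else x $ 2 + poly q (x $ 1))) has_derivative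
     (\<lambda>u. \<rho> * (if k = 1 then u $ 1 else u $ 2 + poly (pderiv q) (x $ 1) * u $ 1))) (at x)" for k :: 2
    by (cases "k = 1") (simp_all add: has_derivative_mult_right n p)
  from has_derivative_vec_lambda_componentwise[OF this] show ?thesis
    unfolding shear_map_def shear_deriv_def .
qed

lemma partial_deriv_shear:
  assumes f: "smooth f"
  shows "(\<lambda>x. f (shear_map \<rho> q x)) differentiable at x"
    and "partial_deriv 1 (\<lambda>x. f (shear_map \<rho> q x)) x =
      \<rho> * (partial_deriv 1 f (shear_map \<rho> q x) + poly (pderiv q) (x $ 1) * partial_deriv 2 f (shear_map \<rho> q x))"
    and "partial_deriv 2 (\<lambda>x. f (shear_map \<rho> q x)) x = \<rho> * partial_deriv 2 f (shear_map \<rho> q x)"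
proof -
  note d = smooth_differentiable[OF f, of "shear_map \<rho> q x"]
  have D: "((\<lambda>x. f (shear_map \<rho> q x)) has_derivative
      (\<lambda>u. frechet_derivative f (at (shear_map \<rho> q x)) (shear_deriv \<rho> q x u))) (at x)"
    by (rule has_derivative_compose[OF has_derivative_shear_map has_derivative_frechet[OF d]])
  then show "(\<lambda>x. f (shear_map \<rho> q x)) differentiable at x" by (rule differentiableI)
  show "partial_deriv 1 (\<lambda>x. f (shear_map \<rho> q x)) x =
      \<rho> * (partial_deriv 1 f (shear_map \<rho> q x) + poly (pderiv q) (x $ 1) * partial_deriv 2 f (shear_map \<rho> q x))"
    "partial_deriv 2 (\<lambda>x. f (shear_map \<rho> q x)) x = \<rho> * partial_deriv 2 f (shear_map \<rho> q x)"
    unfolding partial_deriv_eq[OF D] frechet_derivative_eq_partial[OF d] sum_2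
    by (simp_all add: shear_deriv_def axis_def algebra_simps)
qed

lemma partial_deriv_poly:
  shows "(\<lambda>x::real^2. poly q (x $ 1)) differentiable at x"
    and "partial_deriv 1 (\<lambda>x::real^2. poly q (x $ 1)) x = poly (pderiv q) (x $ 1)"
    and "partial_deriv 2 (\<lambda>x::real^2. poly q (x $ 1)) x = 0"
proof -
  have "(poly q has_derivative (\<lambda>h. poly (pderiv q) (x $ 1) * h)) (at (x $ 1))"
    using poly_DERIV[of q "x $ 1"] by (simp only: has_field_derivative_def)
  from has_derivative_compose[OF bounded_linear_imp_has_derivative[OF bounded_linear_vec_nth] this]
  have D: "((\<lambda>x::real^2. poly q (x $ 1)) has_derivative (\<lambda>h. poly (pderiv q) (x $ 1) * h $ 1)) (at x)" .
  then show "(\<lambda>x::real^2. poly q (x $ 1)) differentiable at x" by (auto simp: differentiable_def)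
  show "partial_deriv 1 (\<lambda>x::real^2. poly q (x $ 1)) x = poly (pderiv q) (x $ 1)"
    "partial_deriv 2 (\<lambda>x::real^2. poly q (x $ 1)) x = 0"
    unfolding partial_deriv_eq[OF D] by (simp_all add: axis_def)
qed

text \<open>The derivatives of the new coefficients that occur in \<open>gauss_num\<close> are computed one by one, in the form in
  which \<open>gauss_num_shear_identity\<close> expects them.\<close>

lemma gauss_num_shear_pullback:
  assumes g: "riemannian_metric g"
  shows "gauss_num (shear_pullback \<rho> q g) x = \<rho>\<^sup>2 * gauss_num g (shear_map \<rho> q x)"
proof -
  define y where "y = shear_map \<rho> q"
  define a where "a x = poly (pderiv q) (x $ 1)" for x :: "real^2"
  define E F G where "E = coeff_fun g 1 1" and "F = coeff_fun g 1 2" and "G = coeff_fun g 2 2"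
  have sm: "smooth E" "smooth F" "smooth G" and sym: "coeff_fun g 2 1 = F"
    using g by (auto simp: riemannian_metric_plane E_def F_def G_def)
  note sm' = smooth_partial_deriv[OF sm(1)] smooth_partial_deriv[OF sm(2)] smooth_partial_deriv[OF sm(3)]
  note pf = partial_deriv_shear[of _ \<rho> q, folded y_def a_def]
  note pa = partial_deriv_poly[of "pderiv q", folded a_def]
  define b where "b = poly (pderiv (pderiv q)) (x $ 1)"
  have diff: "(\<lambda>x. f (y x)) differentiable at x" if "smooth f" for f x
    by (rule pf(1)[OF that])
  have e: "coeff_fun (shear_pullback \<rho> q g) 1 1 = (\<lambda>x. E (y x) + 2 * (a x * F (y x)) + a x * a x * G (y x))"
    by (rule ext) (simp add: coeff_fun_shear_pullback sym E_def G_def F_def y_def a_def)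
  have f: "coeff_fun (shear_pullback \<rho> q g) 1 2 = (\<lambda>x. F (y x) + a x * G (y x))"
    by (rule ext) (simp add: coeff_fun_shear_pullback G_def F_def y_def a_def)
  have h: "coeff_fun (shear_pullback \<rho> q g) 2 2 = (\<lambda>x. G (y x))"
    by (rule ext) (simp add: coeff_fun_shear_pullback G_def y_def)
  note ds = diff[OF sm(1)] diff[OF sm(2)] diff[OF sm(3)] diff[OF sm'(1)] diff[OF sm'(2)] diff[OF sm'(3)] pa(1)
  note rules = partial_deriv_const partial_deriv_add partial_deriv_mult partial_deriv_cmult differentiable_add differentiable_mult differentiable_const ds
    pf(2,3)[OF sm(1)] pf(2,3)[OF sm(2)] pf(2,3)[OF sm(3)] pf(2,3)[OF sm'(1)] pf(2,3)[OF sm'(2)] pf(2,3)[OF sm'(3)] pa(2,3)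
  have e2: "partial_deriv 2 (\<lambda>x. E (y x) + 2 * (a x * F (y x)) + a x * a x * G (y x)) =
     (\<lambda>x. \<rho> * partial_deriv 2 E (y x) + 2 * (a x * (\<rho> * partial_deriv 2 F (y x))) + a x * a x * (\<rho> * partial_deriv 2 G (y x)))"
    by (rule ext) (simp add: rules)
  have e1: "partial_deriv 1 (\<lambda>x. E (y x) + 2 * (a x * F (y x)) + a x * a x * G (y x)) x =
     \<rho> * (partial_deriv 1 E (y x) + a x * partial_deriv 2 E (y x)) + 2 * (b * F (y x) + a x * (\<rho> * (partial_deriv 1 F (y x) + a x * partial_deriv 2 F (y x))))
      + (2 * a x * b * G (y x) + a x * a x * (\<rho> * (partial_deriv 1 G (y x) + a x * partial_deriv 2 G (y x))))"
    by (simp add: rules b_def algebra_simps)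
  have f2: "partial_deriv 2 (\<lambda>x. F (y x) + a x * G (y x)) = (\<lambda>x. \<rho> * partial_deriv 2 F (y x) + a x * (\<rho> * partial_deriv 2 G (y x)))"
    by (rule ext) (simp add: rules)
  have f1: "partial_deriv 1 (\<lambda>x. F (y x) + a x * G (y x)) x = \<rho> * (partial_deriv 1 F (y x) + a x * partial_deriv 2 F (y x))
      + (b * G (y x) + a x * (\<rho> * (partial_deriv 1 G (y x) + a x * partial_deriv 2 G (y x))))"
    by (simp add: rules b_def algebra_simps)
  have h1: "partial_deriv 1 (\<lambda>x. G (y x)) = (\<lambda>x. \<rho> * (partial_deriv 1 G (y x) + a x * partial_deriv 2 G (y x)))"
    by (rule ext) (simp add: rules)
  have h2: "partial_deriv 2 (\<lambda>x. G (y x)) x = \<rho> * partial_deriv 2 G (y x)"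
    by (simp add: rules)
  have comm: "partial_deriv 2 (partial_deriv 1 G) z = partial_deriv 1 (partial_deriv 2 G) z" for z
    by (rule partial_deriv_commute[OF sm(3)])
  have f12: "partial_deriv 1 (\<lambda>x. \<rho> * partial_deriv 2 F (y x) + a x * (\<rho> * partial_deriv 2 G (y x))) x =
      \<rho> * (\<rho> * (partial_deriv 1 (partial_deriv 2 F) (y x) + a x * partial_deriv 2 (partial_deriv 2 F) (y x)))
      + (b * (\<rho> * partial_deriv 2 G (y x)) + a x * (\<rho> * (\<rho> * (partial_deriv 1 (partial_deriv 2 G) (y x) + a x * partial_deriv 2 (partial_deriv 2 G) (y x)))))"
    by (simp add: rules b_def)
  have h11: "partial_deriv 1 (\<lambda>x. \<rho> * (partial_deriv 1 G (y x) + a x * partial_deriv 2 G (y x))) x =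
      \<rho> * (\<rho> * (partial_deriv 1 (partial_deriv 1 G) (y x) + a x * partial_deriv 1 (partial_deriv 2 G) (y x))
       + (b * partial_deriv 2 G (y x) + a x * (\<rho> * (partial_deriv 1 (partial_deriv 2 G) (y x) + a x * partial_deriv 2 (partial_deriv 2 G) (y x)))))"
    by (simp add: rules b_def comm)
  have e22: "partial_deriv 2 (\<lambda>x. \<rho> * partial_deriv 2 E (y x) + 2 * (a x * (\<rho> * partial_deriv 2 F (y x))) + a x * a x * (\<rho> * partial_deriv 2 G (y x))) x =
      \<rho> * (\<rho> * partial_deriv 2 (partial_deriv 2 E) (y x)) + 2 * (a x * (\<rho> * (\<rho> * partial_deriv 2 (partial_deriv 2 F) (y x))))
        + a x * a x * (\<rho> * (\<rho> * partial_deriv 2 (partial_deriv 2 G) (y x)))"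
    by (simp add: rules)
  have det: "gram_det (shear_pullback \<rho> q g) x = E (y x) * G (y x) - F (y x) * F (y x)"
    "gram_det g (y x) = E (y x) * G (y x) - F (y x) * F (y x)"
    unfolding riemannian_metric_shear_pullback(2)[OF g] by (simp_all add: gram_det_def E_def F_def G_def y_def)
  show ?thesis
    unfolding gauss_num_def Let_def y_def[symmetric] det e f h e2 f2 h1 E_def[symmetric] F_def[symmetric] G_def[symmetric]
    unfolding e1 f1 h2 f12 h11 e22
    by (rule gauss_num_shear_identity)
qed

lemma continuous_shear_deriv: "continuous_on UNIV (\<lambda>(x, u). shear_deriv \<rho> q x u)"
proof -
  have "continuous_on UNIV (\<lambda>z::(real^2) \<times> (real^2). \<rho> * (if k = 1 then snd z $ 1 else snd z $ 2 + poly (pderiv q) (fst z $ 1) * snd z $ 1))" for k :: 2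
    by (cases "k = 1") (auto intro!: continuous_intros continuous_on_poly)
  then show ?thesis
    unfolding shear_deriv_def case_prod_unfold by (rule continuous_on_vec_lambda)
qed

lemma shear_map_inverse:
  fixes q :: "real poly"
  assumes "\<rho> \<noteq> 0"
  defines "q' \<equiv> smult (- \<rho>) (pcompose q [:0, 1 / \<rho>:])"
  shows "shear_map \<rho> q (shear_map (1 / \<rho>) q' y) = y" and "shear_map (1 / \<rho>) q' (shear_map \<rho> q x) = x"
  using assms(1) by (simp_all add: vec_eq_iff forall_2 shear_map_def q'_def poly_pcompose field_simps)

lemma shear_pullback_mem_nonneg_planes:
  assumes g: "g \<in> nonneg_planes" and \<rho>: "0 < \<rho>"
  shows "shear_pullback \<rho> q g \<in> nonneg_planes"
proof -
  have gm: "riemannian_metric g" "complete_metric g" "nonneg_sectional_curvature g"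
    using g by (auto simp: nonneg_planes_def)
  note hm = riemannian_metric_shear_pullback(1)[OF gm(1), of \<rho> q]
  have sym: "coeff_fun g 2 1 x = coeff_fun g 1 2 x" for x
    using gm(1) by (simp add: riemannian_metric_plane)
  have "nonneg_sectional_curvature (shear_pullback \<rho> q g)"
    using gm(3) unfolding nonneg_sectional_curvature_plane[OF hm] nonneg_sectional_curvature_plane[OF gm(1)]
    by (simp add: gauss_num_shear_pullback[OF gm(1)])
  moreover have "complete_metric (shear_pullback \<rho> q g)"
  proof (rule complete_metric_homothety[OF gm(1) hm \<rho>, where \<psi> = "shear_map \<rho> q" and D = "shear_deriv \<rho> q"
        and \<phi> = "shear_map (1 / \<rho>) (smult (- \<rho>) (pcompose q [:0, 1 / \<rho>:]))"
        and D' = "shear_deriv (1 / \<rho>) (smult (- \<rho>) (pcompose q [:0, 1 / \<rho>:]))"])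
    show "metric_inner g (shear_map \<rho> q x) (shear_deriv \<rho> q x u) (shear_deriv \<rho> q x u) = \<rho>\<^sup>2 * metric_inner (shear_pullback \<rho> q g) x u u" for x u
      by (simp add: metric_inner_sum sum_2 coeff_fun_shear_pullback shear_deriv_def sym power2_eq_square algebra_simps)
    show "shear_map \<rho> q (shear_map (1 / \<rho>) (smult (- \<rho>) (pcompose q [:0, 1 / \<rho>:])) y) = y"
      "shear_map (1 / \<rho>) (smult (- \<rho>) (pcompose q [:0, 1 / \<rho>:])) (shear_map \<rho> q y) = y" for y
      using shear_map_inverse[of \<rho> q] \<rho> by blast+
  qed (rule has_derivative_shear_map continuous_shear_deriv gm(2))+
  ultimately show ?thesis using hm by (simp add: nonneg_planes_def)
qed

lemma const_mem_nonneg_planes: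
  fixes A :: "real^2^2"
  assumes A: "riemannian_metric (\<lambda>_. A)"
  shows "(\<lambda>_. A) \<in> nonneg_planes"
proof -
  have c: "coeff_fun (\<lambda>_. A) i j = (\<lambda>_. A $ i $ j)" for i j
    by (rule ext) (simp add: coeff_fun_def)
  have d: "partial_deriv i (\<lambda>_::real^2. a) = (\<lambda>_. 0)" for i a
    by (rule ext) (rule partial_deriv_const)
  have "gauss_num (\<lambda>_. A) x = 0" for x
    by (simp add: gauss_num_def Let_def c d)
  then have "nonneg_sectional_curvature (\<lambda>_. A)"
    by (simp add: nonneg_sectional_curvature_plane[OF A])
  then show ?thesis
    using A complete_metric_const[OF A] by (simp add: nonneg_planes_def)
qed

section \<open>Families of metrics with prescribed ends\<close>

definition clamp01 :: "real \<Rightarrow> real" where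
  "clamp01 t = max 0 (min 1 t)"

lemma continuous_clamp01: "continuous_on UNIV f \<Longrightarrow> continuous_on UNIV (\<lambda>p. clamp01 (f p))"
  unfolding clamp01_def by (intro continuous_on_max continuous_on_min continuous_on_const)

text \<open>Three stages: for \<open>t\<close> from \<open>1/5\<close> to \<open>2/5\<close> the metric \<open>g0\<close> is shrunk to \<open>g0 0\<close>, up to \<open>3/5\<close> the
  constant metrics \<open>g0 0\<close> and \<open>g1 0\<close> are interpolated, and up to \<open>4/5\<close> the metric \<open>g1\<close> is expanded. Before and
  after the path rests, which leaves time to turn shears on and off. A single formula with clamped
  parameters replaces a definition by cases, so that joint smoothness follows from closure properties.\<close>

definition base_path :: "2 metric_field \<Rightarrow> 2 metric_field \<Rightarrow> real \<Rightarrow> 2 metric_field" where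
  "base_path g0 g1 t x = (\<chi> i j. (1 - clamp01 (5 * t - 2)) * coeff_fun (shear_pullback (clamp01 (2 - 5 * t)) 0 g0) i j x
      + clamp01 (5 * t - 2) * coeff_fun (shear_pullback (clamp01 (5 * t - 3)) 0 g1) i j x)"

lemma shear_pullback_id_at:
  assumes "poly q (x $ 1) = 0" "poly (pderiv q) (x $ 1) = 0"
  shows "shear_pullback 1 q g x = g x"
proof -
  have e: "shear_map 1 q x = x" using assms by (simp add: vec_eq_iff forall_2 shear_map_def)
  show ?thesis
    unfolding vec_eq_iff forall_2 using assms by (simp add: shear_pullback_def sum_2 shear_jac_def coeff_fun_def e)
qed

lemma shear_pullback_id [simp]: "shear_pullback 1 0 g = g"
  by (rule ext) (simp add: shear_pullback_id_at)

lemma vec_lambda_coeff_fun: "(\<chi> i j. coeff_fun g i j x) = g x"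
  by (simp add: vec_eq_iff coeff_fun_def)

lemma base_path_left: "t \<le> 2/5 \<Longrightarrow> base_path g0 g1 t = shear_pullback (clamp01 (2 - 5 * t)) 0 g0"
  by (rule ext) (simp add: base_path_def clamp01_def vec_lambda_coeff_fun)

lemma base_path_right: "3/5 \<le> t \<Longrightarrow> base_path g0 g1 t = shear_pullback (clamp01 (5 * t - 3)) 0 g1"
  by (rule ext) (simp add: base_path_def clamp01_def vec_lambda_coeff_fun)

lemma base_path_mem_nonneg_planes:
  assumes g0: "g0 \<in> nonneg_planes" and g1: "g1 \<in> nonneg_planes"
  shows "base_path g0 g1 t \<in> nonneg_planes"
proof -
  consider "t < 2/5" | "3/5 < t" | "2/5 \<le> t" "t \<le> 3/5" by linarith
  then show ?thesis
  proof cases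
    case 1
    then show ?thesis by (simp add: base_path_left shear_pullback_mem_nonneg_planes g0 clamp01_def)
  next
    case 2
    then show ?thesis by (simp add: base_path_right shear_pullback_mem_nonneg_planes g1 clamp01_def)
  next
    case 3
    define l where "l = 5 * t - 2"
    have l: "clamp01 (5 * t - 2) = l" "0 \<le> l" "l \<le> 1" "clamp01 (2 - 5 * t) = 0" "clamp01 (5 * t - 3) = 0"
      using 3 by (auto simp: clamp01_def l_def)
    define A where "A = ((\<chi> i j. (1 - l) * coeff_fun g0 i j 0 + l * coeff_fun g1 i j 0) :: real^2^2)"
    have z: "coeff_fun (shear_pullback 0 0 g) i j x = coeff_fun g i j 0" for g i j x
    proof -
      have "shear_map 0 0 x = 0" by (simp add: vec_eq_iff shear_map_def)
      then show ?thesis using exhaust_2[of i] exhaust_2[of j] by (auto simp: coeff_fun_shear_pullback)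
    qed
    have eq: "base_path g0 g1 t = (\<lambda>_. A)"
      by (rule ext) (simp add: base_path_def l A_def z)
    have inner: "metric_inner (\<lambda>_. A) x u v = (1 - l) * metric_inner g0 0 u v + l * metric_inner g1 0 u v" for x u v
      by (simp add: metric_inner_sum sum_2 A_def coeff_fun_def algebra_simps)
    have m: "riemannian_metric g0" "riemannian_metric g1" using g0 g1 by (auto simp: nonneg_planes_def)
    have "riemannian_metric (\<lambda>_. A)"
      unfolding riemannian_metric_def
    proof (intro conjI allI impI)
      fix i j
      have "coeff_fun (\<lambda>_. A) i j = (\<lambda>_. A $ i $ j)" by (rule ext) (simp add: coeff_fun_def)
      then show "smooth (coeff_fun (\<lambda>_. A) i j)"
        using jointly_smooth_imp_smooth[OF jointly_smooth_param[OF continuous_on_const[of "UNIV::real set" "A $ i $ j"]]] by simp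
    next
      fix x u v :: "real^2"
      show "metric_inner (\<lambda>_. A) x u v = metric_inner (\<lambda>_. A) x v u"
        using m by (simp add: inner riemannian_metric_def)
    next
      fix x v :: "real^2" assume "v \<noteq> 0"
      then have p: "0 < metric_inner g0 0 v v" "0 < metric_inner g1 0 v v" using m by (auto simp: riemannian_metric_def)
      show "0 < metric_inner (\<lambda>_. A) x v v"
      proof (cases "l = 0")
        case False
        then have "0 < l * metric_inner g1 0 v v" "0 \<le> (1 - l) * metric_inner g0 0 v v" using l p by simp_all
        then show ?thesis unfolding inner by linarith
      qed (use p in \<open>simp add: inner\<close>)
    qed
    then show ?thesis unfolding eq by (rule const_mem_nonneg_planes)
  qed
qed

lemma jointly_smooth_base_path:
  fixes \<tau> :: "'p::topological_space \<Rightarrow> real"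
  assumes g0: "riemannian_metric g0" and g1: "riemannian_metric g1" and \<tau>: "continuous_on UNIV \<tau>"
  shows "jointly_smooth (\<lambda>p. coeff_fun (base_path g0 g1 (\<tau> p)) i j)"
proof -
  have sm: "smooth (coeff_fun g0 i j)" "smooth (coeff_fun g1 i j)" for i j
    using g0 g1 by (auto simp: riemannian_metric_def)
  have js: "jointly_smooth (\<lambda>p. coeff_fun (shear_pullback (\<rho> p) 0 g) i j)"
    if "continuous_on UNIV \<rho>" "\<And>i j. smooth (coeff_fun g i j)" for \<rho> :: "'p \<Rightarrow> real" and g
    by (rule jointly_smooth_shear_pullback[OF smooth_imp_jointly_smooth[OF that(2)] that(1) jointly_smooth_poly jointly_smooth_poly])
  have cl: "continuous_on UNIV (\<lambda>p. clamp01 (5 * \<tau> p - 2))" "continuous_on UNIV (\<lambda>p. clamp01 (2 - 5 * \<tau> p))"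
    "continuous_on UNIV (\<lambda>p. clamp01 (5 * \<tau> p - 3))"
    by (intro continuous_clamp01 continuous_intros \<tau>)+
  have eq: "coeff_fun (base_path g0 g1 t) i j = (\<lambda>x. (1 - clamp01 (5 * t - 2)) * coeff_fun (shear_pullback (clamp01 (2 - 5 * t)) 0 g0) i j x
      + clamp01 (5 * t - 2) * coeff_fun (shear_pullback (clamp01 (5 * t - 3)) 0 g1) i j x)" for t
    by (rule ext) (simp add: coeff_fun_def[of "base_path g0 g1 t"] base_path_def)
  show ?thesis
    unfolding eq
    by (rule jointly_smooth_add[OF jointly_smooth_mult[OF jointly_smooth_param[OF continuous_on_diff[OF continuous_on_const cl(1)]] js[OF cl(2) sm(1)]]
          jointly_smooth_mult[OF jointly_smooth_param[OF cl(1)] js[OF cl(3) sm(2)]]])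
qed

text \<open>The square of \<open>\<Prod>z\<in>Z. (x - z)\<close> vanishes to second order on \<open>Z\<close>; multiplied by \<open>x - w\<close> it has a simple
  zero at \<open>w\<close>.\<close>

lemma hermite_basis_poly:
  fixes Z :: "real set"
  assumes Z: "finite Z" "w \<notin> Z"
  obtains \<beta> where "poly \<beta> w = 0" "poly (pderiv \<beta>) w = 1" "\<And>z. z \<in> Z \<Longrightarrow> poly \<beta> z = 0" "\<And>z. z \<in> Z \<Longrightarrow> poly (pderiv \<beta>) z = 0"
proof -
  define s where "s = (\<Prod>z\<in>Z. [:- z, 1:])"
  have s: "poly s w \<noteq> 0" "\<And>z. z \<in> Z \<Longrightarrow> poly s z = 0"
    using Z by (auto simp: s_def poly_prod)
  define u where "u = [:- w, 1:]"
  have u: "poly u x = x - w" "poly (pderiv u) x = 1" for x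
    by (simp_all add: u_def pderiv_pCons)
  define \<beta> where "\<beta> = smult (1 / (poly s w * poly s w)) (s * s * u)"
  show ?thesis
    by (rule that[of \<beta>]) (use s in \<open>auto simp: \<beta>_def pderiv_smult pderiv_mult u\<close>)
qed

lemma pderiv_sum_poly: "pderiv (\<Sum>i\<in>I. f i) = (\<Sum>i\<in>I. pderiv (f i))"
  by (induction I rule: infinite_finite_induct) (simp_all add: pderiv_add)

text \<open>Here \<open>a\<close>, \<open>a'\<close> are amplitudes, \<open>s\<close>, \<open>s'\<close> the coordinates to be distinguished, and the other variables are
  contributions of the base metrics at two marked points. The first equation makes the amplitudes nearly
  equal; the second then compares at most \<open>a / 3\<close> with at least \<open>2 * a' / 3\<close>.\<close>

lemma amplitude_bound:
  fixes a a' s s' r r' u u' B :: real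
  assumes "\<bar>r\<bar> \<le> B" "\<bar>r'\<bar> \<le> B" "\<bar>u\<bar> \<le> B" "\<bar>u'\<bar> \<le> B" "0 \<le> a" "0 \<le> a'" "s \<le> 1/3" "2/3 \<le> s'"
    and "r + a = r' + a'" and "u + a * s = u' + a' * s'"
  shows "a \<le> 10 * B" "a' \<le> 8 * B"
proof -
  have "a * s \<le> a * (1/3)" "a' * (2/3) \<le> a' * s'"
    using assms(5-8) by (intro mult_left_mono; simp)+
  then show "a \<le> 10 * B" "a' \<le> 8 * B" using assms by (auto simp: abs_le_iff)
qed

text \<open>The slope of the shear is the amplitude at marked point \<open>0\<close>, which calibrates the others, and the
  amplitude times \<open>p i\<close> at marked point \<open>i\<close>. A coincidence \<open>F p = F p'\<close> of distinguished parameters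
  forces both amplitudes below their maximum by \<open>amplitude_bound\<close>, hence both times into the resting phases
  of \<open>base_path\<close>; the point \<open>z\<close> shows that it is the same phase. There the quotients at the marked points
  are exact, so the amplitude is \<open>0\<close>, and the metric is one of the ends.\<close>

lemma metric_interpolating_family:
  assumes g0: "g0 \<in> nonneg_planes" and g1: "g1 \<in> nonneg_planes" and ne: "g0 \<noteq> g1"
  shows "\<exists>F. continuous_map (top_of_set hilbert_cube) (nonneg_planes_space k) F \<and>
        (\<forall>p\<in>hilbert_cube. (p 0 = 0 \<longrightarrow> F p = g0) \<and> (p 0 = 1 \<longrightarrow> F p = g1)) \<and>
        (\<forall>p\<in>hilbert_cube. \<forall>q\<in>hilbert_cube. \<forall>i\<in>{1..n+1}.
            p i \<le> 1/3 \<longrightarrow> 2/3 \<le> q i \<longrightarrow> F p = F q \<longrightarrow> F p = g0 \<or> F p = g1)"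
proof -
  obtain z where z: "g0 z \<noteq> g1 z" using ne by blast
  have m: "riemannian_metric g0" "riemannian_metric g1" using g0 g1 by (auto simp: nonneg_planes_def)
  define \<gamma> where "\<gamma> = base_path g0 g1"
  have \<gamma>_mem: "\<gamma> t \<in> nonneg_planes" for t
    unfolding \<gamma>_def by (rule base_path_mem_nonneg_planes[OF g0 g1])
  then have \<gamma>_metric: "riemannian_metric (\<gamma> t)" for t by (simp add: nonneg_planes_def)
  \<comment> \<open>The abscissae of the marked points, distinct from each other and from that of \<open>z\<close>.\<close>
  define w where "w j = z $ 1 + 1 + real j" for j :: nat
  define W where "W j = (vector [w j, 0] :: real^2)" for j
  have W1: "W j $ 1 = w j" for j by (simp add: W_def)
  have w_inj: "w i = w j \<longleftrightarrow> i = j" for i j by (simp add: w_def)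
  have w_z: "w j \<noteq> z $ 1" for j by (simp add: w_def)
  have "\<exists>\<beta>. poly \<beta> (w j) = 0 \<and> poly (pderiv \<beta>) (w j) = 1 \<and>
     (\<forall>x\<in>insert (z $ 1) (w ` ({0..n+1} - {j})). poly \<beta> x = 0 \<and> poly (pderiv \<beta>) x = 0)" for j
    by (rule hermite_basis_poly[of "insert (z $ 1) (w ` ({0..n+1} - {j}))" "w j"]) (use w_inj w_z in auto)
  then obtain \<beta> where \<beta>: "\<And>j. poly (\<beta> j) (w j) = 0" "\<And>j. poly (pderiv (\<beta> j)) (w j) = 1"
    "\<And>j x. x \<in> insert (z $ 1) (w ` ({0..n+1} - {j})) \<Longrightarrow> poly (\<beta> j) x = 0 \<and> poly (pderiv (\<beta> j)) x = 0"
    by metis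
  define R where "R j t = coeff_fun (\<gamma> t) 1 2 (W j) / coeff_fun (\<gamma> t) 2 2 (W j)" for j t
  have pos22: "0 < coeff_fun (\<gamma> t) 2 2 x" for t x
  proof -
    have "axis 2 1 \<noteq> (0::real^2)" by (simp add: axis_eq_0_iff)
    then have "0 < metric_inner (\<gamma> t) x (axis 2 1) (axis 2 1)" using \<gamma>_metric[of t] by (simp add: riemannian_metric_def)
    then show ?thesis by (simp add: metric_inner_sum sum_2 axis_def)
  qed
  have cont_coeff: "continuous_on UNIV (\<lambda>t. coeff_fun (\<gamma> t) i j x)" for i j x
  proof -
    have "continuous_on UNIV (\<lambda>(t, x). iter_partial [] (coeff_fun (\<gamma> t) i j) x)"
      unfolding \<gamma>_def by (rule jointly_smooth_continuous[OF jointly_smooth_base_path[OF m continuous_on_id]])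
    from continuous_on_compose2[OF this continuous_on_Pair[OF continuous_on_id continuous_on_const[of UNIV x]] subset_UNIV]
    show ?thesis by simp
  qed
  have "continuous_on {0..1} (R j)" for j
  proof -
    have "continuous_on UNIV (R j)"
      unfolding R_def using pos22 by (intro continuous_on_divide cont_coeff) (metis less_irrefl)
    then show ?thesis by (rule continuous_on_subset) simp
  qed
  then have "bounded (R j ` {0..1})" for j
    by (intro compact_imp_bounded compact_continuous_image) auto
  then have "bounded (\<Union>j\<in>{0..n+1}. R j ` {0..1})" by (intro bounded_UN) auto
  then obtain B where "\<And>v. v \<in> (\<Union>j\<in>{0..n+1}. R j ` {0..1}) \<Longrightarrow> \<bar>v\<bar> \<le> B"
    unfolding bounded_real by blast
  then have B: "\<bar>R j t\<bar> \<le> B" if "j \<in> {0..n+1}" "t \<in> {0..1}" for j t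
    using that by blast
  have B0: "0 \<le> B" using B[of 0 0] by force
  \<comment> \<open>By \<open>amplitude_bound\<close> a coincidence needs amplitudes of at most \<open>10 * B\<close>; between times \<open>1/5\<close> and \<open>4/5\<close> the amplitude exceeds this bound.\<close>
  define amp where "amp t = (10 * B + 1) * (clamp01 (5 * t) * clamp01 (5 - 5 * t))" for t
  define \<sigma> where "\<sigma> i p = (if i = 0 then 1 else p i)" for i and p :: "nat \<Rightarrow> real"
  define q where "q p = (\<Sum>i\<in>{0..n+1}. smult (amp (p 0) * \<sigma> i p) (\<beta> i))" for p
  have poly_q: "poly (q p) x = (\<Sum>i\<in>{0..n+1}. amp (p 0) * \<sigma> i p * poly (\<beta> i) x)"
    "poly (pderiv (q p)) x = (\<Sum>i\<in>{0..n+1}. amp (p 0) * \<sigma> i p * poly (pderiv (\<beta> i)) x)" for p x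
    by (simp_all only: q_def poly_sum pderiv_sum_poly pderiv_smult poly_smult)
  have q_z: "poly (q p) (z $ 1) = 0" "poly (pderiv (q p)) (z $ 1) = 0" for p
    unfolding poly_q using \<beta>(3)[of "z $ 1"] by (auto intro!: sum.neutral)
  have q_w: "poly (q p) (w j) = 0" "poly (pderiv (q p)) (w j) = amp (p 0) * \<sigma> j p" if j: "j \<in> {0..n+1}" for p j
  proof -
    have o: "poly (\<beta> i) (w j) = 0 \<and> poly (pderiv (\<beta> i)) (w j) = (if i = j then 1 else 0)" if "i \<in> {0..n+1}" for i
    proof (cases "i = j")
      case True
      then show ?thesis
        using \<beta>(1,2)[of j] by auto
    next
      case False
      then have "w j \<in> insert (z $ 1) (w ` ({0..n+1} - {i}))" using j by (intro insertI2 imageI) simp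
      from \<beta>(3)[OF this] False
      show ?thesis by auto
    qed
    show "poly (q p) (w j) = 0" unfolding poly_q by (rule sum.neutral) (simp add: o)
    have "poly (pderiv (q p)) (w j) = (\<Sum>i\<in>{0..n+1}. if i = j then amp (p 0) * \<sigma> j p else 0)"
      unfolding poly_q by (rule sum.cong) (simp_all add: o)
    also have "\<dots> = amp (p 0) * \<sigma> j p" using j by (simp only: sum.delta' sum.delta finite_atLeastAtMost if_True)
    finally show "poly (pderiv (q p)) (w j) = amp (p 0) * \<sigma> j p" .
  qed
  define F where "F p = shear_pullback 1 (q p) (\<gamma> (p 0))" for p
  have cont_c: "continuous_on UNIV (\<lambda>p::nat\<Rightarrow>real. amp (p 0) * \<sigma> i p)" for i
    unfolding amp_def \<sigma>_def
    by (cases "i = 0") (auto intro!: continuous_intros continuous_clamp01 continuous_on_coordinate)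
  have js: "jointly_smooth (\<lambda>p. coeff_fun (F p) i j)" for i j
    unfolding F_def
  proof (rule jointly_smooth_shear_pullback)
    show "jointly_smooth (\<lambda>p::nat \<Rightarrow> real. coeff_fun (\<gamma> (p 0)) i j)" for i j
      unfolding \<gamma>_def by (rule jointly_smooth_base_path[OF m continuous_on_coordinate[where A = UNIV and i = 0]])
    show "jointly_smooth (\<lambda>p (x::real^2). poly (q p) (x $ 1))"
      unfolding poly_q(1) by (rule jointly_smooth_sum[OF finite_atLeastAtMost jointly_smooth_mult[OF jointly_smooth_param[OF cont_c] jointly_smooth_poly]])
    show "jointly_smooth (\<lambda>p (x::real^2). poly (pderiv (q p)) (x $ 1))"
      unfolding poly_q(2) by (rule jointly_smooth_sum[OF finite_atLeastAtMost jointly_smooth_mult[OF jointly_smooth_param[OF cont_c] jointly_smooth_poly]])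
  qed (rule continuous_on_const)
  have cont: "continuous_map (top_of_set hilbert_cube) (nonneg_planes_space k) F"
    by (rule continuous_map_nonneg_planes_space[OF js]) (simp add: F_def shear_pullback_mem_nonneg_planes \<gamma>_mem)
  have \<gamma>0: "\<gamma> t = g0" if "t \<le> 1/5" for t
    using that by (simp add: \<gamma>_def base_path_left clamp01_def)
  have \<gamma>1: "\<gamma> t = g1" if "4/5 \<le> t" for t
    using that by (simp add: \<gamma>_def base_path_right clamp01_def)
  have q0: "q p = 0" if "amp (p 0) = 0" for p
    by (simp add: q_def that)
  have ends: "F p = g0" if "p 0 = 0" for p
    using that q0[of p] \<gamma>0[of 0] by (simp add: F_def amp_def clamp01_def)
  have ends': "F p = g1" if "p 0 = 1" for p
    using that q0[of p] \<gamma>1[of 1] by (simp add: F_def amp_def clamp01_def)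
  have ratio: "coeff_fun (F p) 1 2 (W j) / coeff_fun (F p) 2 2 (W j) = R j (p 0) + amp (p 0) * \<sigma> j p" if j: "j \<in> {0..n+1}" for j p
  proof -
    have "shear_map 1 (q p) (W j) = W j"
      using q_w(1)[OF j] by (simp add: vec_eq_iff forall_2 shear_map_def W1)
    then show ?thesis
      using pos22[of "p 0" "W j"] q_w(2)[OF j, of p]
      by (simp add: F_def coeff_fun_shear_pullback R_def W1 field_simps)
  qed
  have amp_nonneg: "0 \<le> amp t" for t using B0 by (simp add: amp_def clamp01_def)
  have amp_small: "t < 1/5 \<or> 4/5 < t" if "amp t \<le> 10 * B" for t
  proof (rule ccontr)
    assume "\<not> (t < 1/5 \<or> 4/5 < t)"
    then have "clamp01 (5 * t) = 1" "clamp01 (5 - 5 * t) = 1" by (auto simp: clamp01_def)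
    then show False using that by (simp add: amp_def)
  qed
  have amp_zero: "t = 0 \<or> t = 1" if "amp t = 0" "t \<in> {0..1}" for t
  proof -
    have "clamp01 (5 * t) = 0 \<or> clamp01 (5 - 5 * t) = 0" using that(1) B0 by (simp add: amp_def)
    then show ?thesis using that(2) by (auto simp: clamp01_def max_def min_def split: if_splits)
  qed
  have Fz: "F p z = \<gamma> (p 0) z" for p
    unfolding F_def by (rule shear_pullback_id_at[OF q_z])
  have sep: "F p = g0 \<or> F p = g1"
    if p: "p \<in> hilbert_cube" and p': "p' \<in> hilbert_cube" and i: "i \<in> {1..n+1}" and pi: "p i \<le> 1/3" and pi': "2/3 \<le> p' i"
      and eq: "F p = F p'" for p p' i
  proof -
    have t: "p 0 \<in> {0..1}" "p' 0 \<in> {0..1}" using p p' by (auto simp: mem_hilbert_cube)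
    have i0: "i \<in> {0..n+1}" "0 \<in> {0..n+1}" "i \<noteq> 0" using i by auto
    have e0: "R 0 (p 0) + amp (p 0) = R 0 (p' 0) + amp (p' 0)"
      using ratio[OF i0(2), of p] ratio[OF i0(2), of p'] eq by (simp add: \<sigma>_def)
    have ei: "R i (p 0) + amp (p 0) * p i = R i (p' 0) + amp (p' 0) * p' i"
      using ratio[OF i0(1), of p] ratio[OF i0(1), of p'] eq i0(3) by (simp add: \<sigma>_def)
    have "amp (p 0) \<le> 10 * B" "amp (p' 0) \<le> 8 * B"
      by (rule amplitude_bound[OF B[OF i0(2) t(1)] B[OF i0(2) t(2)] B[OF i0(1) t(1)] B[OF i0(1) t(2)]
            amp_nonneg amp_nonneg pi pi' e0 ei])+
    then have tt: "p 0 < 1/5 \<or> 4/5 < p 0" "p' 0 < 1/5 \<or> 4/5 < p' 0"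
      using amp_small[of "p 0"] amp_small[of "p' 0"] B0 by auto
    \<comment> \<open>At \<open>z\<close> neither the shear nor its derivative has an effect.\<close>
    have "\<gamma> (p 0) z = \<gamma> (p' 0) z" using Fz[of p] Fz[of p'] eq by simp
    then have same: "\<gamma> (p 0) = \<gamma> (p' 0)"
      using tt \<gamma>0[of "p 0"] \<gamma>0[of "p' 0"] \<gamma>1[of "p 0"] \<gamma>1[of "p' 0"] z by auto
    then have "R j (p 0) = R j (p' 0)" for j by (simp add: R_def)
    with e0 ei have a: "amp (p 0) = amp (p' 0)" "amp (p 0) * p i = amp (p' 0) * p' i" by auto
    have "p i \<noteq> p' i" using pi pi' by linarith
    then have "amp (p 0) = 0" using a by auto
    from amp_zero[OF this t(1)] ends[of p] ends'[of p] show ?thesis by blast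
  qed
  show ?thesis
    using cont ends ends' sep by (intro exI[of _ F]) blast
qed

theorem theorem1p5:
  fixes k :: enat
  shows "(\<forall>S. S \<subseteq> nonneg_planes \<and> finite_dimensional (subtopology (nonneg_planes_space k) S) \<longrightarrow>
             continuum_connected_space (subtopology (nonneg_planes_space k) (nonneg_planes - S))) \<and>
         (\<forall>S. closedin (nonneg_planes_space k) S \<and>
              finite_dimensional (subtopology (nonneg_planes_space k) S) \<longrightarrow>
             path_connected_space (subtopology (nonneg_planes_space k) (nonneg_planes - S)))"
proof -
  let ?X = "nonneg_planes_space k"
  note compl = complement_of_finite_dimensional[OF Hausdorff_nonneg_planes_space, of k, unfolded topspace_nonneg_planes_space,
      OF metric_interpolating_family]
  show ?thesis
  proof (intro conjI allI impI, elim conjE)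
    fix S assume "S \<subseteq> nonneg_planes" "finite_dimensional (subtopology ?X S)"
    then show "continuum_connected_space (subtopology ?X (nonneg_planes - S))"
      by (rule compl(1)[rotated 3])
  next
    fix S assume S: "closedin ?X S \<and> finite_dimensional (subtopology ?X S)"
    then have "S \<subseteq> nonneg_planes" using closedin_subset by force
    then show "path_connected_space (subtopology ?X (nonneg_planes - S))"
      using S compl(2) by blast
  qed
qed

end
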